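(* Let $G$ be a group faisceau acting on faisceaux $X$ and $X'$, such that the action of $G$ on $X$ is free, and let $\pi\colon X\to X/G$ be the quotient faisceau. Then a faisceau $Z$ is isomorphic to the associated fibration $X\times^GX'$ if and only if there exist morphisms $\phi\colon X\times X'\to Z$ and $q\colon Z\to X/G$ with $q\phi=\pi\,\mathrm{pr}_1$ such that $\phi$ is constant on $G$-orbits and the induced morphism $$X\times X'\to X\times_{X/G}Z,\qquad (x,x')\mapsto (x,\phi(x,x')),$$ is an isomorphism.
   Context: Let $K$ be a field. A faisceau is a functor $F$ from commutative $K$-algebras to sets which is a sheaf for the fppf topology: $F(R\times S)\cong F(R)\times F(S)$, and for every faithfully flat, finitely presented $R$-algebra $S$, $F(R)$ is the equaliser of the two maps $F(S)\rightrightarrows F(S\otimes_RS)$. A group faisceau is a group object in faisceaux. $G$ acts freely on $X$ if $G(R)$ acts freely on $X(R)$ for all $R$. The quotient faisceau $X/G$ is the coequaliser, in the category of faisceaux, of the action and projection $\mu,\mathrm{pr}_2\colon G\times X\to X$; equivalently the faisceau associated to $R\mapsto X(R)/G(R)$. The associated fibration is $X\times^GX':=(X\times X')/G$ for the diagonal action of $G$ on $X\times X'$. "$\phi$ constant on $G$-orbits" means $\phi(g\cdot x,g\cdot x')=\phi(x,x')$ on $R$-valued points for all $R$. *)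

theory Defs
  imports "HOL-Algebra.Module" "HOL-Algebra.Ideal" "HOL-Library.Multiset"
begin

text \<open>
  Size conventions. The commutative K-algebras are those whose carrier lies in a type 'u (which
  also contains K); the values of functors lie in a type 'v. For infinite 'u the algebras are
  closed, up to isomorphism, under finite products, tensor products and finitely presented
  extensions. When the power set of 'u embeds into 'v, faisceaux with values in 'v are closed, up
  to isomorphism, under finite limits and under quotients by group actions, so the universal
  property of a coequaliser may be tested inside 'v. This is the usual pair of universes U in V:
  algebras in U, functors with values in the sets of V.

  Since neither 'u nor 'v is closed on the nose under products and tensor products, these are
  described up to isomorphism.
\<close>

section \<open>Commutative algebra\<close>

type_synonym 'u alg = "('u, 'u) module"

text \<open>The locale predicate \<open>algebra K A\<close> is the library's notion of a commutative K-algebra.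
  Homomorphisms are extensional, so that they are determined by their values on the carrier.\<close>

definition alg_hom :: "'u ring \<Rightarrow> 'u alg \<Rightarrow> 'u alg \<Rightarrow> ('u \<Rightarrow> 'u) set" where
  "alg_hom K A B =
     {f \<in> ring_hom A B \<inter> extensional (carrier A).
        \<forall>k\<in>carrier K. \<forall>x\<in>carrier A. f (k \<odot>\<^bsub>A\<^esub> x) = k \<odot>\<^bsub>B\<^esub> f x}"

definition mod_hom :: "'u alg \<Rightarrow> 'u alg \<Rightarrow> 'u alg \<Rightarrow> ('u \<Rightarrow> 'u) set" where
  "mod_hom R M N =
     {f \<in> carrier M \<rightarrow> carrier N.
        (\<forall>x\<in>carrier M. \<forall>y\<in>carrier M. f (x \<oplus>\<^bsub>M\<^esub> y) = f x \<oplus>\<^bsub>N\<^esub> f y) \<and>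
        (\<forall>r\<in>carrier R. \<forall>x\<in>carrier M. f (r \<odot>\<^bsub>M\<^esub> x) = r \<odot>\<^bsub>N\<^esub> f x)}"

definition bilinear_map ::
  "'u alg \<Rightarrow> 'u alg \<Rightarrow> 'u alg \<Rightarrow> 'u alg \<Rightarrow> ('u \<Rightarrow> 'u \<Rightarrow> 'u) \<Rightarrow> bool" where
  "bilinear_map R M N P b \<longleftrightarrow>
     (\<forall>x\<in>carrier M. b x \<in> mod_hom R N P) \<and>
     (\<forall>y\<in>carrier N. (\<lambda>x. b x y) \<in> mod_hom R M P)"

definition is_tensor ::
  "'u alg \<Rightarrow> 'u alg \<Rightarrow> 'u alg \<Rightarrow> 'u alg \<Rightarrow> ('u \<Rightarrow> 'u \<Rightarrow> 'u) \<Rightarrow> bool" where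
  "is_tensor R M N T t \<longleftrightarrow>
     module R M \<and> module R N \<and> module R T \<and> bilinear_map R M N T t \<and>
     (\<forall>P b. module R P \<and> bilinear_map R M N P b \<longrightarrow>
        (\<exists>!h. h \<in> mod_hom R T P \<inter> extensional (carrier T) \<and>
              (\<forall>x\<in>carrier M. \<forall>y\<in>carrier N. h (t x y) = b x y)))"

text \<open>The target of a ring homomorphism \<open>\<phi>\<close>, regarded as a module over the source; the K-algebra
  scalar multiplication is overwritten.\<close>

definition along :: "('u \<Rightarrow> 'u) \<Rightarrow> 'u alg \<Rightarrow> 'u alg" where
  "along \<phi> S = S\<lparr>smult := \<lambda>r s. \<phi> r \<otimes>\<^bsub>S\<^esub> s\<rparr>"

definition flat :: "'u alg \<Rightarrow> 'u alg \<Rightarrow> bool" where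
  "flat R S \<longleftrightarrow>
     module R S \<and>
     (\<forall>M N f T1 t1 T2 t2 h.
        module R M \<and> module R N \<and> f \<in> mod_hom R M N \<and> inj_on f (carrier M) \<and>
        is_tensor R S M T1 t1 \<and> is_tensor R S N T2 t2 \<and> h \<in> mod_hom R T1 T2 \<and>
        (\<forall>s\<in>carrier S. \<forall>x\<in>carrier M. h (t1 s x) = t2 s (f x))
        \<longrightarrow> inj_on h (carrier T1))"

definition faithfully_flat :: "'u alg \<Rightarrow> 'u alg \<Rightarrow> bool" where
  "faithfully_flat R S \<longleftrightarrow>
     flat R S \<and>
     (\<forall>M T t. is_tensor R S M T t \<and> carrier T = {\<zero>\<^bsub>T\<^esub>} \<longrightarrow> carrier M = {\<zero>\<^bsub>M\<^esub>})"

text \<open>The polynomial ring over R in the variables with index below n; a monomial is a multiset of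
  variables and a polynomial is its coefficient function.\<close>

definition mpoly_ring :: "'u alg \<Rightarrow> nat \<Rightarrow> (nat multiset \<Rightarrow> 'u) ring" where
  "mpoly_ring R n =
     \<lparr>carrier = {p. (\<forall>m. p m \<in> carrier R) \<and> finite {m. p m \<noteq> \<zero>\<^bsub>R\<^esub>} \<and>
                    (\<forall>m. p m \<noteq> \<zero>\<^bsub>R\<^esub> \<longrightarrow> set_mset m \<subseteq> {..<n})},
      monoid.mult = (\<lambda>p q m. \<Oplus>\<^bsub>R\<^esub>k\<in>{k. k \<subseteq># m}. p k \<otimes>\<^bsub>R\<^esub> q (m - k)),
      one = (\<lambda>m. if m = {#} then \<one>\<^bsub>R\<^esub> else \<zero>\<^bsub>R\<^esub>),
      ring.zero = (\<lambda>m. \<zero>\<^bsub>R\<^esub>),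
      ring.add = (\<lambda>p q m. p m \<oplus>\<^bsub>R\<^esub> q m)\<rparr>"

definition finitely_presented :: "'u alg \<Rightarrow> 'u alg \<Rightarrow> ('u \<Rightarrow> 'u) \<Rightarrow> bool" where
  "finitely_presented R S \<phi> \<longleftrightarrow>
     (\<exists>n h J. h \<in> ring_hom (mpoly_ring R n) S \<and>
        h ` carrier (mpoly_ring R n) = carrier S \<and>
        (\<forall>r\<in>carrier R. h (\<lambda>m. if m = {#} then r else \<zero>\<^bsub>R\<^esub>) = \<phi> r) \<and>
        finite J \<and> J \<subseteq> carrier (mpoly_ring R n) \<and>
        a_kernel (mpoly_ring R n) S h = genideal (mpoly_ring R n) J)"

definition fppf_cover :: "'u ring \<Rightarrow> 'u alg \<Rightarrow> 'u alg \<Rightarrow> ('u \<Rightarrow> 'u) \<Rightarrow> bool" where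
  "fppf_cover K R S \<phi> \<longleftrightarrow>
     algebra K R \<and> algebra K S \<and> \<phi> \<in> alg_hom K R S \<and>
     faithfully_flat R (along \<phi> S) \<and> finitely_presented R S \<phi>"

text \<open>P, with projections p1 and p2, is the product algebra of A and B.\<close>

definition is_alg_prod ::
  "'u ring \<Rightarrow> 'u alg \<Rightarrow> 'u alg \<Rightarrow> 'u alg \<Rightarrow> ('u \<Rightarrow> 'u) \<Rightarrow> ('u \<Rightarrow> 'u) \<Rightarrow> bool" where
  "is_alg_prod K A B P p1 p2 \<longleftrightarrow>
     algebra K A \<and> algebra K B \<and> algebra K P \<and> p1 \<in> alg_hom K P A \<and> p2 \<in> alg_hom K P B \<and>
     bij_betw (\<lambda>z. (p1 z, p2 z)) (carrier P) (carrier A \<times> carrier B)"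

text \<open>T is the tensor product of S with itself over R, with i1 s playing the role of the tensor of
  s with 1, and i2 s that of the tensor of 1 with s.\<close>

definition is_self_tensor ::
  "'u ring \<Rightarrow> 'u alg \<Rightarrow> 'u alg \<Rightarrow> ('u \<Rightarrow> 'u) \<Rightarrow> 'u alg \<Rightarrow> ('u \<Rightarrow> 'u) \<Rightarrow> ('u \<Rightarrow> 'u) \<Rightarrow> bool" where
  "is_self_tensor K R S \<phi> T i1 i2 \<longleftrightarrow>
     algebra K T \<and> i1 \<in> alg_hom K S T \<and> i2 \<in> alg_hom K S T \<and>
     is_tensor R (along \<phi> S) (along \<phi> S) (along (i1 \<circ> \<phi>) T) (\<lambda>a b. i1 a \<otimes>\<^bsub>T\<^esub> i2 b)"

section \<open>Functors on K-algebras and faisceaux\<close>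

record ('u, 'v) kfunctor =
  obj :: "'u alg \<Rightarrow> 'v set"
  arr :: "'u alg \<Rightarrow> 'u alg \<Rightarrow> ('u \<Rightarrow> 'u) \<Rightarrow> 'v \<Rightarrow> 'v"

definition is_functor :: "'u ring \<Rightarrow> ('u, 'v) kfunctor \<Rightarrow> bool" where
  "is_functor K F \<longleftrightarrow>
     (\<forall>A B f. algebra K A \<and> algebra K B \<and> f \<in> alg_hom K A B \<longrightarrow>
        arr F A B f \<in> obj F A \<rightarrow> obj F B) \<and>
     (\<forall>A. algebra K A \<longrightarrow> (\<forall>x\<in>obj F A. arr F A A (\<lambda>a\<in>carrier A. a) x = x)) \<and>
     (\<forall>A B C f g. algebra K A \<and> algebra K B \<and> algebra K C \<and>
        f \<in> alg_hom K A B \<and> g \<in> alg_hom K B C \<longrightarrow>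
        (\<forall>x\<in>obj F A. arr F A C (compose (carrier A) g f) x = arr F B C g (arr F A B f x)))"

text \<open>Only binary products occur in the product condition, so the functor with all values empty
  is a faisceau.\<close>

definition faisceau :: "'u ring \<Rightarrow> ('u, 'v) kfunctor \<Rightarrow> bool" where
  "faisceau K F \<longleftrightarrow>
     is_functor K F \<and>
     (\<forall>A B P p1 p2. is_alg_prod K A B P p1 p2 \<longrightarrow>
        bij_betw (\<lambda>z. (arr F P A p1 z, arr F P B p2 z)) (obj F P) (obj F A \<times> obj F B)) \<and>
     (\<forall>R S \<phi> T i1 i2. fppf_cover K R S \<phi> \<and> is_self_tensor K R S \<phi> T i1 i2 \<longrightarrow>
        bij_betw (arr F R S \<phi>) (obj F R) {s \<in> obj F S. arr F S T i1 s = arr F S T i2 s})"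

type_synonym ('u, 'v, 'w) nat_map = "'u alg \<Rightarrow> 'v \<Rightarrow> 'w"

definition nat_trans ::
  "'u ring \<Rightarrow> ('u, 'v) kfunctor \<Rightarrow> ('u, 'w) kfunctor \<Rightarrow> ('u, 'v, 'w) nat_map \<Rightarrow> bool" where
  "nat_trans K F F' \<eta> \<longleftrightarrow>
     (\<forall>A. algebra K A \<longrightarrow> \<eta> A \<in> obj F A \<rightarrow> obj F' A) \<and>
     (\<forall>A B f. algebra K A \<and> algebra K B \<and> f \<in> alg_hom K A B \<longrightarrow>
        (\<forall>x\<in>obj F A. \<eta> B (arr F A B f x) = arr F' A B f (\<eta> A x)))"

text \<open>Equality of two natural transformations with source F: their values elsewhere are junk.\<close>

definition nat_eq ::
  "'u ring \<Rightarrow> ('u, 'v) kfunctor \<Rightarrow> ('u, 'v, 'w) nat_map \<Rightarrow> ('u, 'v, 'w) nat_map \<Rightarrow> bool" where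
  "nat_eq K F \<eta> \<theta> \<longleftrightarrow> (\<forall>A. algebra K A \<longrightarrow> (\<forall>x\<in>obj F A. \<eta> A x = \<theta> A x))"

definition nat_comp ::
  "('u, 'w, 'x) nat_map \<Rightarrow> ('u, 'v, 'w) nat_map \<Rightarrow> ('u, 'v, 'x) nat_map" where
  "nat_comp \<theta> \<eta> = (\<lambda>A x. \<theta> A (\<eta> A x))"

definition nat_iso ::
  "'u ring \<Rightarrow> ('u, 'v) kfunctor \<Rightarrow> ('u, 'w) kfunctor \<Rightarrow> ('u, 'v, 'w) nat_map \<Rightarrow> bool" where
  "nat_iso K F F' \<eta> \<longleftrightarrow>
     nat_trans K F F' \<eta> \<and>
     (\<exists>\<theta>. nat_trans K F' F \<theta> \<and>
        nat_eq K F (nat_comp \<theta> \<eta>) (\<lambda>A x. x) \<and> nat_eq K F' (nat_comp \<eta> \<theta>) (\<lambda>A y. y))"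

definition isomorphic :: "'u ring \<Rightarrow> ('u, 'v) kfunctor \<Rightarrow> ('u, 'w) kfunctor \<Rightarrow> bool" where
  "isomorphic K F F' \<longleftrightarrow> (\<exists>\<eta>. nat_iso K F F' \<eta>)"

definition prod_fun ::
  "('u, 'v) kfunctor \<Rightarrow> ('u, 'w) kfunctor \<Rightarrow> ('u, 'v \<times> 'w) kfunctor" where
  "prod_fun F F' =
     \<lparr>obj = (\<lambda>A. obj F A \<times> obj F' A),
      arr = (\<lambda>A B f. map_prod (arr F A B f) (arr F' A B f))\<rparr>"

definition fibre_prod ::
  "('u, 'v) kfunctor \<Rightarrow> ('u, 'v, 'x) nat_map \<Rightarrow> ('u, 'w) kfunctor \<Rightarrow> ('u, 'w, 'x) nat_map \<Rightarrow>
   ('u, 'v \<times> 'w) kfunctor" where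
  "fibre_prod F \<alpha> F' \<beta> =
     \<lparr>obj = (\<lambda>A. {(x, y) \<in> obj F A \<times> obj F' A. \<alpha> A x = \<beta> A y}),
      arr = (\<lambda>A B f. map_prod (arr F A B f) (arr F' A B f))\<rparr>"

text \<open>Coequaliser, in the category of faisceaux with values in 'q, of a pair of morphisms from Y
  to X.\<close>

definition is_coequaliser ::
  "'u ring \<Rightarrow> ('u, 'y) kfunctor \<Rightarrow> ('u, 'x) kfunctor \<Rightarrow>
   ('u, 'y, 'x) nat_map \<Rightarrow> ('u, 'y, 'x) nat_map \<Rightarrow>
   ('u, 'q) kfunctor \<Rightarrow> ('u, 'x, 'q) nat_map \<Rightarrow> bool" where
  "is_coequaliser K Y X \<alpha> \<beta> Q \<pi> \<longleftrightarrow>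
     faisceau K Q \<and> nat_trans K X Q \<pi> \<and> nat_eq K Y (nat_comp \<pi> \<alpha>) (nat_comp \<pi> \<beta>) \<and>
     (\<forall>(T :: ('u, 'q) kfunctor) f.
        faisceau K T \<and> nat_trans K X T f \<and> nat_eq K Y (nat_comp f \<alpha>) (nat_comp f \<beta>) \<longrightarrow>
        (\<exists>h. nat_trans K Q T h \<and> nat_eq K X (nat_comp h \<pi>) f \<and>
           (\<forall>h'. nat_trans K Q T h' \<and> nat_eq K X (nat_comp h' \<pi>) f \<longrightarrow> nat_eq K Q h' h)))"

section \<open>Group faisceaux, actions and quotients\<close>

text \<open>A group object, given by its multiplication m and unit e; naturality of the unit and of the
  inverse follows from that of m.\<close>

definition group_faisceau ::
  "'u ring \<Rightarrow> ('u, 'g) kfunctor \<Rightarrow> ('u alg \<Rightarrow> 'g \<Rightarrow> 'g \<Rightarrow> 'g) \<Rightarrow> ('u alg \<Rightarrow> 'g) \<Rightarrow> bool" where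
  "group_faisceau K G m e \<longleftrightarrow>
     faisceau K G \<and> nat_trans K (prod_fun G G) G (\<lambda>A (g, h). m A g h) \<and>
     (\<forall>A. algebra K A \<longrightarrow> group \<lparr>carrier = obj G A, monoid.mult = m A, one = e A\<rparr>)"

definition group_faisceau_action ::
  "'u ring \<Rightarrow> ('u, 'g) kfunctor \<Rightarrow> ('u alg \<Rightarrow> 'g \<Rightarrow> 'g \<Rightarrow> 'g) \<Rightarrow> ('u alg \<Rightarrow> 'g) \<Rightarrow>
   ('u, 'x) kfunctor \<Rightarrow> ('u alg \<Rightarrow> 'g \<Rightarrow> 'x \<Rightarrow> 'x) \<Rightarrow> bool" where
  "group_faisceau_action K G m e X a \<longleftrightarrow>
     nat_trans K (prod_fun G X) X (\<lambda>A (g, x). a A g x) \<and>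
     (\<forall>A. algebra K A \<longrightarrow>
        (\<forall>x\<in>obj X A. a A (e A) x = x \<and>
           (\<forall>g\<in>obj G A. \<forall>h\<in>obj G A. a A (m A g h) x = a A g (a A h x))))"

definition free_action ::
  "'u ring \<Rightarrow> ('u, 'g) kfunctor \<Rightarrow> ('u alg \<Rightarrow> 'g) \<Rightarrow>
   ('u, 'x) kfunctor \<Rightarrow> ('u alg \<Rightarrow> 'g \<Rightarrow> 'x \<Rightarrow> 'x) \<Rightarrow> bool" where
  "free_action K G e X a \<longleftrightarrow>
     (\<forall>A. algebra K A \<longrightarrow> (\<forall>g\<in>obj G A. \<forall>x\<in>obj X A. a A g x = x \<longrightarrow> g = e A))"

definition quotient_faisceau ::
  "'u ring \<Rightarrow> ('u, 'g) kfunctor \<Rightarrow> ('u, 'x) kfunctor \<Rightarrow> ('u alg \<Rightarrow> 'g \<Rightarrow> 'x \<Rightarrow> 'x) \<Rightarrow>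
   ('u, 'q) kfunctor \<Rightarrow> ('u, 'x, 'q) nat_map \<Rightarrow> bool" where
  "quotient_faisceau K G X a Q \<pi> \<longleftrightarrow>
     is_coequaliser K (prod_fun G X) X (\<lambda>A (g, x). a A g x) (\<lambda>A (g, x). x) Q \<pi>"

definition associated_fibration ::
  "'u ring \<Rightarrow> ('u, 'g) kfunctor \<Rightarrow>
   ('u, 'x) kfunctor \<Rightarrow> ('u alg \<Rightarrow> 'g \<Rightarrow> 'x \<Rightarrow> 'x) \<Rightarrow>
   ('u, 'y) kfunctor \<Rightarrow> ('u alg \<Rightarrow> 'g \<Rightarrow> 'y \<Rightarrow> 'y) \<Rightarrow>
   ('u, 'q) kfunctor \<Rightarrow> ('u, 'x \<times> 'y, 'q) nat_map \<Rightarrow> bool" where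
  "associated_fibration K G X a X' a' E \<rho> \<longleftrightarrow>
     quotient_faisceau K G (prod_fun X X') (\<lambda>A g (x, x'). (a A g x, a' A g x')) E \<rho>"

definition constant_on_orbits ::
  "'u ring \<Rightarrow> ('u, 'g) kfunctor \<Rightarrow>
   ('u, 'x) kfunctor \<Rightarrow> ('u alg \<Rightarrow> 'g \<Rightarrow> 'x \<Rightarrow> 'x) \<Rightarrow>
   ('u, 'y) kfunctor \<Rightarrow> ('u alg \<Rightarrow> 'g \<Rightarrow> 'y \<Rightarrow> 'y) \<Rightarrow>
   ('u, 'x \<times> 'y, 'z) nat_map \<Rightarrow> bool" where
  "constant_on_orbits K G X a X' a' \<phi> \<longleftrightarrow>
     (\<forall>A. algebra K A \<longrightarrow>
        (\<forall>g\<in>obj G A. \<forall>x\<in>obj X A. \<forall>x'\<in>obj X' A. \<phi> A (a A g x, a' A g x') = \<phi> A (x, x')))"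

end

theory Submission
  imports Defs "HOL-Algebra.QuotRing"
begin

text \<open>
  The quotient map of an action is locally surjective, because the subsheaf of the target generated
  by its image has the same universal property. If the action on \<open>X\<close> is free, the quotient is
  effective: the orbit of a section of \<open>X\<close> over \<open>A\<close> is, by freeness, a subsheaf of \<open>X\<close> restricted
  to \<open>A\<close>-algebras, so sending a section to its orbit is an invariant map to the sheaf of such
  subsheaves which separates orbits. Given both facts, \<open>(x, x') \<mapsto> (x, \<rho>(x, x'))\<close> is injective since the
  stabilisers in \<open>X\<close> are trivial, and surjective since a section \<open>z\<close> over \<open>\<pi>(x)\<close> is locally
  \<open>\<rho>(g y, g y')\<close> with \<open>g y = x\<close>. Conversely, if \<open>(x, x') \<mapsto> (x, \<phi>(x, x'))\<close> is an isomorphism, then \<open>\<phi>\<close> is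
  locally surjective, being a pullback of \<open>\<pi>\<close>, and its fibres are the orbits, so it is a coequaliser.

  Both facts rest on the stability of fppf covers under base change.
\<close>

section \<open>Tensor products\<close>

text \<open>The obstacle is size. The universal property of a quotient speaks only of faisceaux with
  values in \<open>'v\<close>, and the modules that test flatness or a tensor product live in
  \<open>'u\<close>, so an auxiliary object is of use only once it has been coded into the right
  type. This is what the injections obtained from the infinitude of \<open>'u\<close>, and from the
  embedding of \<open>'u set\<close> into \<open>'v\<close>, are for. It also explains why no
  sheafification occurs: an associated sheaf would have to be constructed and coded, whereas a
  subsheaf generated inside a given sheaf exists at once, and its sections are coded by the way they
  are generated.

  The faisceau condition is traded for a sheaf condition with matching families over all common
  refinements, in which no fibre product has to be chosen. Flatness and finite presentation enter
  only through the restriction of covers along arbitrary algebra homomorphisms.\<close>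

lemma infinite_inj_pair:
  assumes "infinite (UNIV :: 'u set)"
  shows "\<exists>f :: 'u \<times> 'u \<Rightarrow> 'u. inj f"
proof -
  show ?thesis
    using card_of_Times_same_infinite[OF assms] card_of_ordIso[symmetric] bij_betw_imp_inj_on
    by (metis UNIV_Times_UNIV)
qed

text \<open>On lists of a fixed length, folding an injective pairing is already injective. Lists of
  different lengths could collide through the seed \<open>k 0\<close>, so the length is stored as
  well, by means of an embedding \<open>k\<close> of the naturals.\<close>

lemma infinite_inj_lists:
  assumes "infinite (UNIV :: 'u set)"
  shows "\<exists>f :: 'u list \<Rightarrow> 'u. inj f"
proof -
  obtain g :: "'u \<times> 'u \<Rightarrow> 'u" and k :: "nat \<Rightarrow> 'u" where g: "inj g" and k: "inj k"
    using infinite_inj_pair[OF assms] infinite_countable_subset[OF assms] by blast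
  define h where "h = (\<lambda>xs. foldr (\<lambda>x z. g (x, z)) xs (k 0))"
  have "xs = ys" if "length xs = length ys" "h xs = h ys" for xs ys
    using that by (induction xs ys rule: list_induct2) (auto simp: h_def inj_eq[OF g])
  then have "inj (\<lambda>xs. g (k (length xs), h xs))"
    by (intro injI) (auto simp: inj_eq[OF g] inj_eq[OF k])
  then show ?thesis by blast
qed

lemma infinite_inj_pair_lists:
  assumes "infinite (UNIV :: 'u set)"
  shows "\<exists>f :: ('u \<times> 'u) list \<Rightarrow> 'u. inj f"
proof -
  obtain f :: "'u list \<Rightarrow> 'u" and g :: "'u \<times> 'u \<Rightarrow> 'u" where "inj f" "inj g"
    using infinite_inj_lists[OF assms] infinite_inj_pair[OF assms] by blast
  then have "inj (f \<circ> map g)" by (intro inj_compose) auto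
  then show ?thesis by blast
qed

text \<open>Each class is represented by a chosen member, which \<open>enc\<close> turns into an
  element of \<open>'u\<close>. The choice depends only on the predicate \<open>r x\<close>, and
  equivalent elements have equal predicates. This is how quotients are formed without leaving
  \<open>'u\<close>.\<close>

lemma quotient_map_exists:
  fixes enc :: "'b \<Rightarrow> 'u"
  assumes "inj_on enc C" "\<And>x. x \<in> C \<Longrightarrow> r x x" "\<And>x y. r x y \<Longrightarrow> r y x"
    "\<And>x y z. r x y \<Longrightarrow> r y z \<Longrightarrow> r x z" "\<And>x y. r x y \<Longrightarrow> x \<in> C"
  shows "\<exists>\<kappa> :: 'b \<Rightarrow> 'u. \<forall>x\<in>C. \<forall>y\<in>C. \<kappa> x = \<kappa> y \<longleftrightarrow> r x y"
proof (intro exI ballI)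
  fix x y assume xy: "x \<in> C" "y \<in> C"
  have sx: "r x (SOME z. r x z)" "r y (SOME z. r y z)" using xy assms(2) by (metis someI)+
  then have C: "(SOME z. r x z) \<in> C" "(SOME z. r y z) \<in> C" using assms(3,5) by blast+
  show "enc (SOME z. r x z) = enc (SOME z. r y z) \<longleftrightarrow> r x y"
  proof
    assume "enc (SOME z. r x z) = enc (SOME z. r y z)"
    then have "(SOME z. r x z) = (SOME z. r y z)" using assms(1) C by (simp add: inj_on_eq_iff)
    then show "r x y" using sx assms(3,4) by metis
  next
    assume "r x y"
    then have "r x = r y" using assms(3,4) by (intro ext iffI) metis+
    then show "enc (SOME z. r x z) = enc (SOME z. r y z)" by simp
  qed
qed

text \<open>The structure of \<open>L\<close> is pushed forward along \<open>\<kappa>\<close>, which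
  need not be injective and plays the role of a quotient map. Operations are computed on preimages
  picked by \<open>inv_into\<close>; the choice is immaterial as soon as the fibres of
  \<open>\<kappa>\<close> form a congruence.\<close>

definition transp :: "('b \<Rightarrow> 'u) \<Rightarrow> ('r, 'b) module \<Rightarrow> ('r, 'u) module" where
  "transp \<kappa> L =
     \<lparr>carrier = \<kappa> ` carrier L,
      monoid.mult = (\<lambda>x y. \<kappa> (inv_into (carrier L) \<kappa> x \<otimes>\<^bsub>L\<^esub> inv_into (carrier L) \<kappa> y)),
      one = \<kappa> \<one>\<^bsub>L\<^esub>,
      ring.zero = \<kappa> \<zero>\<^bsub>L\<^esub>,
      ring.add = (\<lambda>x y. \<kappa> (inv_into (carrier L) \<kappa> x \<oplus>\<^bsub>L\<^esub> inv_into (carrier L) \<kappa> y)),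
      smult = (\<lambda>r x. \<kappa> (r \<odot>\<^bsub>L\<^esub> inv_into (carrier L) \<kappa> x))\<rparr>"

lemma transp_simps:
  "carrier (transp \<kappa> L) = \<kappa> ` carrier L" "\<one>\<^bsub>transp \<kappa> L\<^esub> = \<kappa> \<one>\<^bsub>L\<^esub>" "\<zero>\<^bsub>transp \<kappa> L\<^esub> = \<kappa> \<zero>\<^bsub>L\<^esub>"
  by (simp_all add: transp_def)

lemma transp_bin:
  assumes cong: "\<And>a a' b b'. \<lbrakk>a \<in> C; a' \<in> C; b \<in> C; b' \<in> C; \<kappa> a = \<kappa> a'; \<kappa> b = \<kappa> b'\<rbrakk>
      \<Longrightarrow> \<kappa> (f a b) = \<kappa> (f a' b')"
    and "a \<in> C" "b \<in> C"
  shows "\<kappa> (f (inv_into C \<kappa> (\<kappa> a)) (inv_into C \<kappa> (\<kappa> b))) = \<kappa> (f a b)"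
  by (rule cong) (use assms(2,3) in \<open>auto simp: f_inv_into_f inv_into_into\<close>)

lemma transp_un:
  assumes cong: "\<And>a a'. \<lbrakk>a \<in> C; a' \<in> C; \<kappa> a = \<kappa> a'\<rbrakk> \<Longrightarrow> f a = f a'"
    and "a \<in> C"
  shows "f (inv_into C \<kappa> (\<kappa> a)) = f a"
  by (rule cong) (use assms(2) in \<open>auto simp: f_inv_into_f inv_into_into\<close>)

text \<open>The laws are only required modulo \<open>\<kappa>\<close>, so that \<open>L\<close> may be a free structure.\<close>

locale raw_module =
  fixes R :: "('r, 'm) ring_scheme" and L :: "('r, 'b) module" and \<kappa> :: "'b \<Rightarrow> 'u"
  assumes cr: "cring R"
    and add_closed: "\<lbrakk>a \<in> carrier L; b \<in> carrier L\<rbrakk> \<Longrightarrow> a \<oplus>\<^bsub>L\<^esub> b \<in> carrier L"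
    and zero_closed: "\<zero>\<^bsub>L\<^esub> \<in> carrier L"
    and smult_closed: "\<lbrakk>r \<in> carrier R; a \<in> carrier L\<rbrakk> \<Longrightarrow> r \<odot>\<^bsub>L\<^esub> a \<in> carrier L"
    and add_cong: "\<lbrakk>a \<in> carrier L; a' \<in> carrier L; b \<in> carrier L; b' \<in> carrier L;
        \<kappa> a = \<kappa> a'; \<kappa> b = \<kappa> b'\<rbrakk> \<Longrightarrow> \<kappa> (a \<oplus>\<^bsub>L\<^esub> b) = \<kappa> (a' \<oplus>\<^bsub>L\<^esub> b')"
    and smult_cong: "\<lbrakk>r \<in> carrier R; a \<in> carrier L; a' \<in> carrier L; \<kappa> a = \<kappa> a'\<rbrakk>
        \<Longrightarrow> \<kappa> (r \<odot>\<^bsub>L\<^esub> a) = \<kappa> (r \<odot>\<^bsub>L\<^esub> a')"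
    and a_assoc: "\<lbrakk>a \<in> carrier L; b \<in> carrier L; c \<in> carrier L\<rbrakk>
        \<Longrightarrow> \<kappa> ((a \<oplus>\<^bsub>L\<^esub> b) \<oplus>\<^bsub>L\<^esub> c) = \<kappa> (a \<oplus>\<^bsub>L\<^esub> (b \<oplus>\<^bsub>L\<^esub> c))"
    and a_comm: "\<lbrakk>a \<in> carrier L; b \<in> carrier L\<rbrakk> \<Longrightarrow> \<kappa> (a \<oplus>\<^bsub>L\<^esub> b) = \<kappa> (b \<oplus>\<^bsub>L\<^esub> a)"
    and l_zero: "a \<in> carrier L \<Longrightarrow> \<kappa> (\<zero>\<^bsub>L\<^esub> \<oplus>\<^bsub>L\<^esub> a) = \<kappa> a"
    and l_inv: "a \<in> carrier L \<Longrightarrow> \<exists>b\<in>carrier L. \<kappa> (b \<oplus>\<^bsub>L\<^esub> a) = \<kappa> \<zero>\<^bsub>L\<^esub>"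
    and s_l: "\<lbrakk>r \<in> carrier R; s \<in> carrier R; a \<in> carrier L\<rbrakk>
        \<Longrightarrow> \<kappa> ((r \<oplus>\<^bsub>R\<^esub> s) \<odot>\<^bsub>L\<^esub> a) = \<kappa> (r \<odot>\<^bsub>L\<^esub> a \<oplus>\<^bsub>L\<^esub> s \<odot>\<^bsub>L\<^esub> a)"
    and s_r: "\<lbrakk>r \<in> carrier R; a \<in> carrier L; b \<in> carrier L\<rbrakk>
        \<Longrightarrow> \<kappa> (r \<odot>\<^bsub>L\<^esub> (a \<oplus>\<^bsub>L\<^esub> b)) = \<kappa> (r \<odot>\<^bsub>L\<^esub> a \<oplus>\<^bsub>L\<^esub> r \<odot>\<^bsub>L\<^esub> b)"
    and s_assoc: "\<lbrakk>r \<in> carrier R; s \<in> carrier R; a \<in> carrier L\<rbrakk>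
        \<Longrightarrow> \<kappa> ((r \<otimes>\<^bsub>R\<^esub> s) \<odot>\<^bsub>L\<^esub> a) = \<kappa> (r \<odot>\<^bsub>L\<^esub> (s \<odot>\<^bsub>L\<^esub> a))"
    and s_one: "a \<in> carrier L \<Longrightarrow> \<kappa> (\<one>\<^bsub>R\<^esub> \<odot>\<^bsub>L\<^esub> a) = \<kappa> a"
begin

lemma add_transp: "\<lbrakk>a \<in> carrier L; b \<in> carrier L\<rbrakk> \<Longrightarrow> \<kappa> a \<oplus>\<^bsub>transp \<kappa> L\<^esub> \<kappa> b = \<kappa> (a \<oplus>\<^bsub>L\<^esub> b)"
  unfolding transp_def by (simp, rule transp_bin, rule add_cong)

lemma smult_transp: "\<lbrakk>r \<in> carrier R; a \<in> carrier L\<rbrakk> \<Longrightarrow> r \<odot>\<^bsub>transp \<kappa> L\<^esub> \<kappa> a = \<kappa> (r \<odot>\<^bsub>L\<^esub> a)"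
  unfolding transp_def
  by (simp, rule transp_un[where f = "\<lambda>a. \<kappa> (r \<odot>\<^bsub>L\<^esub> a)"]) (rule smult_cong)

lemma abelian_group_transp: "abelian_group (transp \<kappa> L)"
proof (rule abelian_groupI, goal_cases)
  case (6 x)
  then obtain a where a: "a \<in> carrier L" "x = \<kappa> a" by (auto simp: transp_simps)
  then obtain b where "b \<in> carrier L" "\<kappa> (b \<oplus>\<^bsub>L\<^esub> a) = \<kappa> \<zero>\<^bsub>L\<^esub>" using l_inv by blast
  then show ?case using a by (intro bexI[of _ "\<kappa> b"]) (auto simp: add_transp transp_simps)
qed (auto simp: transp_simps add_transp add_closed zero_closed a_assoc l_zero intro: a_comm)

lemma module_transp: "module R (transp \<kappa> L)"
proof -
  interpret R: cring R by (rule cr)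
  show ?thesis
    by (rule moduleI[OF cr abelian_group_transp])
      (auto simp: transp_simps add_transp smult_transp add_closed smult_closed s_l s_r s_assoc s_one)
qed

end

text \<open>A list of pairs stands for a formal sum of pure tensors, and \<open>tev P b\<close> is
  the value that a bilinear map \<open>b\<close> into \<open>P\<close> assigns to it.\<close>

definition tev :: "('u, 'x) ring_scheme \<Rightarrow> ('a \<Rightarrow> 'b \<Rightarrow> 'u) \<Rightarrow> ('a \<times> 'b) list \<Rightarrow> 'u" where
  "tev P b X = foldr (\<lambda>(x, y) c. b x y \<oplus>\<^bsub>P\<^esub> c) X \<zero>\<^bsub>P\<^esub>"

lemma tev_simps [simp]:
  "tev P b [] = \<zero>\<^bsub>P\<^esub>" "tev P b (p # X) = b (fst p) (snd p) \<oplus>\<^bsub>P\<^esub> tev P b X"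
  by (simp_all add: tev_def case_prod_beta)

lemma tev_closed:
  assumes "abelian_monoid P" "\<And>x y. \<lbrakk>x \<in> A; y \<in> B\<rbrakk> \<Longrightarrow> b x y \<in> carrier P" "X \<in> lists (A \<times> B)"
  shows "tev P b X \<in> carrier P"
  using assms(3)
  by induction
    (auto intro!: abelian_monoid.a_closed[OF assms(1)] abelian_monoid.zero_closed[OF assms(1)] assms(2))

lemma tev_append:
  assumes "abelian_monoid P" "\<And>x y. \<lbrakk>x \<in> A; y \<in> B\<rbrakk> \<Longrightarrow> b x y \<in> carrier P"
    "X \<in> lists (A \<times> B)" "Y \<in> lists (A \<times> B)"
  shows "tev P b (X @ Y) = tev P b X \<oplus>\<^bsub>P\<^esub> tev P b Y"
  using assms(3)
proof induction
  case Nil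
  then show ?case using tev_closed[OF assms(1,2,4)] by (simp add: abelian_monoid.l_zero[OF assms(1)])
next
  case (Cons p X)
  have "tev P b X \<in> carrier P" "tev P b Y \<in> carrier P"
    by (rule tev_closed[OF assms(1) _ Cons(2)] tev_closed[OF assms(1) _ assms(4)], use assms in blast)+
  then show ?case using Cons
    by (auto simp: abelian_monoid.a_assoc[OF assms(1)] assms(2))
qed

lemma tev_map: "tev P b (map f X) = tev P (\<lambda>x y. b (fst (f (x, y))) (snd (f (x, y)))) X"
  by (induction X) auto

lemma tev_cong:
  assumes "X \<in> lists (A \<times> B)" "\<And>x y. \<lbrakk>x \<in> A; y \<in> B\<rbrakk> \<Longrightarrow> b x y = c x y"
  shows "tev P b X = tev P c X"
  using assms(1) by induction (auto simp: assms(2))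

lemma tev_zero: "abelian_monoid P \<Longrightarrow> tev P (\<lambda>x y. \<zero>\<^bsub>P\<^esub>) X = \<zero>\<^bsub>P\<^esub>"
  by (induction X) (auto simp: abelian_monoid.l_zero abelian_monoid.zero_closed)

lemma tev_add:
  assumes "abelian_monoid P" "\<And>x y. \<lbrakk>x \<in> A; y \<in> B\<rbrakk> \<Longrightarrow> b x y \<in> carrier P"
    "\<And>x y. \<lbrakk>x \<in> A; y \<in> B\<rbrakk> \<Longrightarrow> c x y \<in> carrier P" "X \<in> lists (A \<times> B)"
  shows "tev P (\<lambda>x y. b x y \<oplus>\<^bsub>P\<^esub> c x y) X = tev P b X \<oplus>\<^bsub>P\<^esub> tev P c X"
  using assms(4)
proof induction
  case Nil
  then show ?case by (simp add: abelian_monoid.l_zero[OF assms(1)] abelian_monoid.zero_closed[OF assms(1)])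
next
  case (Cons p X)
  interpret abelian_monoid P by fact
  have "tev P b X \<in> carrier P" "tev P c X \<in> carrier P"
    by (rule tev_closed[OF assms(1) _ Cons(2)], use assms in blast)+
  then show ?case using Cons by (auto simp: assms(2,3) a_ac)
qed

text \<open>Interchange of two finite sums, by induction on one of them. Commutativity of the
  product on a tensor product of algebras comes down to it.\<close>

lemma tev_swap:
  assumes "abelian_monoid P"
    "\<And>x y x' y'. \<lbrakk>x \<in> A; y \<in> B; x' \<in> A'; y' \<in> B'\<rbrakk> \<Longrightarrow> c x y x' y' \<in> carrier P"
    "X \<in> lists (A \<times> B)" "Y \<in> lists (A' \<times> B')"
  shows "tev P (\<lambda>x y. tev P (\<lambda>x' y'. c x y x' y') Y) X = tev P (\<lambda>x' y'. tev P (\<lambda>x y. c x y x' y') X) Y"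
  using assms(3)
proof induction
  case Nil
  then show ?case by (simp add: tev_zero[OF assms(1)])
next
  case (Cons p X)
  have "tev P (\<lambda>x' y'. c (fst p) (snd p) x' y' \<oplus>\<^bsub>P\<^esub> tev P (\<lambda>x y. c x y x' y') X) Y =
    tev P (\<lambda>x' y'. c (fst p) (snd p) x' y') Y \<oplus>\<^bsub>P\<^esub> tev P (\<lambda>x' y'. tev P (\<lambda>x y. c x y x' y') X) Y"
    by (rule tev_add[OF assms(1) _ _ assms(4)], use Cons(1) assms(2) in force)
      (rule tev_closed[OF assms(1) _ Cons(2)], use assms(2) in blast)
  then show ?case using Cons by simp
qed

lemma mod_homD:
  assumes "f \<in> mod_hom R M N"
  shows "x \<in> carrier M \<Longrightarrow> f x \<in> carrier N"
    "\<lbrakk>x \<in> carrier M; y \<in> carrier M\<rbrakk> \<Longrightarrow> f (x \<oplus>\<^bsub>M\<^esub> y) = f x \<oplus>\<^bsub>N\<^esub> f y"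
    "\<lbrakk>r \<in> carrier R; x \<in> carrier M\<rbrakk> \<Longrightarrow> f (r \<odot>\<^bsub>M\<^esub> x) = r \<odot>\<^bsub>N\<^esub> f x"
  using assms by (auto simp: mod_hom_def)

lemma mod_homI:
  assumes "\<And>x. x \<in> carrier M \<Longrightarrow> f x \<in> carrier N"
    "\<And>x y. \<lbrakk>x \<in> carrier M; y \<in> carrier M\<rbrakk> \<Longrightarrow> f (x \<oplus>\<^bsub>M\<^esub> y) = f x \<oplus>\<^bsub>N\<^esub> f y"
    "\<And>r x. \<lbrakk>r \<in> carrier R; x \<in> carrier M\<rbrakk> \<Longrightarrow> f (r \<odot>\<^bsub>M\<^esub> x) = r \<odot>\<^bsub>N\<^esub> f x"
  shows "f \<in> mod_hom R M N"
  using assms by (auto simp: mod_hom_def)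

lemma bilinear_mapD:
  assumes "bilinear_map R M N P b"
  shows "\<lbrakk>x \<in> carrier M; y \<in> carrier N\<rbrakk> \<Longrightarrow> b x y \<in> carrier P"
    "\<lbrakk>x \<in> carrier M; x' \<in> carrier M; y \<in> carrier N\<rbrakk> \<Longrightarrow> b (x \<oplus>\<^bsub>M\<^esub> x') y = b x y \<oplus>\<^bsub>P\<^esub> b x' y"
    "\<lbrakk>x \<in> carrier M; y \<in> carrier N; y' \<in> carrier N\<rbrakk> \<Longrightarrow> b x (y \<oplus>\<^bsub>N\<^esub> y') = b x y \<oplus>\<^bsub>P\<^esub> b x y'"
    "\<lbrakk>r \<in> carrier R; x \<in> carrier M; y \<in> carrier N\<rbrakk> \<Longrightarrow> b (r \<odot>\<^bsub>M\<^esub> x) y = r \<odot>\<^bsub>P\<^esub> b x y"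
    "\<lbrakk>r \<in> carrier R; x \<in> carrier M; y \<in> carrier N\<rbrakk> \<Longrightarrow> b x (r \<odot>\<^bsub>N\<^esub> y) = r \<odot>\<^bsub>P\<^esub> b x y"
  using assms unfolding bilinear_map_def mod_hom_def by auto

lemma bilinear_mapI:
  assumes "\<And>x y. \<lbrakk>x \<in> carrier M; y \<in> carrier N\<rbrakk> \<Longrightarrow> b x y \<in> carrier P"
    "\<And>x x' y. \<lbrakk>x \<in> carrier M; x' \<in> carrier M; y \<in> carrier N\<rbrakk> \<Longrightarrow> b (x \<oplus>\<^bsub>M\<^esub> x') y = b x y \<oplus>\<^bsub>P\<^esub> b x' y"
    "\<And>x y y'. \<lbrakk>x \<in> carrier M; y \<in> carrier N; y' \<in> carrier N\<rbrakk> \<Longrightarrow> b x (y \<oplus>\<^bsub>N\<^esub> y') = b x y \<oplus>\<^bsub>P\<^esub> b x y'"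
    "\<And>r x y. \<lbrakk>r \<in> carrier R; x \<in> carrier M; y \<in> carrier N\<rbrakk> \<Longrightarrow> b (r \<odot>\<^bsub>M\<^esub> x) y = r \<odot>\<^bsub>P\<^esub> b x y"
    "\<And>r x y. \<lbrakk>r \<in> carrier R; x \<in> carrier M; y \<in> carrier N\<rbrakk> \<Longrightarrow> b x (r \<odot>\<^bsub>N\<^esub> y) = r \<odot>\<^bsub>P\<^esub> b x y"
  shows "bilinear_map R M N P b"
  using assms unfolding bilinear_map_def mod_hom_def by auto

lemma tev_mod_hom:
  assumes "h \<in> mod_hom R P P'" "module R P" "module R P'"
    "\<And>x y. \<lbrakk>x \<in> A; y \<in> B\<rbrakk> \<Longrightarrow> b x y \<in> carrier P" "X \<in> lists (A \<times> B)"
  shows "h (tev P b X) = tev P' (\<lambda>x y. h (b x y)) X"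
  using assms(5)
proof induction
  case Nil
  interpret P: module R P by fact
  interpret P': module R P' by fact
  have "h (\<zero>\<^bsub>R\<^esub> \<odot>\<^bsub>P\<^esub> \<zero>\<^bsub>P\<^esub>) = \<zero>\<^bsub>R\<^esub> \<odot>\<^bsub>P'\<^esub> h \<zero>\<^bsub>P\<^esub>" by (rule mod_homD(3)[OF assms(1)]) auto
  then show ?case using mod_homD(1)[OF assms(1), of "\<zero>\<^bsub>P\<^esub>"] by simp
next
  case (Cons p X)
  interpret P: module R P by fact
  have "tev P b X \<in> carrier P"
    by (rule tev_closed[OF P.abelian_monoid_axioms assms(4) Cons(2)])
  then show ?case using Cons assms(4) by (auto simp: mod_homD(2)[OF assms(1)])
qed

text \<open>Two formal sums are identified if no bilinear map tells them apart, which makes the universal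
  property of the quotient immediate.\<close>

definition trel :: "'u alg \<Rightarrow> 'u alg \<Rightarrow> 'u alg \<Rightarrow> ('u \<times> 'u) list \<Rightarrow> ('u \<times> 'u) list \<Rightarrow> bool" where
  "trel R M N X Y \<longleftrightarrow>
     (\<forall>(P :: 'u alg) b. module R P \<and> bilinear_map R M N P b \<longrightarrow> tev P b X = tev P b Y)"

text \<open>Scalars act on the left factor; that they may be moved to the right one becomes true
  after passing to classes. The product and the unit use the ring structures of \<open>M\<close> and
  \<open>N\<close>, so that the same object also yields the tensor product of two algebras.\<close>

definition raw_tensor :: "'u alg \<Rightarrow> 'u alg \<Rightarrow> ('u, ('u \<times> 'u) list) module" where
  "raw_tensor M N =
     \<lparr>carrier = lists (carrier M \<times> carrier N),
      monoid.mult = (\<lambda>X Y. concat (map (\<lambda>(x, y). map (\<lambda>(x', y'). (x \<otimes>\<^bsub>M\<^esub> x', y \<otimes>\<^bsub>N\<^esub> y')) Y) X)),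
      one = [(\<one>\<^bsub>M\<^esub>, \<one>\<^bsub>N\<^esub>)], ring.zero = [], ring.add = (@),
      smult = (\<lambda>r. map (\<lambda>(x, y). (r \<odot>\<^bsub>M\<^esub> x, y)))\<rparr>"

lemma trel_class_map:
  assumes "infinite (UNIV :: 'u set)"
  shows "\<exists>\<kappa> :: ('u \<times> 'u) list \<Rightarrow> 'u. \<forall>X Y. \<kappa> X = \<kappa> Y \<longleftrightarrow> trel R M N X Y"
proof -
  obtain enc :: "('u \<times> 'u) list \<Rightarrow> 'u" where "inj enc" using infinite_inj_pair_lists[OF assms] by blast
  then show ?thesis
    using quotient_map_exists[of enc UNIV "trel R M N"] by (simp add: trel_def)
qed

locale tensor_construction =
  fixes R M N :: "'u alg" and \<kappa> :: "('u \<times> 'u) list \<Rightarrow> 'u"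
  assumes mM: "module R M" and mN: "module R N"
    and \<kappa>: "\<And>X Y. \<kappa> X = \<kappa> Y \<longleftrightarrow> trel R M N X Y"
begin

abbreviation "L \<equiv> raw_tensor M N"

lemma L_simps [simp]: "carrier L = lists (carrier M \<times> carrier N)" "\<zero>\<^bsub>L\<^esub> = []" "X \<oplus>\<^bsub>L\<^esub> Y = X @ Y"
  "r \<odot>\<^bsub>L\<^esub> X = map (\<lambda>(x, y). (r \<odot>\<^bsub>M\<^esub> x, y)) X"
  by (simp_all add: raw_tensor_def)

lemma tev_smult:
  assumes P: "module R P" "bilinear_map R M N P b" and r: "r \<in> carrier R"
    and X: "X \<in> lists (carrier M \<times> carrier N)"
  shows "tev P b (map (\<lambda>(x, y). (r \<odot>\<^bsub>M\<^esub> x, y)) X) = r \<odot>\<^bsub>P\<^esub> tev P b X"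
  using X
proof induction
  case Nil
  then show ?case using r by (simp add: module.smult_r_null[OF P(1)])
next
  case (Cons p X)
  interpret P: module R P by fact
  have "tev P b X \<in> carrier P"
    by (rule tev_closed[OF P.abelian_monoid_axioms bilinear_mapD(1)[OF P(2)] Cons(2)])
  then show ?case using Cons r
    by (auto simp: bilinear_mapD[OF P(2)] P.smult_r_distr)
qed

text \<open>Every law is an equality of classes, so it may be checked after evaluation under an
  arbitrary bilinear map, where it becomes a law of the target module.\<close>

lemma raw: "raw_module R L \<kappa>"
proof -
  interpret M: module R M by (rule mM)
  interpret N: module R N by (rule mN)
  have tc: "tev P b X \<in> carrier P" if "module R P" "bilinear_map R M N P b" "X \<in> lists (carrier M \<times> carrier N)"
    for P b X
    using that tev_closed[of P "carrier M" "carrier N" b X] bilinear_mapD(1)[OF that(2)]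
    by (meson module_def abelian_group_def)
  have ta: "tev P b (X @ Y) = tev P b X \<oplus>\<^bsub>P\<^esub> tev P b Y"
    if "module R P" "bilinear_map R M N P b" "X \<in> lists (carrier M \<times> carrier N)"
      "Y \<in> lists (carrier M \<times> carrier N)" for P b X Y
    using that tev_append[of P "carrier M" "carrier N" b X Y] bilinear_mapD(1)[OF that(2)]
    by (meson module_def abelian_group_def)
  have clos: "map (\<lambda>(x, y). (r \<odot>\<^bsub>M\<^esub> x, y)) X \<in> lists (carrier M \<times> carrier N)"
    if "r \<in> carrier R" "X \<in> lists (carrier M \<times> carrier N)" for r X
    using that by (auto simp: lists_eq_set)
  note T = \<kappa> trel_def
  show ?thesis
  proof (unfold_locales, goal_cases)
    case 3 then show ?case using clos by simp
  next
    case (4 a a' b b')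
    then show ?case using ta by (auto simp: T simp del: in_lists_conv_set)
  next
    case (5 r a a')
    then show ?case using tev_smult by (auto simp: T)
  next
    case (7 a b)
    show ?case unfolding T
    proof (intro allI impI, elim conjE)
      fix P :: "'u alg" and c assume P: "module R P" and b: "bilinear_map R M N P c"
      interpret P: module R P by (rule P)
      show "tev P c (a \<oplus>\<^bsub>L\<^esub> b) = tev P c (b \<oplus>\<^bsub>L\<^esub> a)"
        using 7 ta[OF P b] tc[OF P b] by (simp add: P.M.a_comm)
    qed
  next
    case (9 a)
    \<comment> \<open>Formal sums have no negatives; scaling the left factors by minus one supplies
      one up to equivalence.\<close>
    let ?b = "map (\<lambda>(x, y). ((\<ominus>\<^bsub>R\<^esub> \<one>\<^bsub>R\<^esub>) \<odot>\<^bsub>M\<^esub> x, y)) a"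
    have "\<kappa> (?b @ a) = \<kappa> []" unfolding T
    proof (intro allI impI, elim conjE)
      fix P :: "'u alg" and c assume P: "module R P" and b: "bilinear_map R M N P c"
      interpret P: module R P by (rule P)
      have a: "a \<in> lists (carrier M \<times> carrier N)" using 9 by simp
      have t: "tev P c a \<in> carrier P" using tc[OF P b a] .
      have "tev P c (?b @ a) = (\<ominus>\<^bsub>R\<^esub> \<one>\<^bsub>R\<^esub>) \<odot>\<^bsub>P\<^esub> tev P c a \<oplus>\<^bsub>P\<^esub> tev P c a"
        using ta[OF P b clos a] a tev_smult[OF P b, of "\<ominus>\<^bsub>R\<^esub> \<one>\<^bsub>R\<^esub>" a] by simp
      also have "\<dots> = \<zero>\<^bsub>P\<^esub>" using t by (simp add: P.smult_l_minus P.M.l_neg)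
      finally show "tev P c (?b @ a) = tev P c []" by simp
    qed
    moreover have "?b \<in> carrier L" using clos 9 by simp
    ultimately show ?case by (intro bexI[of _ ?b]) simp_all
  next
    case (10 r s a)
    show ?case unfolding T
    proof (intro allI impI, elim conjE)
      fix P :: "'u alg" and c assume P: "module R P" and b: "bilinear_map R M N P c"
      interpret P: module R P by (rule P)
      show "tev P c ((r \<oplus>\<^bsub>R\<^esub> s) \<odot>\<^bsub>L\<^esub> a) = tev P c (r \<odot>\<^bsub>L\<^esub> a \<oplus>\<^bsub>L\<^esub> s \<odot>\<^bsub>L\<^esub> a)"
        using 10 ta[OF P b clos clos] tc[OF P b] tev_smult[OF P b] by (simp add: P.smult_l_distr)
    qed
  next
    case (12 r s a)
    show ?case unfolding T
    proof (intro allI impI, elim conjE)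
      fix P :: "'u alg" and c assume P: "module R P" and b: "bilinear_map R M N P c"
      interpret P: module R P by (rule P)
      have "tev P c (r \<odot>\<^bsub>L\<^esub> (s \<odot>\<^bsub>L\<^esub> a)) = r \<odot>\<^bsub>P\<^esub> tev P c (s \<odot>\<^bsub>L\<^esub> a)"
        unfolding L_simps by (rule tev_smult[OF P b]) (use clos 12 in auto)
      then show "tev P c ((r \<otimes>\<^bsub>R\<^esub> s) \<odot>\<^bsub>L\<^esub> a) = tev P c (r \<odot>\<^bsub>L\<^esub> (s \<odot>\<^bsub>L\<^esub> a))"
        using 12 tc[OF P b] tev_smult[OF P b] by (simp add: P.smult_assoc1)
    qed
  next
    case (13 a)
    show ?case unfolding T
    proof (intro allI impI, elim conjE)
      fix P :: "'u alg" and c assume P: "module R P" and b: "bilinear_map R M N P c"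
      interpret P: module R P by (rule P)
      show "tev P c (\<one>\<^bsub>R\<^esub> \<odot>\<^bsub>L\<^esub> a) = tev P c a"
        using 13 tc[OF P b] tev_smult[OF P b] by simp
    qed
  qed auto
qed

sublocale raw_module R L \<kappa> by (rule raw)

abbreviation "T \<equiv> transp \<kappa> L"

lemma bilinear_T: "bilinear_map R M N T (\<lambda>x y. \<kappa> [(x, y)])"
proof -
  interpret M: module R M by (rule mM)
  interpret N: module R N by (rule mN)
  show ?thesis
  proof (rule bilinear_mapI, goal_cases)
    case (2 x x' y)
    have "\<kappa> [(x \<oplus>\<^bsub>M\<^esub> x', y)] = \<kappa> ([(x, y)] @ [(x', y)])" unfolding \<kappa> trel_def
    proof (intro allI impI, elim conjE)
      fix P :: "'u alg" and c assume P: "module R P" and b: "bilinear_map R M N P c"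
      interpret P: module R P by (rule P)
      show "tev P c [(x \<oplus>\<^bsub>M\<^esub> x', y)] = tev P c ([(x, y)] @ [(x', y)])"
        using 2 by (simp add: bilinear_mapD[OF b])
    qed
    then show ?case using 2 add_transp[of "[(x, y)]" "[(x', y)]"] by simp
  next
    case (3 x y y')
    have "\<kappa> [(x, y \<oplus>\<^bsub>N\<^esub> y')] = \<kappa> ([(x, y)] @ [(x, y')])" unfolding \<kappa> trel_def
    proof (intro allI impI, elim conjE)
      fix P :: "'u alg" and c assume P: "module R P" and b: "bilinear_map R M N P c"
      interpret P: module R P by (rule P)
      show "tev P c [(x, y \<oplus>\<^bsub>N\<^esub> y')] = tev P c ([(x, y)] @ [(x, y')])"
        using 3 by (simp add: bilinear_mapD[OF b])
    qed
    then show ?case using 3 add_transp[of "[(x, y)]" "[(x, y')]"] by simp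
  next
    case (4 r x y)
    then show ?case using smult_transp[of r "[(x, y)]"] by simp
  next
    case (5 r x y)
    have "\<kappa> [(x, r \<odot>\<^bsub>N\<^esub> y)] = \<kappa> [(r \<odot>\<^bsub>M\<^esub> x, y)]" unfolding \<kappa> trel_def
    proof (intro allI impI, elim conjE)
      fix P :: "'u alg" and c assume P: "module R P" and b: "bilinear_map R M N P c"
      show "tev P c [(x, r \<odot>\<^bsub>N\<^esub> y)] = tev P c [(r \<odot>\<^bsub>M\<^esub> x, y)]"
        using 5 by (simp add: bilinear_mapD[OF b])
    qed
    then show ?case using 5 smult_transp[of r "[(x, y)]"] by simp
  qed (simp add: transp_simps)
qed

lemma \<kappa>_eq_tev: "X \<in> lists (carrier M \<times> carrier N) \<Longrightarrow> \<kappa> X = tev T (\<lambda>x y. \<kappa> [(x, y)]) X"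
proof (induction X rule: lists.induct)
  case Nil then show ?case by (simp add: transp_simps)
next
  case (Cons p X)
  then have "\<kappa> [p] \<oplus>\<^bsub>T\<^esub> \<kappa> X = \<kappa> ([p] @ X)" using add_transp[of "[p]" X] by auto
  then show ?case using Cons by auto
qed

lemma tensor: "is_tensor R M N T (\<lambda>x y. \<kappa> [(x, y)])"
  unfolding is_tensor_def
proof (intro conjI allI impI mM mN module_transp bilinear_T, elim conjE)
  fix P :: "'u alg" and b assume P: "module R P" and b: "bilinear_map R M N P b"
  interpret P: module R P by (rule P)
  define h where "h = (\<lambda>z\<in>carrier T. tev P b (inv_into (carrier L) \<kappa> z))"
  have h: "h (\<kappa> X) = tev P b X" if "X \<in> carrier L" for X
  proof -
    have "tev P b (inv_into (carrier L) \<kappa> (\<kappa> X)) = tev P b X"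
      by (rule transp_un[OF _ that]) (use P b in \<open>auto simp: \<kappa> trel_def\<close>)
    then show ?thesis using that by (simp add: h_def transp_simps)
  qed
  have hh: "h \<in> mod_hom R T P"
  proof (rule mod_homI, goal_cases)
    case (1 x)
    then obtain X where X: "X \<in> carrier L" "x = \<kappa> X" by (auto simp: transp_simps)
    have "tev P b X \<in> carrier P"
      by (rule tev_closed[OF P.abelian_monoid_axioms bilinear_mapD(1)[OF b]]) (use X in auto)
    then show ?case using h X by simp
  next
    case (2 x y)
    then obtain X Y where X: "X \<in> carrier L" "x = \<kappa> X" and Y: "Y \<in> carrier L" "y = \<kappa> Y"
      by (auto simp: transp_simps)
    have "x \<oplus>\<^bsub>T\<^esub> y = \<kappa> (X @ Y)" using add_transp[OF X(1) Y(1)] X Y by simp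
    moreover have "tev P b (X @ Y) = tev P b X \<oplus>\<^bsub>P\<^esub> tev P b Y"
      by (rule tev_append[OF P.abelian_monoid_axioms bilinear_mapD(1)[OF b]]) (use X Y in auto)
    ultimately show ?case using h X Y by simp
  next
    case (3 r x)
    then obtain X where X: "X \<in> carrier L" "x = \<kappa> X" by (auto simp: transp_simps)
    have "r \<odot>\<^bsub>T\<^esub> x = \<kappa> (r \<odot>\<^bsub>L\<^esub> X)" using smult_transp[OF 3(1) X(1)] X by simp
    then show ?case using h[OF smult_closed[OF 3(1) X(1)]] h[OF X(1)] X 3 tev_smult[OF P b] by simp
  qed
  show "\<exists>!h. h \<in> mod_hom R T P \<inter> extensional (carrier T) \<and>
          (\<forall>x\<in>carrier M. \<forall>y\<in>carrier N. h (\<kappa> [(x, y)]) = b x y)"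
  proof (rule ex1I[of _ h])
    show "h \<in> mod_hom R T P \<inter> extensional (carrier T) \<and>
        (\<forall>x\<in>carrier M. \<forall>y\<in>carrier N. h (\<kappa> [(x, y)]) = b x y)"
      using h hh bilinear_mapD(1)[OF b] by (auto simp: h_def)
  next
    fix h' assume "h' \<in> mod_hom R T P \<inter> extensional (carrier T) \<and>
      (\<forall>x\<in>carrier M. \<forall>y\<in>carrier N. h' (\<kappa> [(x, y)]) = b x y)"
    then have h': "h' \<in> mod_hom R T P \<inter> extensional (carrier T)"
      "\<forall>x\<in>carrier M. \<forall>y\<in>carrier N. h' (\<kappa> [(x, y)]) = b x y" by auto
    show "h' = h"
    proof (rule extensionalityI[of _ "carrier T"])
      fix z assume "z \<in> carrier T"
      then obtain X where X: "X \<in> carrier L" "z = \<kappa> X" by (auto simp: transp_simps)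
      have X': "X \<in> lists (carrier M \<times> carrier N)" using X by simp
      \<comment> \<open>Uniqueness: \<open>z\<close> is the sum in \<open>T\<close> of its pure
        tensors, on which \<open>h'\<close> is prescribed.\<close>
      have "h' z = h' (tev T (\<lambda>x y. \<kappa> [(x, y)]) X)" using X(2) \<kappa>_eq_tev[OF X'] by simp
      also have "\<dots> = tev P (\<lambda>x y. h' (\<kappa> [(x, y)])) X"
        by (rule tev_mod_hom[OF _ module_transp P _ X'])
          (use h'(1) bilinear_mapD(1)[OF bilinear_T] in blast)+
      also have "\<dots> = tev P b X" by (rule tev_cong[OF X']) (use h' in auto)
      finally show "h' z = h z" using h X by simp
    qed (use h' in \<open>auto simp: h_def\<close>)
  qed
qed

end

lemma tensor_exists:
  fixes R M N :: "'u alg"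
  assumes "infinite (UNIV :: 'u set)" "module R M" "module R N"
  shows "\<exists>T t. is_tensor R M N T t"
proof -
  obtain \<kappa> :: "('u \<times> 'u) list \<Rightarrow> 'u" where "\<forall>X Y. \<kappa> X = \<kappa> Y \<longleftrightarrow> trel R M N X Y"
    using trel_class_map[OF assms(1)] by blast
  then interpret tensor_construction R M N \<kappa>
    using assms by (intro tensor_construction.intro) auto
  show ?thesis using tensor by blast
qed

section \<open>Consequences of the universal property of a tensor product\<close>

lemma tensor_hom:
  assumes "is_tensor R M N T t" "module R P" "bilinear_map R M N P b"
  obtains h where "h \<in> mod_hom R T P" "\<And>x y. \<lbrakk>x \<in> carrier M; y \<in> carrier N\<rbrakk> \<Longrightarrow> h (t x y) = b x y"
  using assms unfolding is_tensor_def by blast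

lemma tensorD:
  assumes "is_tensor R M N T t"
  shows "module R M" "module R N" "module R T" "bilinear_map R M N T t"
  using assms unfolding is_tensor_def by blast+

lemma bilinear_map_comp:
  assumes "bilinear_map R M N T t" "h \<in> mod_hom R T P"
  shows "bilinear_map R M N P (\<lambda>x y. h (t x y))"
  by (rule bilinear_mapI) (simp_all add: bilinear_mapD[OF assms(1)] mod_homD[OF assms(2)])

lemma mod_hom_restrict: "restrict h (carrier T) \<in> mod_hom R T P" if "h \<in> mod_hom R T P" "module R T"
proof -
  interpret module R T by fact
  show ?thesis by (rule mod_homI) (simp_all add: mod_homD[OF that(1)])
qed

text \<open>Both maps solve the universal problem for the bilinear map obtained from
  \<open>h\<close>. Uniqueness there is stated for extensional maps, hence the restrictions to the
  carrier.\<close>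

lemma tensor_ext:
  assumes T: "is_tensor R M N T t" and P: "module R P" and h: "h \<in> mod_hom R T P" and h': "h' \<in> mod_hom R T P"
    and eq: "\<And>x y. \<lbrakk>x \<in> carrier M; y \<in> carrier N\<rbrakk> \<Longrightarrow> h (t x y) = h' (t x y)"
    and z: "z \<in> carrier T"
  shows "h z = h' z"
proof -
  note TD = tensorD[OF T]
  let ?h = "restrict h (carrier T)" and ?h' = "restrict h' (carrier T)"
  have "\<exists>!k. k \<in> mod_hom R T P \<inter> extensional (carrier T) \<and>
              (\<forall>x\<in>carrier M. \<forall>y\<in>carrier N. k (t x y) = h (t x y))"
    using T bilinear_map_comp[OF TD(4) h] P unfolding is_tensor_def by blast
  moreover have "?h \<in> mod_hom R T P \<inter> extensional (carrier T) \<and>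
              (\<forall>x\<in>carrier M. \<forall>y\<in>carrier N. ?h (t x y) = h (t x y))"
    using mod_hom_restrict[OF h TD(3)] bilinear_mapD(1)[OF TD(4)] by simp
  moreover have "?h' \<in> mod_hom R T P \<inter> extensional (carrier T) \<and>
              (\<forall>x\<in>carrier M. \<forall>y\<in>carrier N. ?h' (t x y) = h (t x y))"
    using mod_hom_restrict[OF h' TD(3)] bilinear_mapD(1)[OF TD(4)] eq by simp
  ultimately have "?h = ?h'" by blast
  then show ?thesis using z by (metis restrict_apply')
qed

text \<open>Being a tensor product depends only on the underlying \<open>R\<close>-module. This
  allows the other record fields to be changed, in particular when the slot for scalars is also
  claimed by the structure of a \<open>K\<close>-algebra.\<close>

lemma is_tensor_cong:
  assumes T: "is_tensor R M N T t" and m: "module R T'" and c: "carrier T' = carrier T"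
    and a: "\<And>x y. \<lbrakk>x \<in> carrier T; y \<in> carrier T\<rbrakk> \<Longrightarrow> x \<oplus>\<^bsub>T'\<^esub> y = x \<oplus>\<^bsub>T\<^esub> y"
    and s: "\<And>r x. \<lbrakk>r \<in> carrier R; x \<in> carrier T\<rbrakk> \<Longrightarrow> r \<odot>\<^bsub>T'\<^esub> x = r \<odot>\<^bsub>T\<^esub> x"
    and t: "\<And>x y. \<lbrakk>x \<in> carrier M; y \<in> carrier N\<rbrakk> \<Longrightarrow> t' x y = t x y"
  shows "is_tensor R M N T' t'"
proof -
  interpret M: module R M using tensorD[OF T] by blast
  interpret N: module R N using tensorD[OF T] by blast
  note b = bilinear_mapD[OF tensorD(4)[OF T]]
  have "bilinear_map R M N T' t'"
    by (rule bilinear_mapI) (simp_all add: t c b a s)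
  moreover have "mod_hom R T' P = mod_hom R T P" for P
    using c a s unfolding mod_hom_def by auto
  ultimately show ?thesis
    using T m c t unfolding is_tensor_def by auto
qed

section \<open>Modules and algebras along ring homomorphisms\<close>

lemma cring_cong:
  fixes A :: "('a, 'm) ring_scheme" and B :: "('a, 'n) ring_scheme"
  assumes "cring A" "carrier B = carrier A" "monoid.mult B = monoid.mult A" "one B = one A"
    "ring.zero B = ring.zero A" "ring.add B = ring.add A"
  shows "cring B"
proof -
  interpret cring A by fact
  show ?thesis
  proof (rule cringI)
    show "abelian_group B"
      by (rule abelian_groupI) (use assms a_assoc a_comm l_neg in \<open>auto intro: a_inv_closed\<close>)
    show "comm_monoid B"
      by (rule comm_monoidI) (use assms m_assoc m_comm in auto)
  qed (use assms l_distr in auto)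
qed

lemma along_simps [simp]:
  "carrier (along \<phi> S) = carrier S" "monoid.mult (along \<phi> S) = monoid.mult S" "one (along \<phi> S) = one S"
  "ring.zero (along \<phi> S) = ring.zero S" "ring.add (along \<phi> S) = ring.add S"
  "r \<odot>\<^bsub>along \<phi> S\<^esub> x = \<phi> r \<otimes>\<^bsub>S\<^esub> x"
  by (simp_all add: along_def)

lemma module_along:
  assumes "cring R" "cring S" "\<phi> \<in> ring_hom R S"
  shows "module R (along \<phi> S)"
proof -
  interpret S: cring S by fact
  have "abelian_group (along \<phi> S)"
    using cring_cong[OF assms(2), of "along \<phi> S"] by (simp add: cring.axioms(1) ring.is_abelian_group)
  then show ?thesis
    by (rule moduleI[OF assms(1)]) (use ring_hom_closed[OF assms(3)] in
      \<open>auto simp: ring_hom_add[OF assms(3)] ring_hom_mult[OF assms(3)] ring_hom_one[OF assms(3)]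
        S.l_distr S.r_distr S.m_assoc\<close>)
qed

lemma algebra_of_hom:
  assumes "cring K" "cring B" "\<eta> \<in> ring_hom K B"
  shows "algebra K (B\<lparr>smult := \<lambda>k x. \<eta> k \<otimes>\<^bsub>B\<^esub> x\<rparr>)" (is "algebra K ?B")
proof -
  interpret B: cring B by fact
  have c: "cring ?B" by (rule cring_cong[OF assms(2)]) simp_all
  show ?thesis
    by (rule algebraI[OF assms(1) c])
      (use ring_hom_closed[OF assms(3)] in
        \<open>auto simp: ring_hom_add[OF assms(3)] ring_hom_mult[OF assms(3)] ring_hom_one[OF assms(3)]
          B.l_distr B.r_distr B.m_assoc\<close>)
qed

lemma algebra_smult_eq:
  assumes "algebra K A" "k \<in> carrier K" "x \<in> carrier A"
  shows "k \<odot>\<^bsub>A\<^esub> x = (k \<odot>\<^bsub>A\<^esub> \<one>\<^bsub>A\<^esub>) \<otimes>\<^bsub>A\<^esub> x"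
proof -
  interpret algebra K A by fact
  show ?thesis using assms(2,3) by (simp add: smult_assoc2)
qed

lemma algebra_unit_hom: "algebra K A \<Longrightarrow> (\<lambda>k. k \<odot>\<^bsub>A\<^esub> \<one>\<^bsub>A\<^esub>) \<in> ring_hom K A"
proof -
  assume "algebra K A"
  then interpret algebra K A .
  show ?thesis
    by (rule ring_hom_memI)
      (simp_all add: smult_l_distr smult_assoc2 smult_assoc1)
qed

lemma alg_homD:
  assumes "f \<in> alg_hom K A B"
  shows "f \<in> ring_hom A B" "f \<in> extensional (carrier A)" "x \<in> carrier A \<Longrightarrow> f x \<in> carrier B"
    "\<lbrakk>k \<in> carrier K; x \<in> carrier A\<rbrakk> \<Longrightarrow> f (k \<odot>\<^bsub>A\<^esub> x) = k \<odot>\<^bsub>B\<^esub> f x"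
    "\<lbrakk>x \<in> carrier A; y \<in> carrier A\<rbrakk> \<Longrightarrow> f (x \<otimes>\<^bsub>A\<^esub> y) = f x \<otimes>\<^bsub>B\<^esub> f y"
    "\<lbrakk>x \<in> carrier A; y \<in> carrier A\<rbrakk> \<Longrightarrow> f (x \<oplus>\<^bsub>A\<^esub> y) = f x \<oplus>\<^bsub>B\<^esub> f y"
    "f \<one>\<^bsub>A\<^esub> = \<one>\<^bsub>B\<^esub>"
  using assms by (auto simp: alg_hom_def ring_hom_def)

lemma alg_homI:
  assumes "\<And>x. x \<in> carrier A \<Longrightarrow> f x \<in> carrier B" "f \<in> extensional (carrier A)"
    "\<And>k x. \<lbrakk>k \<in> carrier K; x \<in> carrier A\<rbrakk> \<Longrightarrow> f (k \<odot>\<^bsub>A\<^esub> x) = k \<odot>\<^bsub>B\<^esub> f x"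
    "\<And>x y. \<lbrakk>x \<in> carrier A; y \<in> carrier A\<rbrakk> \<Longrightarrow> f (x \<otimes>\<^bsub>A\<^esub> y) = f x \<otimes>\<^bsub>B\<^esub> f y"
    "\<And>x y. \<lbrakk>x \<in> carrier A; y \<in> carrier A\<rbrakk> \<Longrightarrow> f (x \<oplus>\<^bsub>A\<^esub> y) = f x \<oplus>\<^bsub>B\<^esub> f y"
    "f \<one>\<^bsub>A\<^esub> = \<one>\<^bsub>B\<^esub>"
  shows "f \<in> alg_hom K A B"
  using assms by (auto simp: alg_hom_def ring_hom_def)

lemma tev_scale:
  assumes P: "module R P" and r: "r \<in> carrier R"
    and b: "\<And>x y. \<lbrakk>x \<in> A; y \<in> B\<rbrakk> \<Longrightarrow> b x y \<in> carrier P" and X: "X \<in> lists (A \<times> B)"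
  shows "tev P (\<lambda>x y. r \<odot>\<^bsub>P\<^esub> b x y) X = r \<odot>\<^bsub>P\<^esub> tev P b X"
  using X
proof induction
  case Nil
  then show ?case using r by (simp add: module.smult_r_null[OF P])
next
  case (Cons p X)
  interpret P: module R P by fact
  have "tev P b X \<in> carrier P"
    by (rule tev_closed[OF P.abelian_monoid_axioms b Cons(2)])
  then show ?case using Cons r b by (auto simp: P.smult_r_distr)
qed

text \<open>The two algebras over \<open>R\<close> are given by ring homomorphisms alone. The ground
  ring \<open>K\<close> is left aside here and put back in \<open>pushout_exists\<close>.\<close>

locale algebra_tensor =
  fixes R S R' :: "'u alg" and \<phi> g :: "'u \<Rightarrow> 'u" and \<kappa> :: "('u \<times> 'u) list \<Rightarrow> 'u"
  assumes cR: "cring R" and cS: "cring S" and cR': "cring R'"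
    and \<phi>: "\<phi> \<in> ring_hom R S" and g: "g \<in> ring_hom R R'"
    and kap: "\<And>X Y. \<kappa> X = \<kappa> Y \<longleftrightarrow> trel R (along \<phi> S) (along g R') X Y"
begin

sublocale tensor_construction R "along \<phi> S" "along g R'" \<kappa>
  by (rule tensor_construction.intro[OF module_along[OF cR cS \<phi>] module_along[OF cR cR' g] kap])

sublocale S: cring S by (rule cS)
sublocale R': cring R' by (rule cR')

lemma one_L: "\<one>\<^bsub>L\<^esub> = [(\<one>\<^bsub>S\<^esub>, \<one>\<^bsub>R'\<^esub>)]"
  by (simp add: raw_tensor_def)

lemma mult_L: "X \<otimes>\<^bsub>L\<^esub> Y = concat (map (\<lambda>(x, y). map (\<lambda>(x', y'). (x \<otimes>\<^bsub>S\<^esub> x', y \<otimes>\<^bsub>R'\<^esub> y')) Y) X)"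
  by (simp add: raw_tensor_def)

lemma mult_closed: "\<lbrakk>X \<in> carrier L; Y \<in> carrier L\<rbrakk> \<Longrightarrow> X \<otimes>\<^bsub>L\<^esub> Y \<in> carrier L"
  by (fastforce simp: mult_L)

lemma tev_mult:
  assumes P: "abelian_monoid P" and b: "\<And>x y. \<lbrakk>x \<in> carrier S; y \<in> carrier R'\<rbrakk> \<Longrightarrow> b x y \<in> carrier P"
    and X: "X \<in> carrier L" and Y: "Y \<in> carrier L"
  shows "tev P b (X \<otimes>\<^bsub>L\<^esub> Y) = tev P (\<lambda>x y. tev P (\<lambda>x' y'. b (x \<otimes>\<^bsub>S\<^esub> x') (y \<otimes>\<^bsub>R'\<^esub> y')) Y) X"
proof -
  have "X \<in> lists (carrier S \<times> carrier R')" using X by simp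
  then show ?thesis
  proof induction
    case Nil then show ?case by (simp add: mult_L)
  next
    case (Cons p X)
    obtain x y where p: "p = (x, y)" "x \<in> carrier S" "y \<in> carrier R'" using Cons(1) by auto
    have eq: "(p # X) \<otimes>\<^bsub>L\<^esub> Y = map (\<lambda>(x', y'). (x \<otimes>\<^bsub>S\<^esub> x', y \<otimes>\<^bsub>R'\<^esub> y')) Y @ X \<otimes>\<^bsub>L\<^esub> Y"
      by (simp add: mult_L p)
    have "tev P b ((p # X) \<otimes>\<^bsub>L\<^esub> Y) = tev P b (map (\<lambda>(x', y'). (x \<otimes>\<^bsub>S\<^esub> x', y \<otimes>\<^bsub>R'\<^esub> y')) Y) \<oplus>\<^bsub>P\<^esub> tev P b (X \<otimes>\<^bsub>L\<^esub> Y)"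
      unfolding eq
    proof (rule tev_append[OF P b])
      show "map (\<lambda>(x', y'). (x \<otimes>\<^bsub>S\<^esub> x', y \<otimes>\<^bsub>R'\<^esub> y')) Y \<in> lists (carrier S \<times> carrier R')"
        using Y p by fastforce
      show "X \<otimes>\<^bsub>L\<^esub> Y \<in> lists (carrier S \<times> carrier R')"
        using mult_closed[OF _ Y, of X] Cons(2) by simp
    qed
    then show ?case using Cons p by (simp add: tev_map case_prod_beta)
  qed
qed

text \<open>With \<open>Y\<close> fixed, the evaluated product is a bilinear function
  \<open>?c\<close> of the pairs in the left argument, so \<open>X\<close> may be replaced by
  \<open>X'\<close>. For each fixed pair of \<open>X'\<close> it is a bilinear function of the pairs
  in the right argument, so \<open>Y\<close> may be replaced by \<open>Y'\<close>.\<close>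

lemma mult_cong:
  assumes "X \<in> carrier L" "X' \<in> carrier L" "Y \<in> carrier L" "Y' \<in> carrier L" "\<kappa> X = \<kappa> X'" "\<kappa> Y = \<kappa> Y'"
  shows "\<kappa> (X \<otimes>\<^bsub>L\<^esub> Y) = \<kappa> (X' \<otimes>\<^bsub>L\<^esub> Y')"
  unfolding kap trel_def
proof (intro allI impI, elim conjE)
  fix P :: "'u alg" and b assume P: "module R P" and b: "bilinear_map R (along \<phi> S) (along g R') P b"
  interpret P: module R P by (rule P)
  have bc: "\<And>x y. \<lbrakk>x \<in> carrier S; y \<in> carrier R'\<rbrakk> \<Longrightarrow> b x y \<in> carrier P"
    using bilinear_mapD(1)[OF b] by simp
  note bD = bilinear_mapD(2-)[OF b, simplified]
  have R: "\<phi> r \<in> carrier S" "g r \<in> carrier R'" if "r \<in> carrier R" for r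
    using that ring_hom_closed[OF \<phi>] ring_hom_closed[OF g] by auto
  let ?c = "\<lambda>x y. tev P (\<lambda>x' y'. b (x \<otimes>\<^bsub>S\<^esub> x') (y \<otimes>\<^bsub>R'\<^esub> y')) Y"
  have Y: "Y \<in> lists (carrier S \<times> carrier R')" "Y' \<in> lists (carrier S \<times> carrier R')" using assms by auto
  have X: "X' \<in> lists (carrier S \<times> carrier R')" using assms by auto
  note am = P.abelian_monoid_axioms
  have "bilinear_map R (along \<phi> S) (along g R') P ?c"
  proof (rule bilinear_mapI, goal_cases)
    case (1 x y) then show ?case by (intro tev_closed[OF am _ Y(1)] bc) auto
  next
    case (2 x x' y)
    then have "?c (x \<oplus>\<^bsub>S\<^esub> x') y = tev P (\<lambda>u v. b (x \<otimes>\<^bsub>S\<^esub> u) (y \<otimes>\<^bsub>R'\<^esub> v) \<oplus>\<^bsub>P\<^esub> b (x' \<otimes>\<^bsub>S\<^esub> u) (y \<otimes>\<^bsub>R'\<^esub> v)) Y"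
      by (intro tev_cong[OF Y(1)]) (simp add: S.l_distr bD)
    also have "\<dots> = ?c x y \<oplus>\<^bsub>P\<^esub> ?c x' y" by (rule tev_add[OF am _ _ Y(1)]) (use 2 bc in auto)
    finally show ?case by simp
  next
    case (3 x y y')
    then have "?c x (y \<oplus>\<^bsub>R'\<^esub> y') = tev P (\<lambda>u v. b (x \<otimes>\<^bsub>S\<^esub> u) (y \<otimes>\<^bsub>R'\<^esub> v) \<oplus>\<^bsub>P\<^esub> b (x \<otimes>\<^bsub>S\<^esub> u) (y' \<otimes>\<^bsub>R'\<^esub> v)) Y"
      by (intro tev_cong[OF Y(1)]) (simp add: R'.l_distr bD)
    also have "\<dots> = ?c x y \<oplus>\<^bsub>P\<^esub> ?c x y'" by (rule tev_add[OF am _ _ Y(1)]) (use 3 bc in auto)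
    finally show ?case by simp
  next
    case (4 r x y)
    then have "?c (\<phi> r \<otimes>\<^bsub>S\<^esub> x) y = tev P (\<lambda>u v. r \<odot>\<^bsub>P\<^esub> b (x \<otimes>\<^bsub>S\<^esub> u) (y \<otimes>\<^bsub>R'\<^esub> v)) Y"
      using R by (intro tev_cong[OF Y(1)]) (simp add: S.m_assoc bD)
    also have "\<dots> = r \<odot>\<^bsub>P\<^esub> ?c x y" by (rule tev_scale[OF P _ _ Y(1)]) (use 4 bc in auto)
    finally show ?case by simp
  next
    case (5 r x y)
    then have "?c x (g r \<otimes>\<^bsub>R'\<^esub> y) = tev P (\<lambda>u v. r \<odot>\<^bsub>P\<^esub> b (x \<otimes>\<^bsub>S\<^esub> u) (y \<otimes>\<^bsub>R'\<^esub> v)) Y"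
      using R by (intro tev_cong[OF Y(1)]) (simp add: R'.m_assoc bD)
    also have "\<dots> = r \<odot>\<^bsub>P\<^esub> ?c x y" by (rule tev_scale[OF P _ _ Y(1)]) (use 5 bc in auto)
    finally show ?case by simp
  qed
  then have "tev P ?c X = tev P ?c X'" using assms(5) P unfolding kap trel_def by blast
  also have "\<dots> = tev P (\<lambda>x y. tev P (\<lambda>x' y'. b (x \<otimes>\<^bsub>S\<^esub> x') (y \<otimes>\<^bsub>R'\<^esub> y')) Y') X'"
  proof (rule tev_cong[OF X])
    fix x y assume xy: "x \<in> carrier S" "y \<in> carrier R'"
    have "bilinear_map R (along \<phi> S) (along g R') P (\<lambda>x' y'. b (x \<otimes>\<^bsub>S\<^esub> x') (y \<otimes>\<^bsub>R'\<^esub> y'))"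
      by (rule bilinear_mapI) (use xy R in
        \<open>auto simp: bc S.r_distr R'.r_distr bD S.m_lcomm[of x] R'.m_lcomm[of y]\<close>)
    then show "tev P (\<lambda>x' y'. b (x \<otimes>\<^bsub>S\<^esub> x') (y \<otimes>\<^bsub>R'\<^esub> y')) Y = tev P (\<lambda>x' y'. b (x \<otimes>\<^bsub>S\<^esub> x') (y \<otimes>\<^bsub>R'\<^esub> y')) Y'"
      using assms(6) P unfolding kap trel_def by blast
  qed
  finally show "tev P b (X \<otimes>\<^bsub>L\<^esub> Y) = tev P b (X' \<otimes>\<^bsub>L\<^esub> Y')"
    using tev_mult[OF am bc] assms by simp
qed

lemma mult_transp: "\<lbrakk>X \<in> carrier L; Y \<in> carrier L\<rbrakk> \<Longrightarrow> \<kappa> X \<otimes>\<^bsub>T\<^esub> \<kappa> Y = \<kappa> (X \<otimes>\<^bsub>L\<^esub> Y)"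
  unfolding transp_def by (simp del: L_simps, rule transp_bin, rule mult_cong)

lemma mult_comm:
  assumes "X \<in> carrier L" "Y \<in> carrier L"
  shows "\<kappa> (X \<otimes>\<^bsub>L\<^esub> Y) = \<kappa> (Y \<otimes>\<^bsub>L\<^esub> X)"
  unfolding kap trel_def
proof (intro allI impI, elim conjE)
  fix P :: "'u alg" and b assume P: "module R P" and b: "bilinear_map R (along \<phi> S) (along g R') P b"
  interpret P: module R P by (rule P)
  note am = P.abelian_monoid_axioms
  have bc: "\<And>x y. \<lbrakk>x \<in> carrier S; y \<in> carrier R'\<rbrakk> \<Longrightarrow> b x y \<in> carrier P"
    using bilinear_mapD(1)[OF b] by simp
  have XY: "X \<in> lists (carrier S \<times> carrier R')" "Y \<in> lists (carrier S \<times> carrier R')" using assms by auto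
  have "tev P b (X \<otimes>\<^bsub>L\<^esub> Y) = tev P (\<lambda>x y. tev P (\<lambda>x' y'. b (x \<otimes>\<^bsub>S\<^esub> x') (y \<otimes>\<^bsub>R'\<^esub> y')) Y) X"
    by (rule tev_mult[OF am bc assms])
  also have "\<dots> = tev P (\<lambda>x' y'. tev P (\<lambda>x y. b (x \<otimes>\<^bsub>S\<^esub> x') (y \<otimes>\<^bsub>R'\<^esub> y')) X) Y"
    by (rule tev_swap[OF am _ XY]) (simp add: bc)
  also have "\<dots> = tev P (\<lambda>x' y'. tev P (\<lambda>x y. b (x' \<otimes>\<^bsub>S\<^esub> x) (y' \<otimes>\<^bsub>R'\<^esub> y)) X) Y"
    by (intro tev_cong[OF XY(2)] tev_cong[OF XY(1)]) (simp add: S.m_comm R'.m_comm)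
  also have "\<dots> = tev P b (Y \<otimes>\<^bsub>L\<^esub> X)" by (rule tev_mult[OF am bc assms(2,1), symmetric])
  finally show "tev P b (X \<otimes>\<^bsub>L\<^esub> Y) = tev P b (Y \<otimes>\<^bsub>L\<^esub> X)" .
qed

lemma mult_assoc:
  assumes "X \<in> carrier L" "Y \<in> carrier L" "Z \<in> carrier L"
  shows "\<kappa> ((X \<otimes>\<^bsub>L\<^esub> Y) \<otimes>\<^bsub>L\<^esub> Z) = \<kappa> (X \<otimes>\<^bsub>L\<^esub> (Y \<otimes>\<^bsub>L\<^esub> Z))"
  unfolding kap trel_def
proof (intro allI impI, elim conjE)
  fix P :: "'u alg" and b assume P: "module R P" and b: "bilinear_map R (along \<phi> S) (along g R') P b"
  interpret P: module R P by (rule P)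
  note am = P.abelian_monoid_axioms
  have bc: "\<And>x y. \<lbrakk>x \<in> carrier S; y \<in> carrier R'\<rbrakk> \<Longrightarrow> b x y \<in> carrier P"
    using bilinear_mapD(1)[OF b] by simp
  have l: "X \<in> lists (carrier S \<times> carrier R')" "Y \<in> lists (carrier S \<times> carrier R')"
    "Z \<in> lists (carrier S \<times> carrier R')" using assms by auto
  have "tev P b ((X \<otimes>\<^bsub>L\<^esub> Y) \<otimes>\<^bsub>L\<^esub> Z) = tev P (\<lambda>x y. tev P (\<lambda>u v. b (x \<otimes>\<^bsub>S\<^esub> u) (y \<otimes>\<^bsub>R'\<^esub> v)) Z) (X \<otimes>\<^bsub>L\<^esub> Y)"
    by (rule tev_mult[OF am bc mult_closed assms(3)]) (use assms in auto)
  also have "\<dots> = tev P (\<lambda>x y. tev P (\<lambda>x' y'. tev P (\<lambda>u v. b (x \<otimes>\<^bsub>S\<^esub> x' \<otimes>\<^bsub>S\<^esub> u) (y \<otimes>\<^bsub>R'\<^esub> y' \<otimes>\<^bsub>R'\<^esub> v)) Z) Y) X"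
    by (rule tev_mult[OF am _ assms(1,2)], rule tev_closed[OF am _ l(3)]) (simp add: bc)
  also have "\<dots> = tev P (\<lambda>x y. tev P (\<lambda>x' y'. tev P (\<lambda>u v. b (x \<otimes>\<^bsub>S\<^esub> (x' \<otimes>\<^bsub>S\<^esub> u)) (y \<otimes>\<^bsub>R'\<^esub> (y' \<otimes>\<^bsub>R'\<^esub> v))) Z) Y) X"
    by (intro tev_cong[OF l(1)] tev_cong[OF l(2)] tev_cong[OF l(3)]) (simp add: S.m_assoc R'.m_assoc)
  also have "\<dots> = tev P (\<lambda>x y. tev P (\<lambda>u v. b (x \<otimes>\<^bsub>S\<^esub> u) (y \<otimes>\<^bsub>R'\<^esub> v)) (Y \<otimes>\<^bsub>L\<^esub> Z)) X"
    by (intro tev_cong[OF l(1)] tev_mult[OF am _ assms(2,3), symmetric]) (simp add: bc)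
  also have "\<dots> = tev P b (X \<otimes>\<^bsub>L\<^esub> (Y \<otimes>\<^bsub>L\<^esub> Z))"
    by (rule tev_mult[OF am bc assms(1) mult_closed[OF assms(2,3)], symmetric])
  finally show "tev P b ((X \<otimes>\<^bsub>L\<^esub> Y) \<otimes>\<^bsub>L\<^esub> Z) = tev P b (X \<otimes>\<^bsub>L\<^esub> (Y \<otimes>\<^bsub>L\<^esub> Z))" .
qed

lemma one_mult: "X \<in> carrier L \<Longrightarrow> \<one>\<^bsub>L\<^esub> \<otimes>\<^bsub>L\<^esub> X = X"
  by (auto simp: one_L mult_L intro!: map_idI)

lemma cring_T: "cring T"
proof (rule cringI[OF abelian_group_transp])
  have one: "\<one>\<^bsub>L\<^esub> \<in> carrier L" by (simp add: one_L)
  show "comm_monoid T"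
    by (rule comm_monoidI)
      (auto simp: transp_simps mult_transp mult_closed one one_mult mult_assoc simp del: L_simps
        intro: mult_comm)
  fix x y z assume "x \<in> carrier T" "y \<in> carrier T" "z \<in> carrier T"
  then obtain X Y Z where XYZ: "X \<in> carrier L" "Y \<in> carrier L" "Z \<in> carrier L" "x = \<kappa> X" "y = \<kappa> Y" "z = \<kappa> Z"
    by (auto simp: transp_simps simp del: L_simps)
  have "(X \<oplus>\<^bsub>L\<^esub> Y) \<otimes>\<^bsub>L\<^esub> Z = X \<otimes>\<^bsub>L\<^esub> Z \<oplus>\<^bsub>L\<^esub> Y \<otimes>\<^bsub>L\<^esub> Z" by (simp add: mult_L)
  then show "(x \<oplus>\<^bsub>T\<^esub> y) \<otimes>\<^bsub>T\<^esub> z = x \<otimes>\<^bsub>T\<^esub> z \<oplus>\<^bsub>T\<^esub> y \<otimes>\<^bsub>T\<^esub> z"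
    using XYZ by (simp add: mult_transp add_transp add_closed mult_closed del: L_simps)
qed

definition inl :: "'u \<Rightarrow> 'u" where "inl = (\<lambda>s\<in>carrier S. \<kappa> [(s, \<one>\<^bsub>R'\<^esub>)])"
definition inr :: "'u \<Rightarrow> 'u" where "inr = (\<lambda>r\<in>carrier R'. \<kappa> [(\<one>\<^bsub>S\<^esub>, r)])"

lemma inl_mult_inr: "\<lbrakk>s \<in> carrier S; r \<in> carrier R'\<rbrakk> \<Longrightarrow> inl s \<otimes>\<^bsub>T\<^esub> inr r = \<kappa> [(s, r)]"
  by (simp add: inl_def inr_def mult_transp mult_L)

lemma balance:
  assumes "r \<in> carrier R" "s \<in> carrier S" "r' \<in> carrier R'"
  shows "\<kappa> [(\<phi> r \<otimes>\<^bsub>S\<^esub> s, r')] = \<kappa> [(s, g r \<otimes>\<^bsub>R'\<^esub> r')]"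
  using bilinear_mapD(4,5)[OF bilinear_T, of r s r'] assms by simp

lemma inl_hom: "inl \<in> ring_hom S T"
  by (rule ring_hom_memI)
    (use bilinear_mapD(2)[OF bilinear_T, of _ _ "\<one>\<^bsub>R'\<^esub>"] in
      \<open>auto simp: inl_def mult_transp mult_L transp_simps one_L\<close>)

lemma inr_hom: "inr \<in> ring_hom R' T"
  by (rule ring_hom_memI)
    (use bilinear_mapD(3)[OF bilinear_T, of "\<one>\<^bsub>S\<^esub>"] in
      \<open>auto simp: inr_def mult_transp mult_L transp_simps one_L\<close>)

lemma inl_phi: "r \<in> carrier R \<Longrightarrow> inl (\<phi> r) = inr (g r)"
  using balance[of r "\<one>\<^bsub>S\<^esub>" "\<one>\<^bsub>R'\<^esub>"] ring_hom_closed[OF \<phi>] ring_hom_closed[OF g]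
  by (simp add: inl_def inr_def)

end

text \<open>The tensor product of \<open>S\<close> and \<open>R'\<close> over \<open>R\<close>
  becomes a \<open>K\<close>-algebra through \<open>S\<close>; the scalars agree with those coming
  from \<open>R'\<close> because both come from \<open>R\<close>. The last conclusion, that sums of
  pure tensors exhaust \<open>S'\<close>, is recorded for the surjectivity of base-changed
  presentations.\<close>

lemma pushout_exists:
  fixes K :: "'u ring" and R S R' :: "'u alg"
  assumes inf: "infinite (UNIV :: 'u set)" and R: "algebra K R" and S: "algebra K S" and R': "algebra K R'"
    and \<phi>: "\<phi> \<in> alg_hom K R S" and g: "g \<in> alg_hom K R R'"
  obtains S' i \<psi> where "algebra K S'" "i \<in> alg_hom K S S'" "\<psi> \<in> alg_hom K R' S'"
    "\<And>r. r \<in> carrier R \<Longrightarrow> i (\<phi> r) = \<psi> (g r)"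
    "is_tensor R (along \<phi> S) (along g R') (along (i \<circ> \<phi>) S') (\<lambda>s r. i s \<otimes>\<^bsub>S'\<^esub> \<psi> r)"
    "\<And>x. x \<in> carrier S' \<Longrightarrow> \<exists>X\<in>lists (carrier S \<times> carrier R'). x = tev S' (\<lambda>s r. i s \<otimes>\<^bsub>S'\<^esub> \<psi> r) X"
proof -
  obtain \<kappa> :: "('u \<times> 'u) list \<Rightarrow> 'u" where \<kappa>: "\<forall>X Y. \<kappa> X = \<kappa> Y \<longleftrightarrow> trel R (along \<phi> S) (along g R') X Y"
    using trel_class_map[OF inf] by blast
  have cr: "cring R" "cring S" "cring R'" "cring K"
    using R S R' by (simp_all add: algebra.M_cring algebra.R_cring)
  interpret A: algebra_tensor R S R' \<phi> g \<kappa>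
    using cr alg_homD(1)[OF \<phi>] alg_homD(1)[OF g] \<kappa> by (intro algebra_tensor.intro) auto
  interpret S: algebra K S by (rule S)
  interpret R': algebra K R' by (rule R')
  interpret R: algebra K R by (rule R)
  let ?T = A.T
  interpret T: cring ?T by (rule A.cring_T)
  define \<eta> where "\<eta> = A.inl \<circ> (\<lambda>k. k \<odot>\<^bsub>S\<^esub> \<one>\<^bsub>S\<^esub>)"
  have \<eta>: "\<eta> \<in> ring_hom K ?T"
    unfolding \<eta>_def by (rule ring_hom_trans[OF algebra_unit_hom[OF S] A.inl_hom])
  define S' where "S' = ?T\<lparr>smult := \<lambda>k x. \<eta> k \<otimes>\<^bsub>?T\<^esub> x\<rparr>"
  have S': "algebra K S'" unfolding S'_def by (rule algebra_of_hom[OF cr(4) A.cring_T \<eta>])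
  have sim: "carrier S' = carrier ?T" "monoid.mult S' = monoid.mult ?T" "one S' = one ?T"
    "ring.zero S' = ring.zero ?T" "ring.add S' = ring.add ?T" "smult S' = (\<lambda>k x. \<eta> k \<otimes>\<^bsub>?T\<^esub> x)"
    by (simp_all add: S'_def)
  note inlD = ring_hom_memE[OF A.inl_hom] and inrD = ring_hom_memE[OF A.inr_hom]
  have i: "A.inl \<in> alg_hom K S S'"
  proof (rule alg_homI)
    fix k x assume "k \<in> carrier K" "x \<in> carrier S"
    then show "A.inl (k \<odot>\<^bsub>S\<^esub> x) = k \<odot>\<^bsub>S'\<^esub> A.inl x"
      by (subst algebra_smult_eq[OF S]) (simp_all add: sim \<eta>_def inlD)
  qed (simp_all add: sim inlD, simp add: A.inl_def)
  have p: "A.inr \<in> alg_hom K R' S'"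
  proof (rule alg_homI)
    fix k x assume kx: "k \<in> carrier K" "x \<in> carrier R'"
    have "k \<odot>\<^bsub>S\<^esub> \<one>\<^bsub>S\<^esub> = \<phi> (k \<odot>\<^bsub>R\<^esub> \<one>\<^bsub>R\<^esub>)" "k \<odot>\<^bsub>R'\<^esub> \<one>\<^bsub>R'\<^esub> = g (k \<odot>\<^bsub>R\<^esub> \<one>\<^bsub>R\<^esub>)"
      using kx alg_homD(4,7)[OF \<phi>] alg_homD(4,7)[OF g] by simp_all
    then have "\<eta> k = A.inr (k \<odot>\<^bsub>R'\<^esub> \<one>\<^bsub>R'\<^esub>)" using kx A.inl_phi[of "k \<odot>\<^bsub>R\<^esub> \<one>\<^bsub>R\<^esub>"] by (simp add: \<eta>_def)
    then show "A.inr (k \<odot>\<^bsub>R'\<^esub> x) = k \<odot>\<^bsub>S'\<^esub> A.inr x"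
      using kx by (subst algebra_smult_eq[OF R']) (simp_all add: sim inrD)
  qed (simp_all add: sim inrD, simp add: A.inr_def)
  have comm: "A.inl (\<phi> r) = A.inr (g r)" if "r \<in> carrier R" for r
    using A.inl_phi[OF that] .
  have cS': "cring S'" using S' by (simp add: algebra.M_cring)
  have tens: "is_tensor R (along \<phi> S) (along g R') (along (A.inl \<circ> \<phi>) S') (\<lambda>s r. A.inl s \<otimes>\<^bsub>S'\<^esub> A.inr r)"
  proof (rule is_tensor_cong[OF A.tensor])
    show "module R (along (A.inl \<circ> \<phi>) S')"
      by (rule module_along[OF cr(1) cS' ring_hom_trans[OF alg_homD(1)[OF \<phi>] alg_homD(1)[OF i]]])
    fix r x assume r: "r \<in> carrier R" and x: "x \<in> carrier ?T"
    then obtain X where X: "X \<in> carrier A.L" "x = \<kappa> X" by (auto simp: transp_simps simp del: A.L_simps)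
    have p: "\<phi> r \<in> carrier S" using alg_homD(3)[OF \<phi>] r by simp
    have "A.inl (\<phi> r) \<otimes>\<^bsub>?T\<^esub> x = \<kappa> ([(\<phi> r, \<one>\<^bsub>R'\<^esub>)] \<otimes>\<^bsub>A.L\<^esub> X)"
      using p X A.mult_transp[of "[(\<phi> r, \<one>\<^bsub>R'\<^esub>)]" X] by (simp add: A.inl_def)
    also have "[(\<phi> r, \<one>\<^bsub>R'\<^esub>)] \<otimes>\<^bsub>A.L\<^esub> X = r \<odot>\<^bsub>A.L\<^esub> X"
      using X(1) by (auto simp: A.mult_L)
    finally show "r \<odot>\<^bsub>along (A.inl \<circ> \<phi>) S'\<^esub> x = r \<odot>\<^bsub>?T\<^esub> x"
      using A.smult_transp[OF r X(1)] X(2) by (simp add: sim)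
  qed (simp_all add: sim A.inl_mult_inr)
  have span: "\<exists>X\<in>lists (carrier S \<times> carrier R'). x = tev S' (\<lambda>s r. A.inl s \<otimes>\<^bsub>S'\<^esub> A.inr r) X"
    if x: "x \<in> carrier S'" for x
  proof -
    obtain X where X: "X \<in> lists (carrier S \<times> carrier R')" "x = \<kappa> X"
      using x by (auto simp: transp_simps sim simp del: in_lists_conv_set)
    have "x = tev ?T (\<lambda>s r. \<kappa> [(s, r)]) X" using A.\<kappa>_eq_tev[of X] X by simp
    also have "\<dots> = tev ?T (\<lambda>s r. A.inl s \<otimes>\<^bsub>?T\<^esub> A.inr r) X"
      by (rule tev_cong[OF X(1)]) (simp add: A.inl_mult_inr)
    also have "\<dots> = tev S' (\<lambda>s r. A.inl s \<otimes>\<^bsub>S'\<^esub> A.inr r) X" by (simp add: tev_def sim)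
    finally show ?thesis using X(1) by blast
  qed
  show ?thesis by (rule that[OF S' i p comm tens span])
qed

section \<open>Base change of faithful flatness\<close>

definition restr :: "('u \<Rightarrow> 'u) \<Rightarrow> 'u alg \<Rightarrow> 'u alg" where
  "restr g M = M\<lparr>smult := \<lambda>r x. g r \<odot>\<^bsub>M\<^esub> x\<rparr>"

lemma restr_simps [simp]:
  "carrier (restr g M) = carrier M" "ring.zero (restr g M) = ring.zero M"
  "ring.add (restr g M) = ring.add M" "r \<odot>\<^bsub>restr g M\<^esub> x = g r \<odot>\<^bsub>M\<^esub> x"
  by (simp_all add: restr_def)

lemma abelian_group_cong:
  fixes A :: "('a, 'm) ring_scheme" and B :: "('a, 'n) ring_scheme"
  assumes "abelian_group A" "carrier B = carrier A" "ring.zero B = ring.zero A" "ring.add B = ring.add A"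
  shows "abelian_group B"
proof -
  interpret abelian_group A by fact
  show ?thesis
    by (rule abelian_groupI) (use assms a_assoc a_comm l_neg in \<open>auto intro: a_inv_closed\<close>)
qed

lemma module_restr:
  assumes "cring R" "module R' M" "g \<in> ring_hom R R'"
  shows "module R (restr g M)"
proof -
  interpret M: module R' M by fact
  have "abelian_group (restr g M)"
    by (rule abelian_group_cong[OF M.abelian_group_axioms]) simp_all
  then show ?thesis
    by (rule moduleI[OF assms(1)]) (use ring_hom_memE[OF assms(3)] in
      \<open>simp_all add: M.smult_l_distr M.smult_r_distr M.smult_assoc1\<close>)
qed

lemma mod_hom_comp:
  "\<lbrakk>f \<in> mod_hom R M N; h \<in> mod_hom R N P\<rbrakk> \<Longrightarrow> (\<lambda>x. h (f x)) \<in> mod_hom R M P"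
  by (rule mod_homI) (simp_all add: mod_homD)

lemma mod_hom_add:
  assumes "f \<in> mod_hom R M N" "h \<in> mod_hom R M N" "module R N"
  shows "(\<lambda>x. f x \<oplus>\<^bsub>N\<^esub> h x) \<in> mod_hom R M N"
proof -
  interpret N: module R N by fact
  show ?thesis
    by (rule mod_homI) (simp_all add: mod_homD[OF assms(1)] mod_homD[OF assms(2)] N.smult_r_distr N.M.a_ac)
qed

lemma mod_hom_scale:
  assumes "module R N" "r \<in> carrier R"
  shows "(\<lambda>x. r \<odot>\<^bsub>N\<^esub> x) \<in> mod_hom R N N"
proof -
  interpret N: module R N by fact
  show ?thesis
    by (rule mod_homI) (use assms(2) in \<open>simp_all add: N.smult_r_distr N.smult_assoc1[symmetric] N.R.m_comm\<close>)
qed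

lemma mod_hom_id: "(\<lambda>x. x) \<in> mod_hom R M M"
  by (rule mod_homI) simp_all

lemma mod_hom_restr:
  "\<lbrakk>h \<in> mod_hom R' M N; g \<in> ring_hom R R'\<rbrakk> \<Longrightarrow> h \<in> mod_hom R (restr g M) (restr g N)"
  by (rule mod_homI) (simp_all add: mod_homD ring_hom_closed)

text \<open>A pushout square of rings, recorded through the module-theoretic universal property of
  \<open>S'\<close> over \<open>R\<close>. Both halves of the stability of fppf covers are proved in
  this setting.\<close>

locale base_change =
  fixes R S R' S' :: "'u alg" and \<phi> g i \<psi> :: "'u \<Rightarrow> 'u"
  assumes cR: "cring R" and cS: "cring S" and cR': "cring R'" and cS': "cring S'"
    and \<phi>: "\<phi> \<in> ring_hom R S" and g: "g \<in> ring_hom R R'" and i: "i \<in> ring_hom S S'" and \<psi>: "\<psi> \<in> ring_hom R' S'"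
    and comm: "\<And>r. r \<in> carrier R \<Longrightarrow> i (\<phi> r) = \<psi> (g r)"
    and tens: "is_tensor R (along \<phi> S) (along g R') (along (i \<circ> \<phi>) S') (\<lambda>s r. i s \<otimes>\<^bsub>S'\<^esub> \<psi> r)"
begin

sublocale R: cring R by (rule cR)
sublocale S: cring S by (rule cS)
sublocale R': cring R' by (rule cR')
sublocale S': cring S' by (rule cS')

lemmas \<phi>D = ring_hom_memE[OF \<phi>] and gD = ring_hom_memE[OF g] and iD = ring_hom_memE[OF i]
  and \<psi>D = ring_hom_memE[OF \<psi>]

text \<open>Cancellation of base change: tensoring an \<open>R'\<close>-module with
  \<open>S'\<close> over \<open>R'\<close> is the same as tensoring it with \<open>S\<close> over
  \<open>R\<close>. The inverse of \<open>\<gamma>\<close> sends the tensor of \<open>i s\<close>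
  times \<open>\<psi> r\<close> with \<open>x\<close> to the tensor of \<open>s\<close> with
  \<open>r\<close> times \<open>x\<close>.\<close>

lemma tensor_restr_iso:
  assumes M: "module R' M"
    and T0: "is_tensor R (along \<phi> S) (restr g M) T0 t0"
    and T1: "is_tensor R' (along \<psi> S') M T1 t1"
  obtains \<gamma> where "\<gamma> \<in> mod_hom R T0 (restr g T1)" "bij_betw \<gamma> (carrier T0) (carrier T1)"
    "\<And>s x. \<lbrakk>s \<in> carrier S; x \<in> carrier M\<rbrakk> \<Longrightarrow> \<gamma> (t0 s x) = t1 (i s) x"
proof -
  interpret M: module R' M by (rule M)
  interpret T0: module R T0 by (rule tensorD(3)[OF T0])
  interpret T1: module R' T1 by (rule tensorD(3)[OF T1])
  note t0 = bilinear_mapD[OF tensorD(4)[OF T0], simplified]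
  note t1 = bilinear_mapD[OF tensorD(4)[OF T1], simplified]
  note mT0 = tensorD(3)[OF T0] and mT1 = tensorD(3)[OF T1]
  have mrT1: "module R (restr g T1)" by (rule module_restr[OF cR mT1 g])
  \<comment> \<open>An action of \<open>R'\<close> on \<open>T0\<close> through the second factor.
    It turns \<open>T0\<close> into an \<open>R'\<close>-module, which can then receive a map from
    \<open>T1\<close>.\<close>
  have "\<exists>\<rho>. \<rho> \<in> mod_hom R T0 T0 \<and> (\<forall>s\<in>carrier S. \<forall>x\<in>carrier M. \<rho> (t0 s x) = t0 s (r' \<odot>\<^bsub>M\<^esub> x))"
    if r': "r' \<in> carrier R'" for r'
  proof -
    have "bilinear_map R (along \<phi> S) (restr g M) T0 (\<lambda>s x. t0 s (r' \<odot>\<^bsub>M\<^esub> x))"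
    proof (rule bilinear_mapI, goal_cases)
      case (5 r x y)
      have "r' \<odot>\<^bsub>M\<^esub> (g r \<odot>\<^bsub>M\<^esub> y) = g r \<odot>\<^bsub>M\<^esub> (r' \<odot>\<^bsub>M\<^esub> y)"
        using 5 r' gD by (simp add: M.smult_assoc1[symmetric] R'.m_comm)
      then show ?case using 5 r' by (simp add: t0)
    qed (use r' in \<open>simp_all add: t0 M.smult_r_distr\<close>)
    from tensor_hom[OF T0 mT0 this] show ?thesis by (metis along_simps(1) restr_simps(1))
  qed
  then obtain act where act: "\<And>r'. r' \<in> carrier R' \<Longrightarrow> act r' \<in> mod_hom R T0 T0"
    and act_t: "\<And>r' s x. \<lbrakk>r' \<in> carrier R'; s \<in> carrier S; x \<in> carrier M\<rbrakk> \<Longrightarrow> act r' (t0 s x) = t0 s (r' \<odot>\<^bsub>M\<^esub> x)"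
    by metis
  note actD = mod_homD[OF act]
  have ext0: "h z = h' z" if "module R P" "h \<in> mod_hom R T0 P" "h' \<in> mod_hom R T0 P" "z \<in> carrier T0"
    "\<And>s x. \<lbrakk>s \<in> carrier S; x \<in> carrier M\<rbrakk> \<Longrightarrow> h (t0 s x) = h' (t0 s x)" for P h h' z
    by (rule tensor_ext[OF T0 that(1,2,3) _ that(4)]) (use that(5) in simp)
  have extS: "h z = h' z" if "module R P" "h \<in> mod_hom R (along (i \<circ> \<phi>) S') P"
    "h' \<in> mod_hom R (along (i \<circ> \<phi>) S') P" "z \<in> carrier S'"
    "\<And>s r. \<lbrakk>s \<in> carrier S; r \<in> carrier R'\<rbrakk> \<Longrightarrow> h (i s \<otimes>\<^bsub>S'\<^esub> \<psi> r) = h' (i s \<otimes>\<^bsub>S'\<^esub> \<psi> r)" for P h h' z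
    by (rule tensor_ext[OF tens that(1,2,3)]) (use that(4,5) in simp_all)
  define T0' where "T0' = T0\<lparr>smult := act\<rparr>"
  have T0's: "carrier T0' = carrier T0" "ring.zero T0' = ring.zero T0" "ring.add T0' = ring.add T0"
    "smult T0' = act" by (simp_all add: T0'_def)
  have mT0': "module R' T0'"
  proof (rule moduleI[OF cR'], goal_cases)
    case 1 show ?case by (rule abelian_group_cong[OF T0.abelian_group_axioms]) (simp_all add: T0's)
  next
    case 2 then show ?case by (simp add: T0's actD)
  next
    case (3 a b x)
    have "act (a \<oplus>\<^bsub>R'\<^esub> b) x = act a x \<oplus>\<^bsub>T0\<^esub> act b x"
      by (rule ext0[OF mT0 act mod_hom_add[OF act act mT0]])
        (use 3 in \<open>simp_all add: T0's act_t M.smult_l_distr t0\<close>)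
    then show ?case by (simp add: T0's)
  next
    case 4 then show ?case by (simp add: T0's actD)
  next
    case (5 a b x)
    have "act (a \<otimes>\<^bsub>R'\<^esub> b) x = act a (act b x)"
      by (rule ext0[OF mT0 act mod_hom_comp[OF act act]])
        (use 5 in \<open>simp_all add: T0's act_t M.smult_assoc1\<close>)
    then show ?case by (simp add: T0's)
  next
    case (6 x)
    have "act \<one>\<^bsub>R'\<^esub> x = x"
      by (rule ext0[OF mT0 act mod_hom_id]) (use 6 in \<open>simp_all add: T0's act_t\<close>)
    then show ?case by (simp add: T0's)
  qed
  have act_g: "act (g r) z = r \<odot>\<^bsub>T0\<^esub> z" if "r \<in> carrier R" "z \<in> carrier T0" for r z
    by (rule ext0[OF mT0 act mod_hom_scale[OF mT0]]) (use that gD in \<open>simp_all add: act_t t0\<close>)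
  \<comment> \<open>For fixed \<open>x\<close>, a map out of \<open>S'\<close> comes from the
    universal property of \<open>S'\<close> as a tensor product over \<open>R\<close>; varying
    \<open>x\<close> then gives a map that is bilinear over \<open>R'\<close>.\<close>
  have "\<exists>\<beta>. \<beta> \<in> mod_hom R (along (i \<circ> \<phi>) S') T0 \<and>
      (\<forall>s\<in>carrier S. \<forall>r'\<in>carrier R'. \<beta> (i s \<otimes>\<^bsub>S'\<^esub> \<psi> r') = t0 s (r' \<odot>\<^bsub>M\<^esub> x))"
    if x: "x \<in> carrier M" for x
  proof -
    have "bilinear_map R (along \<phi> S) (along g R') T0 (\<lambda>s r'. t0 s (r' \<odot>\<^bsub>M\<^esub> x))"
      by (rule bilinear_mapI)
        (use x gD in \<open>simp_all add: t0 M.smult_l_distr M.smult_assoc1\<close>)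
    from tensor_hom[OF tens mT0 this] show ?thesis by (metis along_simps(1))
  qed
  then obtain \<beta> where \<beta>: "\<And>x. x \<in> carrier M \<Longrightarrow> \<beta> x \<in> mod_hom R (along (i \<circ> \<phi>) S') T0"
    and \<beta>_t: "\<And>x s r'. \<lbrakk>x \<in> carrier M; s \<in> carrier S; r' \<in> carrier R'\<rbrakk>
      \<Longrightarrow> \<beta> x (i s \<otimes>\<^bsub>S'\<^esub> \<psi> r') = t0 s (r' \<odot>\<^bsub>M\<^esub> x)"
    by metis
  note \<beta>D = mod_homD[OF \<beta>, simplified]
  have mulS: "(\<lambda>\<sigma>. \<tau> \<otimes>\<^bsub>S'\<^esub> \<sigma>) \<in> mod_hom R (along (i \<circ> \<phi>) S') (along (i \<circ> \<phi>) S')"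
    if "\<tau> \<in> carrier S'" for \<tau>
    by (rule mod_homI) (use that \<phi>D iD in \<open>auto simp: S'.r_distr S'.m_lcomm\<close>)
  have \<beta>1: "\<beta> x (\<psi> r' \<otimes>\<^bsub>S'\<^esub> \<sigma>) = act r' (\<beta> x \<sigma>)"
    if a: "x \<in> carrier M" "r' \<in> carrier R'" "\<sigma> \<in> carrier S'" for x r' \<sigma>
  proof (rule extS[OF mT0 mod_hom_comp[OF mulS \<beta>] mod_hom_comp[OF \<beta> act]])
    fix s r assume sr: "s \<in> carrier S" "r \<in> carrier R'"
    have "\<psi> r' \<otimes>\<^bsub>S'\<^esub> (i s \<otimes>\<^bsub>S'\<^esub> \<psi> r) = i s \<otimes>\<^bsub>S'\<^esub> \<psi> (r' \<otimes>\<^bsub>R'\<^esub> r)"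
      using sr a iD \<psi>D by (simp add: S'.m_lcomm)
    then show "\<beta> x (\<psi> r' \<otimes>\<^bsub>S'\<^esub> (i s \<otimes>\<^bsub>S'\<^esub> \<psi> r)) = act r' (\<beta> x (i s \<otimes>\<^bsub>S'\<^esub> \<psi> r))"
      using sr a by (simp add: \<beta>_t act_t M.smult_assoc1)
  qed (use a \<psi>D in auto)
  have \<beta>2: "\<beta> (x \<oplus>\<^bsub>M\<^esub> y) \<sigma> = \<beta> x \<sigma> \<oplus>\<^bsub>T0\<^esub> \<beta> y \<sigma>"
    if a: "x \<in> carrier M" "y \<in> carrier M" "\<sigma> \<in> carrier S'" for x y \<sigma>
    by (rule extS[OF mT0 \<beta> mod_hom_add[OF \<beta> \<beta> mT0]]) (use a in \<open>simp_all add: \<beta>_t t0 M.smult_r_distr\<close>)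
  have \<beta>3: "\<beta> (r' \<odot>\<^bsub>M\<^esub> x) \<sigma> = act r' (\<beta> x \<sigma>)"
    if a: "x \<in> carrier M" "r' \<in> carrier R'" "\<sigma> \<in> carrier S'" for x r' \<sigma>
    by (rule extS[OF mT0 \<beta> mod_hom_comp[OF \<beta> act]])
      (use a in \<open>simp_all add: \<beta>_t act_t M.smult_assoc1[symmetric] R'.m_comm\<close>)
  have "bilinear_map R' (along \<psi> S') M T0' (\<lambda>\<sigma> x. \<beta> x \<sigma>)"
    by (rule bilinear_mapI) (simp_all add: T0's \<beta>D \<beta>1 \<beta>2 \<beta>3)
  from tensor_hom[OF T1 mT0' this] obtain \<alpha> where \<alpha>: "\<alpha> \<in> mod_hom R' T1 T0'"
    and \<alpha>_t: "\<And>\<sigma> x. \<lbrakk>\<sigma> \<in> carrier S'; x \<in> carrier M\<rbrakk> \<Longrightarrow> \<alpha> (t1 \<sigma> x) = \<beta> x \<sigma>"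
    by (metis along_simps(1))
  note \<alpha>D = mod_homD[OF \<alpha>, simplified T0's]
  have "bilinear_map R (along \<phi> S) (restr g M) (restr g T1) (\<lambda>s x. t1 (i s) x)"
  proof (rule bilinear_mapI, goal_cases)
    case (4 r x y)
    then show ?case using t1(4)[of "g r" "i x" y] \<phi>D gD iD by (simp add: comm)
  qed (use iD gD in \<open>simp_all add: t1\<close>)
  from tensor_hom[OF T0 mrT1 this] obtain \<gamma> where \<gamma>: "\<gamma> \<in> mod_hom R T0 (restr g T1)"
    and \<gamma>_t: "\<And>s x. \<lbrakk>s \<in> carrier S; x \<in> carrier M\<rbrakk> \<Longrightarrow> \<gamma> (t0 s x) = t1 (i s) x"
    by (metis along_simps(1) restr_simps(1))
  note \<gamma>D = mod_homD[OF \<gamma>, simplified]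
  \<comment> \<open>\<open>\<gamma>\<close> was obtained as an \<open>R\<close>-linear map; its
    \<open>R'\<close>-linearity is what allows \<open>\<gamma>\<close> after \<open>\<alpha>\<close>
    to be compared with the identity on the pure tensors of \<open>T1\<close>.\<close>
  have \<gamma>act: "\<gamma> (act r' z) = r' \<odot>\<^bsub>T1\<^esub> \<gamma> z" if a: "r' \<in> carrier R'" "z \<in> carrier T0" for r' z
  proof (rule ext0[OF mrT1 mod_hom_comp[OF act \<gamma>] mod_hom_comp[OF \<gamma> mod_hom_restr[OF mod_hom_scale[OF mT1] g]]])
    fix s x assume "s \<in> carrier S" "x \<in> carrier M"
    then show "\<gamma> (act r' (t0 s x)) = r' \<odot>\<^bsub>T1\<^esub> \<gamma> (t0 s x)" using a iD by (simp add: act_t \<gamma>_t t1)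
  qed (use a in auto)
  have ag: "\<alpha> (\<gamma> z) = z" if z: "z \<in> carrier T0" for z
  proof (rule ext0[OF mT0 _ mod_hom_id z])
    show "(\<lambda>z. \<alpha> (\<gamma> z)) \<in> mod_hom R T0 T0"
      by (rule mod_homI) (use gD in \<open>simp_all add: \<gamma>D \<alpha>D act_g\<close>)
    fix s x assume sx: "s \<in> carrier S" "x \<in> carrier M"
    have "\<beta> x (i s) = \<beta> x (i s \<otimes>\<^bsub>S'\<^esub> \<psi> \<one>\<^bsub>R'\<^esub>)" using sx iD \<psi>D by simp
    also have "\<dots> = t0 s x" using sx by (subst \<beta>_t) simp_all
    finally show "\<alpha> (\<gamma> (t0 s x)) = t0 s x" using sx iD by (simp add: \<gamma>_t \<alpha>_t)
  qed
  have \<gamma>\<beta>: "\<gamma> (\<beta> x \<sigma>) = t1 \<sigma> x" if a: "\<sigma> \<in> carrier S'" "x \<in> carrier M" for x \<sigma>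
  proof (rule extS[OF mrT1 mod_hom_comp[OF \<beta> \<gamma>]])
    show "(\<lambda>\<sigma>. t1 \<sigma> x) \<in> mod_hom R (along (i \<circ> \<phi>) S') (restr g T1)"
      by (rule mod_homI) (use a gD comm in \<open>simp_all add: t1\<close>)
    fix s r assume sr: "s \<in> carrier S" "r \<in> carrier R'"
    have "\<gamma> (\<beta> x (i s \<otimes>\<^bsub>S'\<^esub> \<psi> r)) = t1 (i s) (r \<odot>\<^bsub>M\<^esub> x)" using sr a by (simp add: \<beta>_t \<gamma>_t)
    also have "\<dots> = t1 (\<psi> r \<otimes>\<^bsub>S'\<^esub> i s) x" using sr a iD by (simp add: t1)
    finally show "\<gamma> (\<beta> x (i s \<otimes>\<^bsub>S'\<^esub> \<psi> r)) = t1 (i s \<otimes>\<^bsub>S'\<^esub> \<psi> r) x"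
      using sr iD \<psi>D by (simp add: S'.m_comm)
  qed (use a in auto)
  have ga: "\<gamma> (\<alpha> z) = z" if z: "z \<in> carrier T1" for z
  proof (rule tensor_ext[OF T1 mT1 _ mod_hom_id _ z])
    show "(\<lambda>z. \<gamma> (\<alpha> z)) \<in> mod_hom R' T1 T1"
      by (rule mod_homI) (simp_all add: \<gamma>D \<alpha>D \<gamma>act)
  qed (simp add: \<alpha>_t \<gamma>\<beta>)
  have "bij_betw \<gamma> (carrier T0) (carrier T1)"
    by (rule bij_betwI[where g = \<alpha>]) (use ag ga \<alpha>D(1) \<gamma>D(1) in auto)
  then show ?thesis using that \<gamma> \<gamma>_t by blast
qed

text \<open>By \<open>tensor_restr_iso\<close>, tensoring with \<open>S'\<close> over
  \<open>R'\<close> agrees with restricting scalars to \<open>R\<close> and tensoring with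
  \<open>S\<close>. Restriction of scalars affects neither injectivity nor vanishing, so both
  conditions pass from \<open>S\<close> to \<open>S'\<close>.\<close>

lemma faithfully_flat_base_change:
  assumes inf: "infinite (UNIV :: 'u set)" and ff: "faithfully_flat R (along \<phi> S)"
  shows "faithfully_flat R' (along \<psi> S')"
proof -
  have mS: "module R (along \<phi> S)" by (rule module_along[OF cR cS \<phi>])
  have fl: "flat R (along \<phi> S)" and
    fa: "\<And>M T t. \<lbrakk>is_tensor R (along \<phi> S) M T t; carrier T = {\<zero>\<^bsub>T\<^esub>}\<rbrakk> \<Longrightarrow> carrier M = {\<zero>\<^bsub>M\<^esub>}"
    using ff unfolding faithfully_flat_def by blast+
  have "inj_on h (carrier T1)" if M: "module R' M" and N: "module R' N" and f: "f \<in> mod_hom R' M N"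
    and inj: "inj_on f (carrier M)" and T1: "is_tensor R' (along \<psi> S') M T1 t1"
    and T2: "is_tensor R' (along \<psi> S') N T2 t2" and h: "h \<in> mod_hom R' T1 T2"
    and ht: "\<forall>s\<in>carrier (along \<psi> S'). \<forall>x\<in>carrier M. h (t1 s x) = t2 s (f x)" for M N f T1 t1 T2 t2 h
  proof -
    note rM = module_restr[OF cR M g] and rN = module_restr[OF cR N g]
    obtain U u where U: "is_tensor R (along \<phi> S) (restr g M) U u" using tensor_exists[OF inf mS rM] by blast
    obtain V v where V: "is_tensor R (along \<phi> S) (restr g N) V v" using tensor_exists[OF inf mS rN] by blast
    obtain \<gamma> where \<gamma>: "\<gamma> \<in> mod_hom R U (restr g T1)" "bij_betw \<gamma> (carrier U) (carrier T1)"
      "\<And>s x. \<lbrakk>s \<in> carrier S; x \<in> carrier M\<rbrakk> \<Longrightarrow> \<gamma> (u s x) = t1 (i s) x"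
      using tensor_restr_iso[OF M U T1] by blast
    obtain \<delta> where \<delta>: "\<delta> \<in> mod_hom R V (restr g T2)" "bij_betw \<delta> (carrier V) (carrier T2)"
      "\<And>s x. \<lbrakk>s \<in> carrier S; x \<in> carrier N\<rbrakk> \<Longrightarrow> \<delta> (v s x) = t2 (i s) x"
      using tensor_restr_iso[OF N V T2] by blast
    have fr: "f \<in> mod_hom R (restr g M) (restr g N)" by (rule mod_hom_restr[OF f g])
    note vD = bilinear_mapD[OF tensorD(4)[OF V], simplified]
    have "bilinear_map R (along \<phi> S) (restr g M) V (\<lambda>s x. v s (f x))"
      by (rule bilinear_mapI) (use gD in \<open>simp_all add: vD mod_homD[OF f]\<close>)
    from tensor_hom[OF U tensorD(3)[OF V] this] obtain k where k: "k \<in> mod_hom R U V"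
      "\<And>s x. \<lbrakk>s \<in> carrier S; x \<in> carrier M\<rbrakk> \<Longrightarrow> k (u s x) = v s (f x)"
      by (metis along_simps(1) restr_simps(1))
    have ik: "inj_on k (carrier U)"
      using fl rM rN fr inj U V k unfolding flat_def by (metis along_simps(1) restr_simps(1))
    \<comment> \<open>Naturality of the comparison maps: \<open>h\<close> corresponds to
      \<open>k\<close> under them, as is seen on pure tensors.\<close>
    have hk: "h (\<gamma> z) = \<delta> (k z)" if z: "z \<in> carrier U" for z
    proof (rule tensor_ext[OF U _ mod_hom_comp[OF \<gamma>(1) mod_hom_restr[OF h g]] mod_hom_comp[OF k(1) \<delta>(1)] _ z])
      show "module R (restr g T2)" by (rule module_restr[OF cR tensorD(3)[OF T2] g])
    qed (use iD in \<open>simp_all add: \<gamma>(3) k(2) \<delta>(3) ht mod_homD(1)[OF f]\<close>)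
    show ?thesis
    proof (rule inj_onI)
      fix x y assume xy: "x \<in> carrier T1" "y \<in> carrier T1" "h x = h y"
      obtain x0 y0 where x0: "x0 \<in> carrier U" "x = \<gamma> x0" and y0: "y0 \<in> carrier U" "y = \<gamma> y0"
        using xy \<gamma>(2) unfolding bij_betw_def by blast
      have "\<delta> (k x0) = \<delta> (k y0)" using xy hk x0 y0 by simp
      then have "k x0 = k y0" using \<delta>(2) mod_homD(1)[OF k(1)] x0 y0 unfolding bij_betw_def inj_on_def by blast
      then show "x = y" using ik x0 y0 unfolding inj_on_def by blast
    qed
  qed
  then have flat': "flat R' (along \<psi> S')"
    unfolding flat_def using module_along[OF cR' cS' \<psi>] by blast
  have "carrier M = {\<zero>\<^bsub>M\<^esub>}" if T1: "is_tensor R' (along \<psi> S') M T1 t1" and z: "carrier T1 = {\<zero>\<^bsub>T1\<^esub>}" for M T1 t1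
  proof -
    note M = tensorD(2)[OF T1]
    note rM = module_restr[OF cR M g]
    obtain U u where U: "is_tensor R (along \<phi> S) (restr g M) U u" using tensor_exists[OF inf mS rM] by blast
    interpret U: module R U by (rule tensorD(3)[OF U])
    obtain \<gamma> where \<gamma>: "bij_betw \<gamma> (carrier U) (carrier T1)"
      using tensor_restr_iso[OF M U T1] by blast
    have "x = \<zero>\<^bsub>U\<^esub>" if "x \<in> carrier U" for x
      using \<gamma> z that U.M.zero_closed unfolding bij_betw_def inj_on_def by (metis imageI singletonD)
    then have "carrier U = {\<zero>\<^bsub>U\<^esub>}" using U.M.zero_closed by blast
    from fa[OF U this] show ?thesis by simp
  qed
  then show ?thesis unfolding faithfully_flat_def using flat' by blast
qed

end

section \<open>Polynomial rings and base change of finite presentations\<close>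

text \<open>The product of two polynomials is a sum over sub-multisets; isolating a single summand
  of it needs a finite index set.\<close>

lemma finite_submultisets: "finite {k. k \<subseteq># (m :: 'a multiset)}"
proof (induction m)
  case (add x m)
  have "{k. k \<subseteq># add_mset x m} \<subseteq> {k. k \<subseteq># m} \<union> add_mset x ` {k. k \<subseteq># m}"
  proof
    fix k assume k: "k \<in> {k. k \<subseteq># add_mset x m}"
    show "k \<in> {k. k \<subseteq># m} \<union> add_mset x ` {k. k \<subseteq># m}"
    proof (cases "x \<in># k")
      case True
      then obtain k' where "k = add_mset x k'" by (meson multi_member_split)
      then show ?thesis using k by auto
    next
      case False
      then have "count k y \<le> count m y" for y
        using k mset_subset_eq_count[of k "add_mset x m" y] by (cases "y = x") (auto simp: not_in_iff)
      then show ?thesis by (simp add: subseteq_mset_def)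
    qed
  qed
  then show ?case using add by (meson finite_Un finite_imageI finite_subset)
qed simp

locale mpoly = R: cring R for R :: "'u alg" + fixes n :: nat
begin

abbreviation "P \<equiv> mpoly_ring R n"

definition mono :: "'u \<Rightarrow> nat multiset \<Rightarrow> nat multiset \<Rightarrow> 'u" where
  "mono r m = (\<lambda>k. if k = m then r else \<zero>\<^bsub>R\<^esub>)"

definition vars :: "nat multiset set" where
  "vars = {m. set_mset m \<subseteq> {..<n}}"

lemma vars_simps [simp]: "{#} \<in> vars" "k + l \<in> vars \<longleftrightarrow> k \<in> vars \<and> l \<in> vars"
  by (auto simp: vars_def)

lemma P_simps:
  "carrier P = {p. (\<forall>m. p m \<in> carrier R) \<and> finite {m. p m \<noteq> \<zero>\<^bsub>R\<^esub>} \<and> (\<forall>m. p m \<noteq> \<zero>\<^bsub>R\<^esub> \<longrightarrow> m \<in> vars)}"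
  "p \<otimes>\<^bsub>P\<^esub> q = (\<lambda>m. \<Oplus>\<^bsub>R\<^esub>k\<in>{k. k \<subseteq># m}. p k \<otimes>\<^bsub>R\<^esub> q (m - k))"
  "\<one>\<^bsub>P\<^esub> = mono \<one>\<^bsub>R\<^esub> {#}" "\<zero>\<^bsub>P\<^esub> = (\<lambda>m. \<zero>\<^bsub>R\<^esub>)" "p \<oplus>\<^bsub>P\<^esub> q = (\<lambda>m. p m \<oplus>\<^bsub>R\<^esub> q m)"
  by (simp_all add: mpoly_ring_def mono_def vars_def)

lemma coeff_closed: "p \<in> carrier P \<Longrightarrow> p m \<in> carrier R"
  by (simp add: P_simps)

lemma mono_closed [simp]: "\<lbrakk>r \<in> carrier R; m \<in> vars\<rbrakk> \<Longrightarrow> mono r m \<in> carrier P"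
proof -
  assume "r \<in> carrier R" "m \<in> vars"
  moreover have "{k. mono r m k \<noteq> \<zero>\<^bsub>R\<^esub>} \<subseteq> {m}" by (auto simp: mono_def)
  ultimately show ?thesis by (auto simp: P_simps mono_def finite_subset)
qed

lemma zero_closed: "\<zero>\<^bsub>P\<^esub> \<in> carrier P"
  by (simp add: P_simps)

lemma add_closed: "\<lbrakk>p \<in> carrier P; q \<in> carrier P\<rbrakk> \<Longrightarrow> p \<oplus>\<^bsub>P\<^esub> q \<in> carrier P"
proof -
  assume pq: "p \<in> carrier P" "q \<in> carrier P"
  have "{m. p m \<oplus>\<^bsub>R\<^esub> q m \<noteq> \<zero>\<^bsub>R\<^esub>} \<subseteq> {m. p m \<noteq> \<zero>\<^bsub>R\<^esub>} \<union> {m. q m \<noteq> \<zero>\<^bsub>R\<^esub>}" by auto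
  then have "finite {m. p m \<oplus>\<^bsub>R\<^esub> q m \<noteq> \<zero>\<^bsub>R\<^esub>}" using pq by (auto simp: P_simps finite_subset)
  moreover have "m \<in> vars" if "p m \<oplus>\<^bsub>R\<^esub> q m \<noteq> \<zero>\<^bsub>R\<^esub>" for m
    using that pq by (cases "p m = \<zero>\<^bsub>R\<^esub>") (auto simp: P_simps)
  ultimately show ?thesis using pq by (auto simp: P_simps)
qed

lemma abelian_group_P: "abelian_group P"
proof (rule abelian_groupI, goal_cases)
  case (6 p)
  have "{m. \<ominus>\<^bsub>R\<^esub> p m \<noteq> \<zero>\<^bsub>R\<^esub>} = {m. p m \<noteq> \<zero>\<^bsub>R\<^esub>}"
    using 6 by (auto simp: P_simps)
  moreover have "m \<in> vars" if "\<ominus>\<^bsub>R\<^esub> p m \<noteq> \<zero>\<^bsub>R\<^esub>" for m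
    using that 6 by (cases "p m = \<zero>\<^bsub>R\<^esub>") (auto simp: P_simps)
  ultimately have "(\<lambda>m. \<ominus>\<^bsub>R\<^esub> p m) \<in> carrier P" using 6 by (auto simp: P_simps)
  then show ?case using 6
    by (intro bexI[of _ "\<lambda>m. \<ominus>\<^bsub>R\<^esub> p m"]) (auto simp: P_simps R.l_neg)
next
  case 1 then show ?case by (rule add_closed)
next
  case 2 then show ?case by (rule zero_closed)
next
  case 4 then show ?case by (simp add: P_simps(5) coeff_closed R.a_comm)
qed (simp_all add: P_simps(4,5) coeff_closed R.a_assoc)

sublocale P: abelian_group P by (rule abelian_group_P)

text \<open>Induction on the support, splitting off one monomial at a time. Associativity,
  commutativity and the unit law are proved by this rule, which reduces them to products of
  monomials and avoids rearranging convolution sums.\<close>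

lemma P_induct [consumes 1, case_names zero mono]:
  assumes "p \<in> carrier P" and zero: "Q \<zero>\<^bsub>P\<^esub>"
    and step: "\<And>r m p. \<lbrakk>r \<in> carrier R; m \<in> vars; p \<in> carrier P; Q p\<rbrakk> \<Longrightarrow> Q (mono r m \<oplus>\<^bsub>P\<^esub> p)"
  shows "Q p"
proof -
  have "finite {m. p m \<noteq> \<zero>\<^bsub>R\<^esub>}" using assms(1) by (simp add: P_simps)
  then show ?thesis using assms(1)
  proof (induction "{m. p m \<noteq> \<zero>\<^bsub>R\<^esub>}" arbitrary: p rule: finite_induct)
    case empty
    then have "p = \<zero>\<^bsub>P\<^esub>" by (auto simp: P_simps)
    then show ?case using zero by simp
  next
    case (insert m F)
    let ?q = "p(m := \<zero>\<^bsub>R\<^esub>)"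
    have F: "F = {k. ?q k \<noteq> \<zero>\<^bsub>R\<^esub>}" using insert by auto
    have q: "?q \<in> carrier P"
      using insert.prems insert.hyps(1) unfolding F by (auto simp: P_simps)
    have m: "m \<in> vars" "p m \<in> carrier R" using insert by (auto simp: P_simps)
    have "p = mono (p m) m \<oplus>\<^bsub>P\<^esub> ?q"
      using insert.prems by (auto simp: P_simps mono_def fun_eq_iff)
    then show ?case using step[OF m(2,1) q] insert.hyps(3)[OF F q] by simp
  qed
qed

lemma l_distr:
  assumes "p \<in> carrier P" "q \<in> carrier P" "s \<in> carrier P"
  shows "(p \<oplus>\<^bsub>P\<^esub> q) \<otimes>\<^bsub>P\<^esub> s = p \<otimes>\<^bsub>P\<^esub> s \<oplus>\<^bsub>P\<^esub> q \<otimes>\<^bsub>P\<^esub> s"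
  unfolding P_simps(2,5)
  by (rule ext, subst R.finsum_addf[symmetric])
    (auto simp: coeff_closed[OF assms(1)] coeff_closed[OF assms(2)] coeff_closed[OF assms(3)] R.l_distr
      intro!: R.finsum_cong')

lemma r_distr:
  assumes "p \<in> carrier P" "q \<in> carrier P" "s \<in> carrier P"
  shows "s \<otimes>\<^bsub>P\<^esub> (p \<oplus>\<^bsub>P\<^esub> q) = s \<otimes>\<^bsub>P\<^esub> p \<oplus>\<^bsub>P\<^esub> s \<otimes>\<^bsub>P\<^esub> q"
  unfolding P_simps(2,5)
  by (rule ext, subst R.finsum_addf[symmetric])
    (auto simp: coeff_closed[OF assms(1)] coeff_closed[OF assms(2)] coeff_closed[OF assms(3)] R.r_distr
      intro!: R.finsum_cong')

lemma zero_mult: "p \<in> carrier P \<Longrightarrow> \<zero>\<^bsub>P\<^esub> \<otimes>\<^bsub>P\<^esub> p = \<zero>\<^bsub>P\<^esub>" "p \<in> carrier P \<Longrightarrow> p \<otimes>\<^bsub>P\<^esub> \<zero>\<^bsub>P\<^esub> = \<zero>\<^bsub>P\<^esub>"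
  by (auto simp: P_simps(2,4) coeff_closed intro!: R.add.finprod_one_eqI)

text \<open>In the convolution only the sub-multiset \<open>k\<close> can contribute, and it does so
  only at the monomial \<open>k + l\<close>.\<close>

lemma mono_mult:
  assumes "r \<in> carrier R" "s \<in> carrier R"
  shows "mono r k \<otimes>\<^bsub>P\<^esub> mono s l = mono (r \<otimes>\<^bsub>R\<^esub> s) (k + l)"
proof
  fix m
  have "(mono r k \<otimes>\<^bsub>P\<^esub> mono s l) m =
      (\<Oplus>\<^bsub>R\<^esub>j\<in>{j. j \<subseteq># m}. if k = j then (if m = k + l then r \<otimes>\<^bsub>R\<^esub> s else \<zero>\<^bsub>R\<^esub>) else \<zero>\<^bsub>R\<^esub>)"
    unfolding P_simps(2)
    by (rule R.finsum_cong') (use assms in \<open>auto simp: mono_def subset_mset.diff_add_assoc\<close>)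
  also have "\<dots> = mono (r \<otimes>\<^bsub>R\<^esub> s) (k + l) m"
  proof (cases "k \<subseteq># m")
    case True
    then show ?thesis
      using R.finsum_singleton[of k "{j. j \<subseteq># m}" "\<lambda>j. if m = k + l then r \<otimes>\<^bsub>R\<^esub> s else \<zero>\<^bsub>R\<^esub>"]
        finite_submultisets[of m] assms by (auto simp: mono_def)
  next
    case False
    then show ?thesis by (auto simp: mono_def intro!: R.add.finprod_one_eqI)
  qed
  finally show "(mono r k \<otimes>\<^bsub>P\<^esub> mono s l) m = mono (r \<otimes>\<^bsub>R\<^esub> s) (k + l) m" .
qed

lemma mult_closed: "\<lbrakk>p \<in> carrier P; q \<in> carrier P\<rbrakk> \<Longrightarrow> p \<otimes>\<^bsub>P\<^esub> q \<in> carrier P"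
proof (induction p rule: P_induct)
  case zero then show ?case by (simp add: zero_mult)
next
  case (mono r m p)
  from \<open>q \<in> carrier P\<close> have "mono r m \<otimes>\<^bsub>P\<^esub> q \<in> carrier P"
  proof (induction q rule: P_induct)
    case zero then show ?case using mono by (simp add: zero_mult)
  next
    case (mono s l q)
    then show ?case using \<open>r \<in> _\<close> \<open>m \<in> _\<close> by (simp add: r_distr mono_mult)
  qed
  then show ?case using mono by (simp add: l_distr)
qed

lemma mult_comm: "\<lbrakk>p \<in> carrier P; q \<in> carrier P\<rbrakk> \<Longrightarrow> p \<otimes>\<^bsub>P\<^esub> q = q \<otimes>\<^bsub>P\<^esub> p"
proof (induction p rule: P_induct)
  case zero then show ?case by (simp add: zero_mult)
next
  case (mono r m p)
  from \<open>q \<in> carrier P\<close> have "mono r m \<otimes>\<^bsub>P\<^esub> q = q \<otimes>\<^bsub>P\<^esub> mono r m"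
  proof (induction q rule: P_induct)
    case zero then show ?case using mono by (simp add: zero_mult)
  next
    case (mono s l q)
    then show ?case using \<open>r \<in> _\<close> \<open>m \<in> _\<close>
      by (simp add: r_distr l_distr mono_mult R.m_comm add.commute)
  qed
  then show ?case using mono by (simp add: l_distr r_distr)
qed

lemma mult_assoc:
  "\<lbrakk>p \<in> carrier P; q \<in> carrier P; s \<in> carrier P\<rbrakk> \<Longrightarrow> (p \<otimes>\<^bsub>P\<^esub> q) \<otimes>\<^bsub>P\<^esub> s = p \<otimes>\<^bsub>P\<^esub> (q \<otimes>\<^bsub>P\<^esub> s)"
proof (induction p rule: P_induct)
  case zero then show ?case by (simp add: zero_mult mult_closed)
next
  case (mono r m p)
  from \<open>q \<in> carrier P\<close> \<open>s \<in> carrier P\<close> have "(mono r m \<otimes>\<^bsub>P\<^esub> q) \<otimes>\<^bsub>P\<^esub> s = mono r m \<otimes>\<^bsub>P\<^esub> (q \<otimes>\<^bsub>P\<^esub> s)"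
  proof (induction q rule: P_induct)
    case zero then show ?case using mono by (simp add: zero_mult)
  next
    case (mono r' m' q)
    note rm = \<open>r \<in> _\<close> \<open>m \<in> _\<close> \<open>r' \<in> _\<close> \<open>m' \<in> _\<close>
    from \<open>s \<in> carrier P\<close> have "(mono r m \<otimes>\<^bsub>P\<^esub> mono r' m') \<otimes>\<^bsub>P\<^esub> s = mono r m \<otimes>\<^bsub>P\<^esub> (mono r' m' \<otimes>\<^bsub>P\<^esub> s)"
    proof (induction s rule: P_induct)
      case zero then show ?case using rm by (simp add: zero_mult mult_closed)
    next
      case (mono r'' m'' s)
      then show ?case using rm
        by (simp add: r_distr mult_closed mono_mult R.m_assoc add.assoc)
    qed
    then show ?case using mono rm by (simp add: r_distr l_distr mult_closed)
  qed
  then show ?case using mono by (simp add: l_distr mult_closed)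
qed

lemma one_mult: "p \<in> carrier P \<Longrightarrow> \<one>\<^bsub>P\<^esub> \<otimes>\<^bsub>P\<^esub> p = p"
proof (induction p rule: P_induct)
  case zero then show ?case by (simp add: zero_mult P_simps(3))
next
  case (mono r m p)
  then show ?case by (simp add: P_simps(3) r_distr mono_mult)
qed

lemma one_closed: "\<one>\<^bsub>P\<^esub> \<in> carrier P"
  by (simp add: P_simps(3))

lemma cring_P: "cring P"
  by (rule cringI[OF abelian_group_P comm_monoidI])
    (auto simp: mult_closed mult_assoc one_mult l_distr one_closed intro: mult_comm)

sublocale P: cring P by (rule cring_P)

lemma additive_eqI:
  assumes B: "abelian_group B" and p: "p \<in> carrier P"
    and fc: "\<And>p. p \<in> carrier P \<Longrightarrow> f p \<in> carrier B"
    and f: "\<And>p q. \<lbrakk>p \<in> carrier P; q \<in> carrier P\<rbrakk> \<Longrightarrow> f (p \<oplus>\<^bsub>P\<^esub> q) = f p \<oplus>\<^bsub>B\<^esub> f q"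
    and h: "\<And>p q. \<lbrakk>p \<in> carrier P; q \<in> carrier P\<rbrakk> \<Longrightarrow> h (p \<oplus>\<^bsub>P\<^esub> q) = h p \<oplus>\<^bsub>B\<^esub> h q"
    and eq: "\<And>r m. \<lbrakk>r \<in> carrier R; m \<in> vars\<rbrakk> \<Longrightarrow> f (mono r m) = h (mono r m)"
  shows "f p = h p"
  using p
proof (induction p rule: P_induct)
  \<comment> \<open>The zero polynomial is a monomial with coefficient zero, so \<open>eq\<close>
    covers it.\<close>
  case zero
  have "\<zero>\<^bsub>P\<^esub> = mono \<zero>\<^bsub>R\<^esub> {#}" by (auto simp: P_simps mono_def)
  then show ?case using eq[of "\<zero>\<^bsub>R\<^esub>" "{#}"] by simp
next
  case (mono r m p)
  then show ?case by (simp add: f h eq)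
qed

text \<open>The evaluation is prescribed by a multiplicative map \<open>\<chi>\<close> on monomials
  instead of values of the variables. It will be applied to a \<open>\<chi>\<close> read off from a
  given presentation, so products over the variables of a monomial never have to be formed.\<close>

definition ev :: "('b, 'x) ring_scheme \<Rightarrow> ('u \<Rightarrow> 'b) \<Rightarrow> (nat multiset \<Rightarrow> 'b) \<Rightarrow> (nat multiset \<Rightarrow> 'u) \<Rightarrow> 'b" where
  "ev B \<psi> \<chi> p = (\<Oplus>\<^bsub>B\<^esub>m\<in>{m. p m \<noteq> \<zero>\<^bsub>R\<^esub>}. \<psi> (p m) \<otimes>\<^bsub>B\<^esub> \<chi> m)"

context
  fixes B :: "('b, 'x) ring_scheme" and \<psi> :: "'u \<Rightarrow> 'b" and \<chi> :: "nat multiset \<Rightarrow> 'b"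
  assumes B: "cring B" and \<psi>: "\<psi> \<in> ring_hom R B"
    and \<chi>: "\<And>m. m \<in> vars \<Longrightarrow> \<chi> m \<in> carrier B" "\<chi> {#} = \<one>\<^bsub>B\<^esub>"
      "\<And>k l. \<lbrakk>k \<in> vars; l \<in> vars\<rbrakk> \<Longrightarrow> \<chi> (k + l) = \<chi> k \<otimes>\<^bsub>B\<^esub> \<chi> l"
begin

interpretation B: cring B by (rule B)
interpretation \<psi>: ring_hom_cring R B \<psi>
  by (rule ring_hom_cringI[OF ring_hom_ringI2[OF R.ring_axioms B.ring_axioms \<psi>] R.is_cring B])

text \<open>\<open>ev\<close> sums over the support, which varies with the polynomial; a common
  finite index set is needed before two evaluations can be added.\<close>

lemma ev_superset:
  assumes "p \<in> carrier P" "finite A" "{m. p m \<noteq> \<zero>\<^bsub>R\<^esub>} \<subseteq> A" "A \<subseteq> vars"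
  shows "ev B \<psi> \<chi> p = (\<Oplus>\<^bsub>B\<^esub>m\<in>A. \<psi> (p m) \<otimes>\<^bsub>B\<^esub> \<chi> m)"
  unfolding ev_def
  by (rule B.add.finprod_mono_neutral_cong_left) (use assms \<chi> coeff_closed[OF assms(1)] in auto)

lemma ev_closed: "p \<in> carrier P \<Longrightarrow> ev B \<psi> \<chi> p \<in> carrier B"
  unfolding ev_def by (rule B.finsum_closed) (auto simp: P_simps \<chi>)

lemma ev_add:
  assumes "p \<in> carrier P" "q \<in> carrier P"
  shows "ev B \<psi> \<chi> (p \<oplus>\<^bsub>P\<^esub> q) = ev B \<psi> \<chi> p \<oplus>\<^bsub>B\<^esub> ev B \<psi> \<chi> q"
proof -
  define A where "A = {m. p m \<noteq> \<zero>\<^bsub>R\<^esub>} \<union> {m. q m \<noteq> \<zero>\<^bsub>R\<^esub>}"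
  have A: "finite A" "A \<subseteq> vars" using assms by (auto simp: A_def P_simps)
  have "{m. (p \<oplus>\<^bsub>P\<^esub> q) m \<noteq> \<zero>\<^bsub>R\<^esub>} \<subseteq> A" by (auto simp: A_def P_simps)
  note ss = ev_superset[OF add_closed[OF assms] A(1) this A(2)]
    ev_superset[OF assms(1) A(1) _ A(2)] ev_superset[OF assms(2) A(1) _ A(2)]
  have sub: "{m. p m \<noteq> \<zero>\<^bsub>R\<^esub>} \<subseteq> A" "{m. q m \<noteq> \<zero>\<^bsub>R\<^esub>} \<subseteq> A" by (auto simp: A_def)
  have cl: "p m \<in> carrier R" "q m \<in> carrier R" for m using assms by (simp_all add: coeff_closed)
  have "(\<Oplus>\<^bsub>B\<^esub>m\<in>A. \<psi> ((p \<oplus>\<^bsub>P\<^esub> q) m) \<otimes>\<^bsub>B\<^esub> \<chi> m) =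
      (\<Oplus>\<^bsub>B\<^esub>m\<in>A. \<psi> (p m) \<otimes>\<^bsub>B\<^esub> \<chi> m \<oplus>\<^bsub>B\<^esub> \<psi> (q m) \<otimes>\<^bsub>B\<^esub> \<chi> m)"
    by (rule B.finsum_cong') (use A(2) cl \<chi>(1) in \<open>auto simp: P_simps B.l_distr subset_iff\<close>)
  also have "\<dots> = (\<Oplus>\<^bsub>B\<^esub>m\<in>A. \<psi> (p m) \<otimes>\<^bsub>B\<^esub> \<chi> m) \<oplus>\<^bsub>B\<^esub> (\<Oplus>\<^bsub>B\<^esub>m\<in>A. \<psi> (q m) \<otimes>\<^bsub>B\<^esub> \<chi> m)"
    by (rule B.finsum_addf) (use A(2) cl \<chi>(1) in auto)
  finally show ?thesis using ss(1) ss(2)[OF sub(1)] ss(3)[OF sub(2)] by simp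
qed

lemma ev_mono:
  assumes "r \<in> carrier R" "m \<in> vars"
  shows "ev B \<psi> \<chi> (mono r m) = \<psi> r \<otimes>\<^bsub>B\<^esub> \<chi> m"
proof -
  have "ev B \<psi> \<chi> (mono r m) = (\<Oplus>\<^bsub>B\<^esub>k\<in>{m}. \<psi> (mono r m k) \<otimes>\<^bsub>B\<^esub> \<chi> k)"
    by (rule ev_superset[OF mono_closed[OF assms]]) (use assms in \<open>auto simp: mono_def\<close>)
  also have "\<dots> = \<psi> r \<otimes>\<^bsub>B\<^esub> \<chi> m" using assms \<chi> by (simp add: mono_def)
  finally show ?thesis .
qed

lemma ev_zero: "ev B \<psi> \<chi> \<zero>\<^bsub>P\<^esub> = \<zero>\<^bsub>B\<^esub>"
  by (simp add: ev_def P_simps)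

lemma ev_hom: "ev B \<psi> \<chi> \<in> ring_hom P B"
proof (rule ring_hom_memI)
  fix p q assume pq: "p \<in> carrier P" "q \<in> carrier P"
  then show "ev B \<psi> \<chi> (p \<otimes>\<^bsub>P\<^esub> q) = ev B \<psi> \<chi> p \<otimes>\<^bsub>B\<^esub> ev B \<psi> \<chi> q"
  proof (induction p rule: P_induct)
    case zero then show ?case by (simp add: zero_mult ev_zero ev_closed)
  next
    case (mono r m p)
    from \<open>q \<in> carrier P\<close> have "ev B \<psi> \<chi> (mono r m \<otimes>\<^bsub>P\<^esub> q) = ev B \<psi> \<chi> (mono r m) \<otimes>\<^bsub>B\<^esub> ev B \<psi> \<chi> q"
    proof (induction q rule: P_induct)
      case zero then show ?case using mono by (simp add: zero_mult ev_zero ev_closed)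
    next
      case (mono s l q)
      have "ev B \<psi> \<chi> (mono r m \<otimes>\<^bsub>P\<^esub> mono s l) = ev B \<psi> \<chi> (mono r m) \<otimes>\<^bsub>B\<^esub> ev B \<psi> \<chi> (mono s l)"
        using mono \<open>r \<in> _\<close> \<open>m \<in> _\<close> \<chi> by (simp add: mono_mult ev_mono B.m_ac)
      then show ?case using mono \<open>r \<in> _\<close> \<open>m \<in> _\<close>
        by (simp add: r_distr ev_add mult_closed ev_closed B.r_distr)
    qed
    then show ?case using mono by (simp add: l_distr ev_add mult_closed ev_closed B.l_distr)
  qed
next
  show "ev B \<psi> \<chi> \<one>\<^bsub>P\<^esub> = \<one>\<^bsub>B\<^esub>" using \<chi> by (simp add: P_simps(3) ev_mono)
qed (auto simp: ev_closed ev_add)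

end

text \<open>The polynomial ring does not live in \<open>'u\<close>, but the modules against which a
  tensor product is tested do. A polynomial is coded by a list of its nonzero coefficients, each
  paired with a code of its monomial; this makes quotients of the polynomial ring available in
  \<open>'u\<close>.\<close>

lemma P_embeds:
  assumes "infinite (UNIV :: 'u set)"
  shows "\<exists>enc :: (nat multiset \<Rightarrow> 'u) \<Rightarrow> 'u. inj_on enc (carrier P)"
proof -
  obtain f :: "'u list \<Rightarrow> 'u" and k :: "nat \<Rightarrow> 'u" and f2 :: "('u \<times> 'u) list \<Rightarrow> 'u"
    where f: "inj f" and k: "inj k" and f2: "inj f2"
    using infinite_inj_lists[OF assms] infinite_countable_subset[OF assms] infinite_inj_pair_lists[OF assms] by blast
  define e where "e = (\<lambda>m. f (map k (sorted_list_of_multiset m)))"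
  have e: "inj e" unfolding e_def
    by (rule injI) (metis f k inj_eq inj_map_eq_map mset_sorted_list_of_multiset)
  define L where "L = (\<lambda>p :: nat multiset \<Rightarrow> 'u. SOME xs. set xs = (\<lambda>m. (e m, p m)) ` {m. p m \<noteq> \<zero>\<^bsub>R\<^esub>})"
  have L: "set (L p) = (\<lambda>m. (e m, p m)) ` {m. p m \<noteq> \<zero>\<^bsub>R\<^esub>}" if "p \<in> carrier P" for p
    unfolding L_def by (rule someI_ex, rule finite_list) (use that in \<open>simp add: P_simps\<close>)
  have "inj_on (\<lambda>p. f2 (L p)) (carrier P)"
  proof (rule inj_onI)
    fix p q assume pq: "p \<in> carrier P" "q \<in> carrier P" "f2 (L p) = f2 (L q)"
    then have "L p = L q" using f2 by (simp add: inj_eq)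
    then have s: "(\<lambda>m. (e m, p m)) ` {m. p m \<noteq> \<zero>\<^bsub>R\<^esub>} = (\<lambda>m. (e m, q m)) ` {m. q m \<noteq> \<zero>\<^bsub>R\<^esub>}"
      using L[OF pq(1)] L[OF pq(2)] by simp
    show "p = q"
    proof
      fix m
      have e_iff: "(e m, x) \<in> (\<lambda>m. (e m, p' m)) ` {m. p' m \<noteq> \<zero>\<^bsub>R\<^esub>} \<longleftrightarrow> p' m = x \<and> x \<noteq> \<zero>\<^bsub>R\<^esub>"
        for p' :: "nat multiset \<Rightarrow> 'u" and x
        using e by (auto simp: inj_eq)
      have "p m = x \<and> x \<noteq> \<zero>\<^bsub>R\<^esub> \<longleftrightarrow> q m = x \<and> x \<noteq> \<zero>\<^bsub>R\<^esub>" for x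
        by (simp only: e_iff[symmetric] s)
      from this[of "p m"] this[of "q m"] show "p m = q m" by auto
    qed
  qed
  then show ?thesis by blast
qed

end

section \<open>Stability of finite presentation\<close>

context base_change
begin

text \<open>If S is R[X] modulo the relations \<open>J\<close>, then S' is R'[X] modulo their
  images. The point is that the ideal \<open>I\<close> of the images is the whole kernel: the
  universal property of \<open>S'\<close> gives a map \<open>\<Gamma>\<close> from \<open>S'\<close>
  to R'[X] modulo \<open>I\<close>, and \<open>\<Gamma>\<close> after \<open>h'\<close> is the
  quotient map, so whatever \<open>h'\<close> kills lies in \<open>I\<close>.\<close>

lemma finitely_presented_base_change:
  assumes inf: "infinite (UNIV :: 'u set)" and fp: "finitely_presented R S \<phi>"
    and span: "\<And>x. x \<in> carrier S' \<Longrightarrow>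
      \<exists>X\<in>lists (carrier S \<times> carrier R'). x = tev S' (\<lambda>s r. i s \<otimes>\<^bsub>S'\<^esub> \<psi> r) X"
  shows "finitely_presented R' S' \<psi>"
proof -
  obtain n h J where h: "h \<in> ring_hom (mpoly_ring R n) S" and hs: "h ` carrier (mpoly_ring R n) = carrier S"
    and hc: "\<And>r. r \<in> carrier R \<Longrightarrow> h (\<lambda>m. if m = {#} then r else \<zero>\<^bsub>R\<^esub>) = \<phi> r"
    and J: "finite J" "J \<subseteq> carrier (mpoly_ring R n)"
    and ker: "a_kernel (mpoly_ring R n) S h = genideal (mpoly_ring R n) J"
    using fp unfolding finitely_presented_def by blast
  interpret A: mpoly R n by unfold_locales
  interpret A': mpoly R' n by unfold_locales
  note hD = ring_hom_memE[OF h]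
  have h_mono: "h (A.mono r m) = \<phi> r \<otimes>\<^bsub>S\<^esub> h (A.mono \<one>\<^bsub>R\<^esub> m)" if "r \<in> carrier R" "m \<in> A.vars" for r m
  proof -
    have "A.mono r m = A.mono r {#} \<otimes>\<^bsub>A.P\<^esub> A.mono \<one>\<^bsub>R\<^esub> m" using that by (simp add: A.mono_mult)
    moreover have "h (A.mono r {#}) = \<phi> r" using hc[OF that(1)] by (simp add: A.mono_def)
    ultimately show ?thesis using that by (simp add: hD)
  qed
  define G where "G = (\<lambda>(p :: nat multiset \<Rightarrow> 'u) m. g (p m))"
  interpret g: ring_hom_cring R R' g
    by (rule ring_hom_cringI[OF ring_hom_ringI2[OF R.ring_axioms R'.ring_axioms g] cR cR'])
  have G: "G \<in> ring_hom A.P A'.P"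
  proof (rule ring_hom_memI)
    fix p assume p: "p \<in> carrier A.P"
    have "{m. g (p m) \<noteq> \<zero>\<^bsub>R'\<^esub>} \<subseteq> {m. p m \<noteq> \<zero>\<^bsub>R\<^esub>}" by auto
    then have "finite {m. G p m \<noteq> \<zero>\<^bsub>R'\<^esub>}"
      using p finite_subset unfolding A.P_simps(1) G_def by blast
    moreover have "m \<in> A.vars" if "G p m \<noteq> \<zero>\<^bsub>R'\<^esub>" for m
      using that p by (cases "p m = \<zero>\<^bsub>R\<^esub>") (auto simp: A.P_simps G_def)
    moreover have "G p m \<in> carrier R'" for m using A.coeff_closed[OF p] by (simp add: G_def)
    ultimately show "G p \<in> carrier A'.P" by (simp add: A'.P_simps)
    fix q assume q: "q \<in> carrier A.P"
    have c: "p m \<in> carrier R" "q m \<in> carrier R" for m using A.coeff_closed p q by auto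
    show "G (p \<oplus>\<^bsub>A.P\<^esub> q) = G p \<oplus>\<^bsub>A'.P\<^esub> G q" by (simp add: A.P_simps A'.P_simps G_def c)
    have "g (\<Oplus>\<^bsub>R\<^esub>k\<in>{k. k \<subseteq># m}. p k \<otimes>\<^bsub>R\<^esub> q (m - k)) = (\<Oplus>\<^bsub>R'\<^esub>k\<in>{k. k \<subseteq># m}. g (p k) \<otimes>\<^bsub>R'\<^esub> g (q (m - k)))" for m
      using c by (subst g.hom_finsum) (auto intro!: R'.finsum_cong')
    then show "G (p \<otimes>\<^bsub>A.P\<^esub> q) = G p \<otimes>\<^bsub>A'.P\<^esub> G q" by (simp add: A.P_simps A'.P_simps G_def)
  next
    show "G \<one>\<^bsub>A.P\<^esub> = \<one>\<^bsub>A'.P\<^esub>" by (auto simp: A.P_simps A'.P_simps G_def A.mono_def A'.mono_def)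
  qed
  note GD = ring_hom_memE[OF G]
  have G_mono: "G (A.mono r m) = A'.mono (g r) m" for r m
    by (auto simp: G_def A.mono_def A'.mono_def)
  \<comment> \<open>A monomial over \<open>R'\<close> goes where the given presentation of
    \<open>S\<close> sends it, followed by \<open>i\<close>.\<close>
  define \<chi> where "\<chi> = (\<lambda>m. i (h (A.mono \<one>\<^bsub>R\<^esub> m)))"
  have \<chi>: "\<And>m. m \<in> A'.vars \<Longrightarrow> \<chi> m \<in> carrier S'" "\<chi> {#} = \<one>\<^bsub>S'\<^esub>"
    "\<And>k l. \<lbrakk>k \<in> A'.vars; l \<in> A'.vars\<rbrakk> \<Longrightarrow> \<chi> (k + l) = \<chi> k \<otimes>\<^bsub>S'\<^esub> \<chi> l"
  proof -
    show "m \<in> A'.vars \<Longrightarrow> \<chi> m \<in> carrier S'" for m by (simp add: \<chi>_def iD hD)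
    show "\<chi> {#} = \<one>\<^bsub>S'\<^esub>" unfolding \<chi>_def A.P_simps(3)[symmetric] hD(4) iD(4) ..
    fix k l assume kl: "k \<in> A'.vars" "l \<in> A'.vars"
    have "A.mono \<one>\<^bsub>R\<^esub> (k + l) = A.mono \<one>\<^bsub>R\<^esub> k \<otimes>\<^bsub>A.P\<^esub> A.mono \<one>\<^bsub>R\<^esub> l" by (simp add: A.mono_mult)
    then show "\<chi> (k + l) = \<chi> k \<otimes>\<^bsub>S'\<^esub> \<chi> l" using kl by (simp add: \<chi>_def hD iD)
  qed
  define h' where "h' = A'.ev S' \<psi> \<chi>"
  have h': "h' \<in> ring_hom A'.P S'" unfolding h'_def by (rule A'.ev_hom[OF cS' \<psi> \<chi>])
  have h'_mono: "h' (A'.mono r m) = \<psi> r \<otimes>\<^bsub>S'\<^esub> \<chi> m" if "r \<in> carrier R'" "m \<in> A'.vars" for r m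
    unfolding h'_def by (rule A'.ev_mono[OF cS' \<psi> \<chi> that])
  note h'D = ring_hom_memE[OF h']
  have h'_const: "h' (A'.mono r {#}) = \<psi> r" if "r \<in> carrier R'" for r
    using that \<psi>D by (simp add: h'_mono \<chi>)
  have h'G: "h' (G p) = i (h p)" if p: "p \<in> carrier A.P" for p
  proof (rule A.additive_eqI[OF S'.abelian_group_axioms p])
    fix r m assume rm: "r \<in> carrier R" "m \<in> A.vars"
    then show "h' (G (A.mono r m)) = i (h (A.mono r m))"
      using \<phi>D hD iD gD by (subst h_mono) (simp_all add: G_mono h'_mono \<chi>_def comm)
  qed (simp_all add: h'D GD iD hD)
  interpret h': ring_hom_ring A'.P S' h'
    by (rule ring_hom_ringI2[OF A'.P.ring_axioms S'.ring_axioms h'])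
  interpret h: ring_hom_ring A.P S h
    by (rule ring_hom_ringI2[OF A.P.ring_axioms S.ring_axioms h])
  interpret G: ring_hom_ring A.P A'.P G
    by (rule ring_hom_ringI2[OF A.P.ring_axioms A'.P.ring_axioms G])
  interpret i: ring_hom_ring S S' i
    by (rule ring_hom_ringI2[OF S.ring_axioms S'.ring_axioms i])
  have surj: "h' ` carrier A'.P = carrier S'"
  proof
    show "h' ` carrier A'.P \<subseteq> carrier S'" using h'D by auto
    show "carrier S' \<subseteq> h' ` carrier A'.P"
    proof
      fix x assume "x \<in> carrier S'"
      then obtain X where X: "X \<in> lists (carrier S \<times> carrier R')" "x = tev S' (\<lambda>s r. i s \<otimes>\<^bsub>S'\<^esub> \<psi> r) X"
        using span by blast
      from X(1) have "tev S' (\<lambda>s r. i s \<otimes>\<^bsub>S'\<^esub> \<psi> r) X \<in> h' ` carrier A'.P"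
      proof induction
        case Nil
        have "h' \<zero>\<^bsub>A'.P\<^esub> = \<zero>\<^bsub>S'\<^esub>" by simp
        then show ?case by (metis A'.zero_closed imageI tev_simps(1))
      next
        case (Cons a X)
        obtain s r where a: "a = (s, r)" "s \<in> carrier S" "r \<in> carrier R'" using Cons(1) by auto
        obtain p where p: "p \<in> carrier A.P" "s = h p" using a hs by blast
        obtain q where q: "q \<in> carrier A'.P" "tev S' (\<lambda>s r. i s \<otimes>\<^bsub>S'\<^esub> \<psi> r) X = h' q" using Cons by blast
        \<comment> \<open>A pure tensor is the image of \<open>G p\<close> times a constant
          polynomial, where \<open>p\<close> is a polynomial representing \<open>s\<close>.\<close>
        have "tev S' (\<lambda>s r. i s \<otimes>\<^bsub>S'\<^esub> \<psi> r) (a # X) = h' (G p \<otimes>\<^bsub>A'.P\<^esub> A'.mono r {#} \<oplus>\<^bsub>A'.P\<^esub> q)"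
          using a p q GD by (simp add: h'G h'_const)
        then show ?case
          by (simp only:, intro imageI) (use a p q GD in \<open>simp add: A'.add_closed A'.mult_closed\<close>)
      qed
      then show "x \<in> h' ` carrier A'.P" using X by simp
    qed
  qed
  define I where "I = genideal A'.P (G ` J)"
  have GJ: "G ` J \<subseteq> carrier A'.P" using J GD by auto
  interpret I: ideal I A'.P unfolding I_def by (rule A'.P.genideal_ideal[OF GJ])
  have sub1: "I \<subseteq> a_kernel A'.P S' h'" unfolding I_def
  proof (rule A'.P.genideal_minimal[OF h'.kernel_is_ideal])
    show "G ` J \<subseteq> a_kernel A'.P S' h'"
    proof
      fix q assume "q \<in> G ` J"
      then obtain p where p: "p \<in> J" "q = G p" by blast
      then have "p \<in> a_kernel A.P S h" unfolding ker using A.P.genideal_self[OF J(2)] by blast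
      then have "p \<in> carrier A.P" "h p = \<zero>\<^bsub>S\<^esub>" unfolding a_kernel_def' by blast+
      then have "G p \<in> carrier A'.P" "h' (G p) = \<zero>\<^bsub>S'\<^esub>" using GD by (simp_all add: h'G)
      then show "q \<in> a_kernel A'.P S' h'" unfolding a_kernel_def' p(2) by blast
    qed
  qed
  have GI: "G p \<in> I" if "p \<in> a_kernel A.P S h" for p
  proof -
    have "ideal {q \<in> carrier A.P. G q \<in> I} A.P" by (rule G.ideal_vimage[OF I.is_ideal])
    moreover have "J \<subseteq> {q \<in> carrier A.P. G q \<in> I}"
      using J(2) A'.P.genideal_self[OF GJ] unfolding I_def by auto
    ultimately have "genideal A.P J \<subseteq> {q \<in> carrier A.P. G q \<in> I}" by (rule A.P.genideal_minimal)
    then show ?thesis using that ker by blast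
  qed
  obtain enc :: "(nat multiset \<Rightarrow> 'u) \<Rightarrow> 'u" where enc: "inj_on enc (carrier A'.P)"
    using A'.P_embeds[OF inf] by blast
  \<comment> \<open>Congruence modulo \<open>I\<close>. The quotient of R'[X] by \<open>I\<close> is
    realised inside \<open>'u\<close> by a map \<open>\<kappa>\<close> whose fibres are the
    cosets.\<close>
  define rel where "rel = (\<lambda>p q. p \<in> carrier A'.P \<and> q \<in> carrier A'.P \<and> p \<ominus>\<^bsub>A'.P\<^esub> q \<in> I)"
  have "\<exists>\<kappa> :: (nat multiset \<Rightarrow> 'u) \<Rightarrow> 'u. \<forall>p\<in>carrier A'.P. \<forall>q\<in>carrier A'.P. \<kappa> p = \<kappa> q \<longleftrightarrow> rel p q"
  proof (rule quotient_map_exists[OF enc])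
    show "x \<in> carrier A'.P \<Longrightarrow> rel x x" for x
      by (simp add: rel_def A'.P.minus_eq A'.P.r_neg)
    show "rel x y \<Longrightarrow> rel y x" for x y
    proof -
      assume a: "rel x y"
      then have "\<ominus>\<^bsub>A'.P\<^esub> (x \<ominus>\<^bsub>A'.P\<^esub> y) \<in> I" by (simp add: rel_def)
      moreover have "\<ominus>\<^bsub>A'.P\<^esub> (x \<ominus>\<^bsub>A'.P\<^esub> y) = y \<ominus>\<^bsub>A'.P\<^esub> x"
        using a by (simp add: rel_def A'.P.minus_eq A'.P.minus_add A'.P.a_comm)
      ultimately show "rel y x" using a by (simp add: rel_def)
    qed
    show "rel x y \<Longrightarrow> rel y z \<Longrightarrow> rel x z" for x y z
    proof -
      assume a: "rel x y" "rel y z"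
      then have "(x \<ominus>\<^bsub>A'.P\<^esub> y) \<oplus>\<^bsub>A'.P\<^esub> (y \<ominus>\<^bsub>A'.P\<^esub> z) \<in> I" by (simp add: rel_def)
      moreover have "(x \<ominus>\<^bsub>A'.P\<^esub> y) \<oplus>\<^bsub>A'.P\<^esub> (y \<ominus>\<^bsub>A'.P\<^esub> z) = x \<ominus>\<^bsub>A'.P\<^esub> z"
        using a unfolding rel_def by algebra
      ultimately show "rel x z" using a by (simp add: rel_def)
    qed
  qed (simp add: rel_def)
  then obtain \<kappa> :: "(nat multiset \<Rightarrow> 'u) \<Rightarrow> 'u" where
    "\<forall>p\<in>carrier A'.P. \<forall>q\<in>carrier A'.P. \<kappa> p = \<kappa> q \<longleftrightarrow> rel p q" by blast
  then have \<kappa>: "\<kappa> p = \<kappa> q \<longleftrightarrow> p \<ominus>\<^bsub>A'.P\<^esub> q \<in> I" if "p \<in> carrier A'.P" "q \<in> carrier A'.P" for p q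
    using that by (simp add: rel_def)
  define c where "c = (\<lambda>r. A'.mono r {#})"
  have c: "c \<in> ring_hom R' A'.P"
  proof (rule ring_hom_memI)
    show "r \<in> carrier R' \<Longrightarrow> c r \<in> carrier A'.P" for r by (simp add: c_def)
    show "r \<in> carrier R' \<Longrightarrow> s \<in> carrier R' \<Longrightarrow> c (r \<otimes>\<^bsub>R'\<^esub> s) = c r \<otimes>\<^bsub>A'.P\<^esub> c s" for r s
      by (simp add: c_def A'.mono_mult)
    show "r \<in> carrier R' \<Longrightarrow> s \<in> carrier R' \<Longrightarrow> c (r \<oplus>\<^bsub>R'\<^esub> s) = c r \<oplus>\<^bsub>A'.P\<^esub> c s" for r s
      by (auto simp: c_def A'.mono_def A'.P_simps)
    show "c \<one>\<^bsub>R'\<^esub> = \<one>\<^bsub>A'.P\<^esub>" by (simp add: c_def A'.P_simps)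
  qed
  note cD = ring_hom_memE[OF c]
  \<comment> \<open>R'[X] receives only scalars from \<open>R\<close>, acting through
    \<open>g\<close> and the constant polynomials, because \<open>S'\<close> is known as a tensor
    product over \<open>R\<close>.\<close>
  define L :: "('u, nat multiset \<Rightarrow> 'u) module" where
    "L = \<lparr>carrier = carrier A'.P, monoid.mult = monoid.mult A'.P, one = one A'.P,
      ring.zero = ring.zero A'.P, ring.add = ring.add A'.P, smult = (\<lambda>r p. c (g r) \<otimes>\<^bsub>A'.P\<^esub> p)\<rparr>"
  have L: "carrier L = carrier A'.P" "ring.zero L = ring.zero A'.P" "ring.add L = ring.add A'.P"
    "smult L = (\<lambda>r p. c (g r) \<otimes>\<^bsub>A'.P\<^esub> p)" by (simp_all add: L_def)
  have add_cong: "\<kappa> (x \<oplus>\<^bsub>A'.P\<^esub> y) = \<kappa> (x' \<oplus>\<^bsub>A'.P\<^esub> y')"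
    if a: "x \<in> carrier A'.P" "x' \<in> carrier A'.P" "y \<in> carrier A'.P" "y' \<in> carrier A'.P"
      "\<kappa> x = \<kappa> x'" "\<kappa> y = \<kappa> y'" for x x' y y'
  proof -
    have "(x \<ominus>\<^bsub>A'.P\<^esub> x') \<oplus>\<^bsub>A'.P\<^esub> (y \<ominus>\<^bsub>A'.P\<^esub> y') \<in> I" using a by (simp add: \<kappa>)
    moreover have "(x \<ominus>\<^bsub>A'.P\<^esub> x') \<oplus>\<^bsub>A'.P\<^esub> (y \<ominus>\<^bsub>A'.P\<^esub> y') = (x \<oplus>\<^bsub>A'.P\<^esub> y) \<ominus>\<^bsub>A'.P\<^esub> (x' \<oplus>\<^bsub>A'.P\<^esub> y')"
      using a(1-4) by algebra
    ultimately show ?thesis using a by (simp add: \<kappa>)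
  qed
  have mult_cong: "\<kappa> (z \<otimes>\<^bsub>A'.P\<^esub> x) = \<kappa> (z \<otimes>\<^bsub>A'.P\<^esub> x')"
    if a: "x \<in> carrier A'.P" "x' \<in> carrier A'.P" "z \<in> carrier A'.P" "\<kappa> x = \<kappa> x'" for x x' z
  proof -
    have "z \<otimes>\<^bsub>A'.P\<^esub> (x \<ominus>\<^bsub>A'.P\<^esub> x') \<in> I" using a I.I_l_closed by (simp add: \<kappa>)
    moreover have "z \<otimes>\<^bsub>A'.P\<^esub> (x \<ominus>\<^bsub>A'.P\<^esub> x') = z \<otimes>\<^bsub>A'.P\<^esub> x \<ominus>\<^bsub>A'.P\<^esub> z \<otimes>\<^bsub>A'.P\<^esub> x'"
      using a(1-3) by algebra
    ultimately show ?thesis using a by (simp add: \<kappa>)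
  qed
  interpret Q: raw_module R L \<kappa>
  proof (unfold_locales, goal_cases)
    case (4 a a' b b') then show ?case unfolding L by (intro add_cong)
  next
    case (5 r a a') then show ?case unfolding L by (intro mult_cong) (use cD gD in auto)
  next
    case (9 a) then show ?case
      by (intro bexI[of _ "\<ominus>\<^bsub>A'.P\<^esub> a"]) (simp_all add: L A'.P.l_neg)
  qed (simp_all add: L cD gD A'.P.a_ac A'.P.l_distr A'.P.r_distr A'.P.m_assoc)
  let ?Q = "transp \<kappa> L"
  have Q_add: "\<kappa> a \<oplus>\<^bsub>?Q\<^esub> \<kappa> b = \<kappa> (a \<oplus>\<^bsub>A'.P\<^esub> b)" if "a \<in> carrier A'.P" "b \<in> carrier A'.P" for a b
    using Q.add_transp[of a b] that by (simp add: L)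
  have Q_smult: "r \<odot>\<^bsub>?Q\<^esub> \<kappa> a = \<kappa> (c (g r) \<otimes>\<^bsub>A'.P\<^esub> a)" if "r \<in> carrier R" "a \<in> carrier A'.P" for r a
    using Q.smult_transp[of r a] that by (simp add: L)
  \<comment> \<open>An arbitrary lift of the elements of \<open>S\<close> to polynomials;
    \<open>dep\<close> shows that the choice does not matter modulo \<open>I\<close>, since
    \<open>G\<close> carries the kernel of \<open>h\<close> into \<open>I\<close>.\<close>
  define lft where "lft = inv_into (carrier A.P) h"
  have lft: "lft s \<in> carrier A.P" "h (lft s) = s" if "s \<in> carrier S" for s
    using that hs unfolding lft_def by (auto simp: inv_into_into f_inv_into_f)
  have dep: "\<kappa> (G p \<otimes>\<^bsub>A'.P\<^esub> z) = \<kappa> (G q \<otimes>\<^bsub>A'.P\<^esub> z)"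
    if a: "p \<in> carrier A.P" "q \<in> carrier A.P" "z \<in> carrier A'.P" "h p = h q" for p q z
  proof -
    have "h (p \<ominus>\<^bsub>A.P\<^esub> q) = \<zero>\<^bsub>S\<^esub>" using a hD by (simp add: A.P.minus_eq S.r_neg)
    moreover have "p \<ominus>\<^bsub>A.P\<^esub> q \<in> carrier A.P" using a by simp
    ultimately have "p \<ominus>\<^bsub>A.P\<^esub> q \<in> a_kernel A.P S h" unfolding a_kernel_def' by blast
    from GI[OF this] have "G p \<ominus>\<^bsub>A'.P\<^esub> G q \<in> I" using a by (simp add: A.P.minus_eq A'.P.minus_eq)
    then have "\<kappa> (G p) = \<kappa> (G q)" using a GD by (simp add: \<kappa>)
    from mult_cong[OF _ _ a(3) this] show ?thesis using a GD by (simp add: A'.P.m_comm)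
  qed
  define b where "b = (\<lambda>s r. \<kappa> (G (lft s) \<otimes>\<^bsub>A'.P\<^esub> c r))"
  have b_eq: "b (h p) r = \<kappa> (G p \<otimes>\<^bsub>A'.P\<^esub> c r)" if "p \<in> carrier A.P" "r \<in> carrier R'" for p r
    unfolding b_def by (rule dep) (use that hD lft cD in auto)
  have Gc: "G (A.mono r {#}) = c (g r)" for r by (simp add: G_mono c_def)
  have hmono0: "h (A.mono r {#}) = \<phi> r" if "r \<in> carrier R" for r using hc[OF that] by (simp add: A.mono_def)
  have b_bil: "bilinear_map R (along \<phi> S) (along g R') ?Q b"
  proof (rule bilinear_mapI, goal_cases)
    case (1 x y) then show ?case using lft GD cD by (simp add: b_def transp_simps L)
  next
    case (2 x x' y)
    then have e: "x \<oplus>\<^bsub>S\<^esub> x' = h (lft x \<oplus>\<^bsub>A.P\<^esub> lft x')" using lft hD by simp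
    have "b (x \<oplus>\<^bsub>S\<^esub> x') y = \<kappa> (G (lft x \<oplus>\<^bsub>A.P\<^esub> lft x') \<otimes>\<^bsub>A'.P\<^esub> c y)"
      unfolding e by (rule b_eq) (use 2 lft in auto)
    then show ?case using 2 lft GD cD by (simp add: b_def Q_add A'.P.l_distr)
  next
    case (3 x y y')
    then show ?case using lft GD cD by (simp add: b_def Q_add A'.P.r_distr)
  next
    case (4 r x y)
    then have e: "\<phi> r \<otimes>\<^bsub>S\<^esub> x = h (A.mono r {#} \<otimes>\<^bsub>A.P\<^esub> lft x)" using lft hD hmono0 by simp
    have "b (\<phi> r \<otimes>\<^bsub>S\<^esub> x) y = \<kappa> (G (A.mono r {#} \<otimes>\<^bsub>A.P\<^esub> lft x) \<otimes>\<^bsub>A'.P\<^esub> c y)"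
      unfolding e by (rule b_eq) (use 4 lft in auto)
    then show ?case using 4 lft GD cD gD by (simp add: b_def Q_smult Gc A'.P.m_assoc)
  next
    case (5 r x y)
    then show ?case using lft GD cD gD by (simp add: b_def Q_smult A'.P.m_lcomm)
  qed
  \<comment> \<open>Only additivity of \<open>\<Gamma>\<close> is exploited below: its composite
    with \<open>h'\<close> is compared with \<open>\<kappa>\<close> on monomials.\<close>
  from tensor_hom[OF tens Q.module_transp b_bil] obtain \<Gamma> where
    \<Gamma>: "\<Gamma> \<in> mod_hom R (along (i \<circ> \<phi>) S') ?Q"
    and \<Gamma>_t: "\<And>s r. \<lbrakk>s \<in> carrier S; r \<in> carrier R'\<rbrakk> \<Longrightarrow> \<Gamma> (i s \<otimes>\<^bsub>S'\<^esub> \<psi> r) = b s r"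
    by (metis along_simps(1))
  note \<Gamma>D = mod_homD[OF \<Gamma>, simplified]
  have \<Gamma>h': "\<Gamma> (h' p) = \<kappa> p" if p: "p \<in> carrier A'.P" for p
  proof (rule A'.additive_eqI[OF Q.abelian_group_transp p])
    fix r m assume rm: "r \<in> carrier R'" "m \<in> A'.vars"
    have "\<Gamma> (h' (A'.mono r m)) = \<Gamma> (i (h (A.mono \<one>\<^bsub>R\<^esub> m)) \<otimes>\<^bsub>S'\<^esub> \<psi> r)"
      using rm \<psi>D iD hD by (simp add: h'_mono \<chi>_def S'.m_comm)
    also have "\<dots> = b (h (A.mono \<one>\<^bsub>R\<^esub> m)) r" by (rule \<Gamma>_t) (use rm hD in auto)
    also have "\<dots> = \<kappa> (G (A.mono \<one>\<^bsub>R\<^esub> m) \<otimes>\<^bsub>A'.P\<^esub> c r)" by (rule b_eq) (use rm in auto)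
    also have "G (A.mono \<one>\<^bsub>R\<^esub> m) \<otimes>\<^bsub>A'.P\<^esub> c r = A'.mono r m"
      using rm gD by (simp add: G_mono c_def A'.mono_mult)
    finally show "\<Gamma> (h' (A'.mono r m)) = \<kappa> (A'.mono r m)" .
  qed (simp_all add: h'D \<Gamma>D Q_add)
  have sub2: "a_kernel A'.P S' h' \<subseteq> I"
  proof
    fix p assume "p \<in> a_kernel A'.P S' h'"
    then have p: "p \<in> carrier A'.P" "h' p = \<zero>\<^bsub>S'\<^esub>" unfolding a_kernel_def' by blast+
    then have "\<kappa> p = \<kappa> \<zero>\<^bsub>A'.P\<^esub>" using \<Gamma>h'[OF p(1)] \<Gamma>h'[OF A'.zero_closed] by simp
    then show "p \<in> I" using p by (simp add: \<kappa> A'.P.minus_eq)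
  qed
  show ?thesis unfolding finitely_presented_def
  proof (intro exI conjI)
    show "\<forall>r\<in>carrier R'. h' (\<lambda>m. if m = {#} then r else \<zero>\<^bsub>R'\<^esub>) = \<psi> r"
      using h'_const by (simp add: A'.mono_def)
    show "finite (G ` J)" using J by simp
    show "a_kernel A'.P S' h' = genideal A'.P (G ` J)" using sub1 sub2 I_def by blast
  qed (use h' surj GJ in auto)
qed

end

section \<open>The fppf coverage\<close>

text \<open>These are the situations in the two gluing clauses of \<open>faisceau\<close>; the fppf
  case includes a self tensor product because the equaliser there is stated with one. No family has
  more than two members, which keeps the codes of generated sections binary.\<close>

definition covers :: "'u ring \<Rightarrow> 'u alg \<Rightarrow> ('u alg \<times> ('u \<Rightarrow> 'u)) set \<Rightarrow> bool" where
  "covers K A I \<longleftrightarrow>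
     (\<exists>B C p q. is_alg_prod K B C A p q \<and> I = {(B, p), (C, q)}) \<or>
     (\<exists>S \<phi> T i1 i2. fppf_cover K A S \<phi> \<and> is_self_tensor K A S \<phi> T i1 i2 \<and> I = {(S, \<phi>)})"

lemma covers_alg:
  assumes "covers K A I"
  shows "algebra K A" "(B, f) \<in> I \<Longrightarrow> algebra K B" "(B, f) \<in> I \<Longrightarrow> f \<in> alg_hom K A B"
  using assms unfolding covers_def is_alg_prod_def fppf_cover_def by auto

section \<open>Homomorphisms of algebras and decompositions by idempotents\<close>

lemma alg_hom_id: "algebra K A \<Longrightarrow> (\<lambda>a\<in>carrier A. a) \<in> alg_hom K A A"
proof -
  assume "algebra K A"
  then interpret algebra K A .
  show ?thesis by (rule alg_homI) auto
qed

lemma alg_hom_compose: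
  assumes "algebra K A" "f \<in> alg_hom K A B" "g \<in> alg_hom K B C"
  shows "compose (carrier A) g f \<in> alg_hom K A C"
proof -
  interpret algebra K A by fact
  note f = alg_homD[OF assms(2)] and g = alg_homD[OF assms(3)]
  show ?thesis by (rule alg_homI) (simp_all add: compose_def f(3-7) g(3-7))
qed

lemma alg_hom_ext:
  "\<lbrakk>f \<in> alg_hom K A B; g \<in> alg_hom K A B; \<And>x. x \<in> carrier A \<Longrightarrow> f x = g x\<rbrakk> \<Longrightarrow> f = g"
  by (meson alg_homD(2) extensionalityI)

lemma compose_alg_assoc:
  assumes "f \<in> alg_hom K A B"
  shows "compose (carrier A) h (compose (carrier A) g f) = compose (carrier A) (compose (carrier B) h g) f"
  by (rule ext) (simp add: compose_def alg_homD(3)[OF assms])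

lemma compose_alg_id:
  assumes "f \<in> alg_hom K A B"
  shows "compose (carrier A) f (\<lambda>a\<in>carrier A. a) = f" "compose (carrier A) (\<lambda>b\<in>carrier B. b) f = f"
  using extensional_arb[OF alg_homD(2)[OF assms]]
  by (auto simp: compose_def fun_eq_iff alg_homD(3)[OF assms])

text \<open>Serves to map the factors of a product algebra into the corners that its idempotents cut
  out after base change.\<close>

lemma alg_hom_factor:
  assumes A: "algebra K A" and p: "p \<in> alg_hom K A B" and surj: "p ` carrier A = carrier B" and B: "algebra K B"
    and v: "v \<in> alg_hom K A D" and eq: "\<And>x y. \<lbrakk>x \<in> carrier A; y \<in> carrier A; p x = p y\<rbrakk> \<Longrightarrow> v x = v y"
  obtains t where "t \<in> alg_hom K B D" "compose (carrier A) t p = v"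
proof -
  interpret A: algebra K A by (rule A)
  note pD = alg_homD[OF p] and vD = alg_homD[OF v]
  define t where "t = (\<lambda>b\<in>carrier B. v (inv_into (carrier A) p b))"
  have t: "t (p x) = v x" if "x \<in> carrier A" for x
    unfolding t_def using that pD(3)
    by (simp, intro eq) (auto simp: inv_into_into f_inv_into_f)
  have "t \<in> alg_hom K B D"
  proof (rule alg_homI)
    fix y assume "y \<in> carrier B"
    then obtain x where x: "x \<in> carrier A" "y = p x" using surj by auto
    then show "t y \<in> carrier D" using t vD(3) by simp
    {
      fix k assume "k \<in> carrier K"
      then show "t (k \<odot>\<^bsub>B\<^esub> y) = k \<odot>\<^bsub>D\<^esub> t y"
        using x t[of "k \<odot>\<^bsub>A\<^esub> x"] t[of x] pD(4) vD(4) by simp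
    }
    fix y' assume "y' \<in> carrier B"
    then obtain x' where x': "x' \<in> carrier A" "y' = p x'" using surj by auto
    show "t (y \<otimes>\<^bsub>B\<^esub> y') = t y \<otimes>\<^bsub>D\<^esub> t y'"
      using x x' t[of "x \<otimes>\<^bsub>A\<^esub> x'"] t[of x] t[of x'] pD(5) vD(5) by simp
    show "t (y \<oplus>\<^bsub>B\<^esub> y') = t y \<oplus>\<^bsub>D\<^esub> t y'"
      using x x' t[of "x \<oplus>\<^bsub>A\<^esub> x'"] t[of x] t[of x'] pD(6) vD(6) by simp
  next
    show "t \<in> extensional (carrier B)" by (simp add: t_def)
    show "t \<one>\<^bsub>B\<^esub> = \<one>\<^bsub>D\<^esub>" using t[of "\<one>\<^bsub>A\<^esub>"] pD(7) vD(7) by simp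
  qed
  moreover have "compose (carrier A) t p = v"
    using extensional_arb[OF vD(2)] by (auto simp: compose_def fun_eq_iff t)
  ultimately show ?thesis using that by blast
qed

text \<open>For an idempotent \<open>e\<close> this is the ideal generated by \<open>e\<close>,
  viewed as a ring with unit \<open>e\<close>: its elements are exactly those fixed by
  multiplication by \<open>e\<close>.\<close>

definition corner :: "'u \<Rightarrow> 'u alg \<Rightarrow> 'u alg" where
  "corner e A = A\<lparr>carrier := {x \<in> carrier A. e \<otimes>\<^bsub>A\<^esub> x = x}, one := e\<rparr>"

lemma corner_simps:
  "carrier (corner e A) = {x \<in> carrier A. e \<otimes>\<^bsub>A\<^esub> x = x}" "one (corner e A) = e"
  "monoid.mult (corner e A) = monoid.mult A" "ring.zero (corner e A) = ring.zero A"
  "ring.add (corner e A) = ring.add A" "smult (corner e A) = smult A"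
  by (simp_all add: corner_def)

locale idempotent = algebra K A for K :: "'u ring" and A :: "'u alg" +
  fixes e :: 'u
  assumes e: "e \<in> carrier A" "e \<otimes>\<^bsub>A\<^esub> e = e"
begin

lemma ee: "x \<in> carrier A \<Longrightarrow> e \<otimes>\<^bsub>A\<^esub> (e \<otimes>\<^bsub>A\<^esub> x) = e \<otimes>\<^bsub>A\<^esub> x"
  using e by (simp flip: m_assoc)

lemma smult_e: "\<lbrakk>k \<in> carrier K; x \<in> carrier A\<rbrakk> \<Longrightarrow> e \<otimes>\<^bsub>A\<^esub> (k \<odot>\<^bsub>A\<^esub> x) = k \<odot>\<^bsub>A\<^esub> (e \<otimes>\<^bsub>A\<^esub> x)"
  using e by (metis m_comm smult_assoc2 smult_closed)

lemma corner_algebra: "algebra K (corner e A)"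
proof (rule algebraI)
  show "cring K" by (rule R_cring)
  show "cring (corner e A)"
  proof (rule cringI)
    show "abelian_group (corner e A)"
    proof (rule abelian_groupI, goal_cases)
      case (6 x)
      have "e \<otimes>\<^bsub>A\<^esub> (\<ominus>\<^bsub>A\<^esub> x) = \<ominus>\<^bsub>A\<^esub> (e \<otimes>\<^bsub>A\<^esub> x)" using 6 e by (simp add: corner_simps r_minus)
      then show ?case using 6 by (intro bexI[of _ "\<ominus>\<^bsub>A\<^esub> x"]) (auto simp: corner_simps M.l_neg)
    qed (use e in \<open>auto simp: corner_simps r_distr M.a_ac\<close>)
    show "comm_monoid (corner e A)"
    proof (rule comm_monoidI, goal_cases)
      case (1 x y)
      then show ?case using e by (auto simp: corner_simps simp flip: m_assoc)
    next
      case (3 x y z)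
      then show ?case by (simp add: corner_simps m_assoc)
    next
      case (5 x y)
      then show ?case by (simp add: corner_simps m_comm)
    qed (use e in \<open>auto simp: corner_simps\<close>)
  qed (use e in \<open>auto simp: corner_simps l_distr\<close>)
qed (use e in \<open>auto simp: corner_simps smult_e smult_l_distr smult_r_distr smult_assoc1 smult_assoc2\<close>)

definition proj :: "'u \<Rightarrow> 'u" where "proj = (\<lambda>x\<in>carrier A. e \<otimes>\<^bsub>A\<^esub> x)"

lemma proj_hom: "proj \<in> alg_hom K A (corner e A)"
  by (rule alg_homI) (use e in \<open>auto simp: proj_def corner_simps ee smult_e r_distr m_ac\<close>)

end

lemma prod_surj:
  assumes "is_alg_prod K B C A p q"
  shows "p ` carrier A = carrier B" "q ` carrier A = carrier C"
proof -
  interpret B: algebra K B using assms unfolding is_alg_prod_def by blast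
  interpret C: algebra K C using assms unfolding is_alg_prod_def by blast
  have "(\<lambda>z. (p z, q z)) ` carrier A = carrier B \<times> carrier C"
    using assms unfolding is_alg_prod_def bij_betw_def by blast
  then have "fst ` (\<lambda>z. (p z, q z)) ` carrier A = carrier B" "snd ` (\<lambda>z. (p z, q z)) ` carrier A = carrier C"
    using B.M.zero_closed C.M.zero_closed by (auto simp: fst_image_times snd_image_times)
  then show "p ` carrier A = carrier B" "q ` carrier A = carrier C" by (simp_all add: image_image)
qed

text \<open>The elements (1, 0) and (0, 1) of \<open>A\<close> are complementary orthogonal
  idempotents, and so are their images in \<open>A'\<close>, which split \<open>A'\<close> into two
  corners. The projection to a corner, composed with \<open>u\<close>, factors through
  \<open>B\<close> or \<open>C\<close> because multiplication by the corresponding idempotent of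
  \<open>A\<close> forgets the other factor.\<close>

lemma covers_prod_pullback:
  assumes prod: "is_alg_prod K B C A p q" and A': "algebra K A'" and u: "u \<in> alg_hom K A A'"
  obtains I' where "covers K A' I'"
    "\<And>B' f'. (B', f') \<in> I' \<Longrightarrow> \<exists>(D, f)\<in>{(B, p), (C, q)}. \<exists>t\<in>alg_hom K D B'.
       compose (carrier A) t f = compose (carrier A) f' u"
proof -
  have alg: "algebra K B" "algebra K C" "algebra K A" and p: "p \<in> alg_hom K A B" and q: "q \<in> alg_hom K A C"
    and bij: "bij_betw (\<lambda>z. (p z, q z)) (carrier A) (carrier B \<times> carrier C)"
    using prod unfolding is_alg_prod_def by auto
  interpret B: algebra K B by (rule alg)
  interpret C: algebra K C by (rule alg)
  interpret A: algebra K A by (rule alg)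
  interpret A': algebra K A' by (rule A')
  note pD = alg_homD[OF p] and qD = alg_homD[OF q] and uD = alg_homD[OF u]
  have inj: "x = y" if "x \<in> carrier A" "y \<in> carrier A" "p x = p y" "q x = q y" for x y
    using bij that unfolding bij_betw_def inj_on_def by blast
  have sur: "\<exists>z\<in>carrier A. p z = b \<and> q z = c" if "b \<in> carrier B" "c \<in> carrier C" for b c
  proof -
    have "(b, c) \<in> (\<lambda>z. (p z, q z)) ` carrier A" using bij that unfolding bij_betw_def by blast
    then show ?thesis by auto
  qed
  obtain e where e: "e \<in> carrier A" "p e = \<one>\<^bsub>B\<^esub>" "q e = \<zero>\<^bsub>C\<^esub>" using sur[of "\<one>\<^bsub>B\<^esub>" "\<zero>\<^bsub>C\<^esub>"] by auto
  obtain d where d: "d \<in> carrier A" "p d = \<zero>\<^bsub>B\<^esub>" "q d = \<one>\<^bsub>C\<^esub>" using sur[of "\<zero>\<^bsub>B\<^esub>" "\<one>\<^bsub>C\<^esub>"] by auto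
  have pz: "p \<zero>\<^bsub>A\<^esub> = \<zero>\<^bsub>B\<^esub>" "q \<zero>\<^bsub>A\<^esub> = \<zero>\<^bsub>C\<^esub>" "u \<zero>\<^bsub>A\<^esub> = \<zero>\<^bsub>A'\<^esub>"
    using ring_hom_zero[OF pD(1)] ring_hom_zero[OF qD(1)] ring_hom_zero[OF uD(1)]
      A.ring_axioms A'.ring_axioms B.ring_axioms C.ring_axioms by auto
  have ee: "e \<otimes>\<^bsub>A\<^esub> e = e" by (rule inj) (use e in \<open>simp_all add: pD(5) qD(5)\<close>)
  have dd: "d \<otimes>\<^bsub>A\<^esub> d = d" by (rule inj) (use d in \<open>simp_all add: pD(5) qD(5)\<close>)
  have ed: "e \<otimes>\<^bsub>A\<^esub> d = \<zero>\<^bsub>A\<^esub>" by (rule inj) (use e d in \<open>simp_all add: pD(5) qD(5) pz\<close>)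
  have ed1: "e \<oplus>\<^bsub>A\<^esub> d = \<one>\<^bsub>A\<^esub>" by (rule inj) (use e d in \<open>simp_all add: pD(6,7) qD(6,7)\<close>)
  let ?e = "u e" and ?d = "u d"
  have cl: "?e \<in> carrier A'" "?d \<in> carrier A'" using e d uD(3) by auto
  interpret E: idempotent K A' ?e
    by unfold_locales (use e ee cl uD(5)[of e e] in auto)
  interpret D: idempotent K A' ?d
    by unfold_locales (use d dd cl uD(5)[of d d] in auto)
  have ed': "?e \<otimes>\<^bsub>A'\<^esub> ?d = \<zero>\<^bsub>A'\<^esub>" "?d \<otimes>\<^bsub>A'\<^esub> ?e = \<zero>\<^bsub>A'\<^esub>" "?e \<oplus>\<^bsub>A'\<^esub> ?d = \<one>\<^bsub>A'\<^esub>"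
    using uD(5)[OF e(1) d(1)] uD(6)[OF e(1) d(1)] uD(7) ed ed1 pz(3) cl A'.m_comm by auto
  have "is_alg_prod K (corner ?e A') (corner ?d A') A' E.proj D.proj"
    unfolding is_alg_prod_def
  proof (intro conjI E.corner_algebra D.corner_algebra A' E.proj_hom D.proj_hom)
    show "bij_betw (\<lambda>z. (E.proj z, D.proj z)) (carrier A') (carrier (corner ?e A') \<times> carrier (corner ?d A'))"
    proof (rule bij_betwI[where g = "\<lambda>(y, z). y \<oplus>\<^bsub>A'\<^esub> z"], goal_cases)
      case 1 then show ?case using alg_homD(3)[OF E.proj_hom] alg_homD(3)[OF D.proj_hom] by auto
    next
      case 2 then show ?case by (auto simp: corner_simps)
    next
      case (3 x)
      then show ?case using cl ed' by (simp add: E.proj_def D.proj_def flip: A'.l_distr)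
    next
      case (4 y)
      obtain a b where y: "y = (a, b)" by (cases y)
      have a: "a \<in> carrier A'" "?e \<otimes>\<^bsub>A'\<^esub> a = a" and b: "b \<in> carrier A'" "?d \<otimes>\<^bsub>A'\<^esub> b = b"
        using 4 y by (auto simp: corner_simps)
      have "?e \<otimes>\<^bsub>A'\<^esub> b = ?e \<otimes>\<^bsub>A'\<^esub> (?d \<otimes>\<^bsub>A'\<^esub> b)" using b by simp
      also have "\<dots> = \<zero>\<^bsub>A'\<^esub>" using b(1) cl ed' by (simp flip: A'.m_assoc)
      finally have eb: "?e \<otimes>\<^bsub>A'\<^esub> b = \<zero>\<^bsub>A'\<^esub>" .
      have "?d \<otimes>\<^bsub>A'\<^esub> a = ?d \<otimes>\<^bsub>A'\<^esub> (?e \<otimes>\<^bsub>A'\<^esub> a)" using a by simp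
      also have "\<dots> = \<zero>\<^bsub>A'\<^esub>" using a(1) cl ed' by (simp flip: A'.m_assoc)
      finally have da: "?d \<otimes>\<^bsub>A'\<^esub> a = \<zero>\<^bsub>A'\<^esub>" .
      show ?case using a b cl eb da y by (simp add: E.proj_def D.proj_def A'.r_distr)
    qed
  qed
  then have cov: "covers K A' {(corner ?e A', E.proj), (corner ?d A', D.proj)}"
    unfolding covers_def by blast
  have ps: "p ` carrier A = carrier B" "q ` carrier A = carrier C"
    by (rule prod_surj[OF prod])+
  have "\<exists>t\<in>alg_hom K B (corner ?e A'). compose (carrier A) t p = compose (carrier A) E.proj u"
  proof (rule alg_hom_factor[OF alg(3) p ps(1) alg(1) alg_hom_compose[OF alg(3) u E.proj_hom]])
    fix x y assume xy: "x \<in> carrier A" "y \<in> carrier A" "p x = p y"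
    have "e \<otimes>\<^bsub>A\<^esub> x = e \<otimes>\<^bsub>A\<^esub> y"
      by (rule inj) (use e xy pD(3) qD(3) in \<open>simp_all add: pD(5) qD(5)\<close>)
    then have "u e \<otimes>\<^bsub>A'\<^esub> u x = u e \<otimes>\<^bsub>A'\<^esub> u y" using e xy uD(5) by metis
    then show "compose (carrier A) E.proj u x = compose (carrier A) E.proj u y"
      using xy uD(3) by (simp add: compose_def E.proj_def)
  qed blast
  moreover have "\<exists>t\<in>alg_hom K C (corner ?d A'). compose (carrier A) t q = compose (carrier A) D.proj u"
  proof (rule alg_hom_factor[OF alg(3) q ps(2) alg(2) alg_hom_compose[OF alg(3) u D.proj_hom]])
    fix x y assume xy: "x \<in> carrier A" "y \<in> carrier A" "q x = q y"
    have "d \<otimes>\<^bsub>A\<^esub> x = d \<otimes>\<^bsub>A\<^esub> y"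
      by (rule inj) (use d xy pD(3) qD(3) in \<open>simp_all add: pD(5) qD(5)\<close>)
    then have "u d \<otimes>\<^bsub>A'\<^esub> u x = u d \<otimes>\<^bsub>A'\<^esub> u y" using d xy uD(5) by metis
    then show "compose (carrier A) D.proj u x = compose (carrier A) D.proj u y"
      using xy uD(3) by (simp add: compose_def D.proj_def)
  qed blast
  ultimately show ?thesis using that[OF cov] by auto
qed

text \<open>A refinement is enough: each member of the new cover receives a map, over
  \<open>u\<close>, from some member of the old one. A product is pulled back by means of its
  idempotents and an fppf cover by the pushout along \<open>u\<close>; the self tensor product
  demanded by \<open>covers\<close> is a further pushout.\<close>

lemma covers_pullback:
  fixes A :: "'u alg"
  assumes inf: "infinite (UNIV :: 'u set)" and cov: "covers K A I" and A': "algebra K A'" and u: "u \<in> alg_hom K A A'"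
  obtains I' where "covers K A' I'"
    "\<And>B' f'. (B', f') \<in> I' \<Longrightarrow> \<exists>(B, f)\<in>I. \<exists>t\<in>alg_hom K B B'. compose (carrier A) t f = compose (carrier A) f' u"
  using cov unfolding covers_def
proof (elim disjE exE conjE)
  fix B C p q assume pr: "is_alg_prod K B C A p q" and I: "I = {(B, p), (C, q)}"
  show ?thesis by (rule covers_prod_pullback[OF pr A' u], rule that, assumption) (unfold I, assumption)
next
  fix S \<phi> T i1 i2 assume c: "fppf_cover K A S \<phi>" and I: "I = {(S, \<phi>)}"
  have alg: "algebra K A" "algebra K S" and \<phi>: "\<phi> \<in> alg_hom K A S" and ff: "faithfully_flat A (along \<phi> S)"
    and fp: "finitely_presented A S \<phi>" using c unfolding fppf_cover_def by auto
  obtain S' i \<psi> where S': "algebra K S'" and i_alg: "i \<in> alg_hom K S S'" and \<psi>_alg: "\<psi> \<in> alg_hom K A' S'"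
    and comm: "\<And>r. r \<in> carrier A \<Longrightarrow> i (\<phi> r) = \<psi> (u r)"
    and tens: "is_tensor A (along \<phi> S) (along u A') (along (i \<circ> \<phi>) S') (\<lambda>s r. i s \<otimes>\<^bsub>S'\<^esub> \<psi> r)"
    and span: "\<And>x. x \<in> carrier S' \<Longrightarrow> \<exists>X\<in>lists (carrier S \<times> carrier A'). x = tev S' (\<lambda>s r. i s \<otimes>\<^bsub>S'\<^esub> \<psi> r) X"
    by (rule pushout_exists[OF inf alg A' \<phi> u]) blast
  interpret base_change A S A' S' \<phi> u i \<psi>
    by (rule base_change.intro)
      (use alg A' S' alg_homD(1) \<phi> u i_alg \<psi>_alg comm tens in \<open>auto intro: algebra.M_cring\<close>)
  have "fppf_cover K A' S' \<psi>"
    unfolding fppf_cover_def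
    by (intro conjI A' S' \<psi>_alg faithfully_flat_base_change[OF inf ff] finitely_presented_base_change[OF inf fp span])
  moreover obtain T' j1 j2 where "algebra K T'" "j1 \<in> alg_hom K S' T'" "j2 \<in> alg_hom K S' T'"
    "is_tensor A' (along \<psi> S') (along \<psi> S') (along (j1 \<circ> \<psi>) T') (\<lambda>s r. j1 s \<otimes>\<^bsub>T'\<^esub> j2 r)"
    by (rule pushout_exists[OF inf A' S' S' \<psi>_alg \<psi>_alg]) blast
  then have "is_self_tensor K A' S' \<psi> T' j1 j2" unfolding is_self_tensor_def by blast
  ultimately have "covers K A' {(S', \<psi>)}" unfolding covers_def by blast
  moreover have "compose (carrier A) i \<phi> = compose (carrier A) \<psi> u"
    using comm by (auto simp: compose_def fun_eq_iff)
  ultimately show ?thesis using that[of "{(S', \<psi>)}"] i_alg I by auto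
qed

section \<open>Faisceaux as sheaves for the coverage\<close>

lemma functorD:
  assumes "is_functor K F"
  shows "\<lbrakk>algebra K A; algebra K B; f \<in> alg_hom K A B; x \<in> obj F A\<rbrakk> \<Longrightarrow> arr F A B f x \<in> obj F B"
    "\<lbrakk>algebra K A; x \<in> obj F A\<rbrakk> \<Longrightarrow> arr F A A (\<lambda>a\<in>carrier A. a) x = x"
    "\<lbrakk>algebra K A; algebra K B; algebra K C; f \<in> alg_hom K A B; g \<in> alg_hom K B C; x \<in> obj F A\<rbrakk>
      \<Longrightarrow> arr F B C g (arr F A B f x) = arr F A C (compose (carrier A) g f) x"
  using assms unfolding is_functor_def by (blast, blast, metis)

text \<open>Compatibility is tested in every algebra \<open>D\<close> that receives both members
  over \<open>A\<close>, so no tensor product of \<open>B\<close> with \<open>C\<close> has to be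
  chosen.\<close>

definition matching :: "'u ring \<Rightarrow> ('u, 'v) kfunctor \<Rightarrow> 'u alg \<Rightarrow> ('u alg \<times> ('u \<Rightarrow> 'u)) set \<Rightarrow>
    ('u alg \<Rightarrow> ('u \<Rightarrow> 'u) \<Rightarrow> 'v) \<Rightarrow> bool" where
  "matching K F A I s \<longleftrightarrow>
     (\<forall>(B, f)\<in>I. s B f \<in> obj F B) \<and>
     (\<forall>(B, f)\<in>I. \<forall>(C, g)\<in>I. \<forall>D v w. algebra K D \<and> v \<in> alg_hom K B D \<and> w \<in> alg_hom K C D \<and>
        compose (carrier A) v f = compose (carrier A) w g \<longrightarrow> arr F B D v (s B f) = arr F C D w (s C g))"

definition cov_sheaf :: "'u ring \<Rightarrow> ('u, 'v) kfunctor \<Rightarrow> bool" where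
  "cov_sheaf K F \<longleftrightarrow> is_functor K F \<and>
     (\<forall>A I. covers K A I \<longrightarrow>
        (\<forall>x\<in>obj F A. \<forall>y\<in>obj F A. (\<forall>(B, f)\<in>I. arr F A B f x = arr F A B f y) \<longrightarrow> x = y) \<and>
        (\<forall>s. matching K F A I s \<longrightarrow> (\<exists>x\<in>obj F A. \<forall>(B, f)\<in>I. arr F A B f x = s B f)))"

text \<open>A faisceau need not have a unique section over the zero ring, which is therefore not covered
  by the empty family; but two sections over the zero ring agree, since it is its own square.\<close>

definition zero_subsingleton :: "'u ring \<Rightarrow> ('u, 'v) kfunctor \<Rightarrow> bool" where
  "zero_subsingleton K F \<longleftrightarrow>
     (\<forall>A. algebra K A \<and> \<one>\<^bsub>A\<^esub> = \<zero>\<^bsub>A\<^esub> \<longrightarrow> (\<forall>x\<in>obj F A. \<forall>y\<in>obj F A. x = y))"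

lemma matchingD:
  assumes "matching K F A I s"
  shows "(B, f) \<in> I \<Longrightarrow> s B f \<in> obj F B"
    "\<lbrakk>(B, f) \<in> I; (C, g) \<in> I; algebra K D; v \<in> alg_hom K B D; w \<in> alg_hom K C D;
      compose (carrier A) v f = compose (carrier A) w g\<rbrakk> \<Longrightarrow> arr F B D v (s B f) = arr F C D w (s C g)"
  using assms unfolding matching_def by blast+

lemma matchingI:
  assumes "\<And>B f. (B, f) \<in> I \<Longrightarrow> s B f \<in> obj F B"
    "\<And>B f C g D v w. \<lbrakk>(B, f) \<in> I; (C, g) \<in> I; algebra K D; v \<in> alg_hom K B D; w \<in> alg_hom K C D;
      compose (carrier A) v f = compose (carrier A) w g\<rbrakk> \<Longrightarrow> arr F B D v (s B f) = arr F C D w (s C g)"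
  shows "matching K F A I s"
  using assms unfolding matching_def by blast

lemma cov_sheafD:
  assumes "cov_sheaf K F"
  shows "is_functor K F"
    "\<lbrakk>covers K A I; x \<in> obj F A; y \<in> obj F A; \<And>B f. (B, f) \<in> I \<Longrightarrow> arr F A B f x = arr F A B f y\<rbrakk> \<Longrightarrow> x = y"
    "\<lbrakk>covers K A I; matching K F A I s\<rbrakk> \<Longrightarrow> \<exists>x\<in>obj F A. \<forall>(B, f)\<in>I. arr F A B f x = s B f"
  using assms unfolding cov_sheaf_def by (blast, blast, blast)

lemma cov_sheafI:
  assumes "is_functor K F"
    "\<And>A I x y. \<lbrakk>covers K A I; x \<in> obj F A; y \<in> obj F A; \<And>B f. (B, f) \<in> I \<Longrightarrow> arr F A B f x = arr F A B f y\<rbrakk> \<Longrightarrow> x = y"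
    "\<And>A I s. \<lbrakk>covers K A I; matching K F A I s\<rbrakk> \<Longrightarrow> \<exists>x\<in>obj F A. \<forall>(B, f)\<in>I. arr F A B f x = s B f"
  shows "cov_sheaf K F"
  unfolding cov_sheaf_def
proof (intro conjI allI impI ballI assms(1))
  fix A I x y assume "covers K A I" "x \<in> obj F A" "y \<in> obj F A" "\<forall>(B, f)\<in>I. arr F A B f x = arr F A B f y"
  then show "x = y" by (intro assms(2)[of A I x y]) auto
qed (rule assms(3))

text \<open>The scalar \<open>r\<close> passes from one side of the tensor of 1 with 1 to the
  other.\<close>

lemma self_tensor_coequal:
  assumes "algebra K R" "algebra K S" "\<phi> \<in> alg_hom K R S" and T: "is_self_tensor K R S \<phi> T i1 i2"
  shows "compose (carrier R) i1 \<phi> = compose (carrier R) i2 \<phi>"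
proof
  fix r
  have i: "i1 \<in> alg_hom K S T" "i2 \<in> alg_hom K S T" "algebra K T"
    and t: "is_tensor R (along \<phi> S) (along \<phi> S) (along (i1 \<circ> \<phi>) T) (\<lambda>a b. i1 a \<otimes>\<^bsub>T\<^esub> i2 b)"
    using T unfolding is_self_tensor_def by auto
  interpret S: algebra K S by fact
  interpret T: algebra K T by fact
  note iD = alg_homD[OF i(1)] alg_homD[OF i(2)]
  note b = bilinear_mapD(4,5)[OF tensorD(4)[OF t], of r "\<one>\<^bsub>S\<^esub>" "\<one>\<^bsub>S\<^esub>"]
  show "compose (carrier R) i1 \<phi> r = compose (carrier R) i2 \<phi> r"
  proof (cases "r \<in> carrier R")
    case True
    then have "\<phi> r \<in> carrier S" using alg_homD(3)[OF assms(3)] by blast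
    then show ?thesis using b True iD by (simp add: compose_def)
  qed (simp add: compose_def)
qed

text \<open>The tensor product is characterised as a module, so its universal property only yields
  an \<open>R\<close>-linear map \<open>k0\<close>. That \<open>k0\<close> is multiplicative is
  verified on pure tensors, one argument at a time.\<close>

lemma self_tensor_factor:
  assumes R: "algebra K R" and S: "algebra K S" and \<phi>: "\<phi> \<in> alg_hom K R S" and T: "is_self_tensor K R S \<phi> T i1 i2"
    and D: "algebra K D" and v: "v \<in> alg_hom K S D" and w: "w \<in> alg_hom K S D"
    and vw: "compose (carrier R) v \<phi> = compose (carrier R) w \<phi>"
  obtains k where "k \<in> alg_hom K T D" "compose (carrier S) k i1 = v" "compose (carrier S) k i2 = w"
proof -
  have i: "i1 \<in> alg_hom K S T" "i2 \<in> alg_hom K S T" "algebra K T"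
    and t: "is_tensor R (along \<phi> S) (along \<phi> S) (along (i1 \<circ> \<phi>) T) (\<lambda>a b. i1 a \<otimes>\<^bsub>T\<^esub> i2 b)"
    using T unfolding is_self_tensor_def by auto
  interpret R: algebra K R by fact
  interpret S: algebra K S by fact
  interpret T: algebra K T by fact
  interpret D: algebra K D by fact
  note i1D = alg_homD[OF i(1)] and i2D = alg_homD[OF i(2)] and vD = alg_homD[OF v] and wD = alg_homD[OF w]
    and \<phi>D = alg_homD[OF \<phi>]
  have vw': "v (\<phi> r) = w (\<phi> r)" if "r \<in> carrier R" for r
    using fun_cong[OF vw, of r] that by (simp add: compose_def)
  have mD: "module R (along (v \<circ> \<phi>) D)"
    by (rule module_along[OF R.M_cring D.M_cring ring_hom_trans[OF \<phi>D(1) vD(1)]])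
  have "bilinear_map R (along \<phi> S) (along \<phi> S) (along (v \<circ> \<phi>) D) (\<lambda>a b. v a \<otimes>\<^bsub>D\<^esub> w b)"
    by (rule bilinear_mapI)
      (auto simp: vD(3,5,6) wD(3,5,6) \<phi>D(3) D.l_distr D.r_distr D.m_assoc vw' intro: D.m_lcomm)
  from tensor_hom[OF t mD this] obtain k0 where k0: "k0 \<in> mod_hom R (along (i1 \<circ> \<phi>) T) (along (v \<circ> \<phi>) D)"
    and k0t: "\<And>a b. \<lbrakk>a \<in> carrier S; b \<in> carrier S\<rbrakk> \<Longrightarrow> k0 (i1 a \<otimes>\<^bsub>T\<^esub> i2 b) = v a \<otimes>\<^bsub>D\<^esub> w b"
    by (metis along_simps(1))
  note k0D = mod_homD[OF k0, simplified]
  have k1: "k0 (i1 a) = v a" if "a \<in> carrier S" for a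
    using k0t[OF that S.one_closed] that by (simp add: i1D i2D vD wD)
  have k2: "k0 (i2 a) = w a" if "a \<in> carrier S" for a
    using k0t[OF S.one_closed that] that by (simp add: i1D i2D vD wD)
  have mT: "(\<lambda>z. x \<otimes>\<^bsub>T\<^esub> z) \<in> mod_hom R (along (i1 \<circ> \<phi>) T) (along (i1 \<circ> \<phi>) T)" if "x \<in> carrier T" for x
    by (rule mod_homI) (use that i1D(3) \<phi>D(3) in \<open>auto simp: T.r_distr intro: T.m_lcomm\<close>)
  have mDD: "(\<lambda>z. x \<otimes>\<^bsub>D\<^esub> z) \<in> mod_hom R (along (v \<circ> \<phi>) D) (along (v \<circ> \<phi>) D)" if "x \<in> carrier D" for x
    by (rule mod_homI) (use that vD(3) \<phi>D(3) in \<open>auto simp: D.r_distr intro: D.m_lcomm\<close>)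
  \<comment> \<open>The left argument is still a pure tensor here. Commutativity and the same
    comparison on pure tensors remove this restriction in \<open>mult\<close>.\<close>
  have gen: "k0 (i1 a \<otimes>\<^bsub>T\<^esub> i2 b \<otimes>\<^bsub>T\<^esub> z) = k0 (i1 a \<otimes>\<^bsub>T\<^esub> i2 b) \<otimes>\<^bsub>D\<^esub> k0 z"
    if ab: "a \<in> carrier S" "b \<in> carrier S" and z: "z \<in> carrier T" for a b z
  proof (rule tensor_ext[OF t mD mod_hom_comp[OF mT k0] mod_hom_comp[OF k0 mDD]])
    fix c d assume "c \<in> carrier (along \<phi> S)" "d \<in> carrier (along \<phi> S)"
    then have cd: "c \<in> carrier S" "d \<in> carrier S" by simp_all
    have "i1 a \<otimes>\<^bsub>T\<^esub> i2 b \<otimes>\<^bsub>T\<^esub> (i1 c \<otimes>\<^bsub>T\<^esub> i2 d) = i1 (a \<otimes>\<^bsub>S\<^esub> c) \<otimes>\<^bsub>T\<^esub> i2 (b \<otimes>\<^bsub>S\<^esub> d)"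
      using ab cd by (simp add: i1D i2D T.m_ac)
    then show "k0 (i1 a \<otimes>\<^bsub>T\<^esub> i2 b \<otimes>\<^bsub>T\<^esub> (i1 c \<otimes>\<^bsub>T\<^esub> i2 d)) = k0 (i1 a \<otimes>\<^bsub>T\<^esub> i2 b) \<otimes>\<^bsub>D\<^esub> k0 (i1 c \<otimes>\<^bsub>T\<^esub> i2 d)"
      using ab cd by (simp add: k0t vD wD D.m_ac)
  qed (use ab z in \<open>simp_all add: i1D i2D k0D\<close>)
  have mult: "k0 (y \<otimes>\<^bsub>T\<^esub> z) = k0 y \<otimes>\<^bsub>D\<^esub> k0 z" if y: "y \<in> carrier T" and z: "z \<in> carrier T" for y z
  proof -
    have "k0 (z \<otimes>\<^bsub>T\<^esub> y) = k0 z \<otimes>\<^bsub>D\<^esub> k0 y"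
    proof (rule tensor_ext[OF t mD mod_hom_comp[OF mT k0] mod_hom_comp[OF k0 mDD]])
      fix a b assume "a \<in> carrier (along \<phi> S)" "b \<in> carrier (along \<phi> S)"
      then have ab: "a \<in> carrier S" "b \<in> carrier S" by simp_all
      have c: "i1 a \<otimes>\<^bsub>T\<^esub> i2 b \<in> carrier T" using ab by (simp add: i1D i2D)
      show "k0 (z \<otimes>\<^bsub>T\<^esub> (i1 a \<otimes>\<^bsub>T\<^esub> i2 b)) = k0 z \<otimes>\<^bsub>D\<^esub> k0 (i1 a \<otimes>\<^bsub>T\<^esub> i2 b)"
        using gen[OF ab z] T.m_comm[OF z c] D.m_comm[OF k0D(1)[OF z] k0D(1)[OF c]] by simp
    qed (use y z in \<open>simp_all add: k0D\<close>)
    then show ?thesis using T.m_comm[OF y z] D.m_comm[OF k0D(1)[OF y] k0D(1)[OF z]] by simp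
  qed
  have one: "k0 \<one>\<^bsub>T\<^esub> = \<one>\<^bsub>D\<^esub>" using k1[of "\<one>\<^bsub>S\<^esub>"] by (simp add: i1D vD)
  have "restrict k0 (carrier T) \<in> alg_hom K T D"
  proof (rule alg_homI)
    fix c x assume c: "c \<in> carrier K" and x: "x \<in> carrier T"
    have "c \<odot>\<^bsub>T\<^esub> \<one>\<^bsub>T\<^esub> = i1 (c \<odot>\<^bsub>S\<^esub> \<one>\<^bsub>S\<^esub>)" using c by (simp add: i1D)
    then have "k0 (c \<odot>\<^bsub>T\<^esub> \<one>\<^bsub>T\<^esub>) = c \<odot>\<^bsub>D\<^esub> \<one>\<^bsub>D\<^esub>" using c k1 by (simp add: vD)
    then have "k0 (c \<odot>\<^bsub>T\<^esub> x) = c \<odot>\<^bsub>D\<^esub> k0 x"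
      using c x algebra_smult_eq[OF i(3) c x] algebra_smult_eq[OF D c k0D(1)[OF x]] mult[of "c \<odot>\<^bsub>T\<^esub> \<one>\<^bsub>T\<^esub>" x]
      by simp
    then show "restrict k0 (carrier T) (c \<odot>\<^bsub>T\<^esub> x) = c \<odot>\<^bsub>D\<^esub> restrict k0 (carrier T) x"
      using c x by simp
  qed (simp_all add: k0D mult one)
  moreover have "compose (carrier S) (restrict k0 (carrier T)) i1 = v"
    "compose (carrier S) (restrict k0 (carrier T)) i2 = w"
    using extensional_arb[OF vD(2)] extensional_arb[OF wD(2)]
    by (auto simp: compose_def fun_eq_iff k1 k2 i1D i2D)
  ultimately show ?thesis using that by blast
qed

lemma zero_algebra_hom:
  assumes "algebra K A" "algebra K B" "f \<in> alg_hom K A B" "\<one>\<^bsub>A\<^esub> = \<zero>\<^bsub>A\<^esub>"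
  shows "\<one>\<^bsub>B\<^esub> = \<zero>\<^bsub>B\<^esub>"
proof -
  interpret A: algebra K A by fact
  interpret B: algebra K B by fact
  note f = alg_homD[OF assms(3)]
  show ?thesis using f(7) assms(4) ring_hom_zero[OF f(1) A.ring_axioms B.ring_axioms] by simp
qed

text \<open>The element (1, 0) of the product goes to 1 through one factor and to 0 through the
  other.\<close>

lemma prod_disjoint:
  assumes pr: "is_alg_prod K B C A p q" and D: "algebra K D" and v: "v \<in> alg_hom K B D" and w: "w \<in> alg_hom K C D"
    and eq: "compose (carrier A) v p = compose (carrier A) w q"
  shows "\<one>\<^bsub>D\<^esub> = \<zero>\<^bsub>D\<^esub>"
proof -
  have alg: "algebra K B" "algebra K C" using pr unfolding is_alg_prod_def by blast+
  interpret B: algebra K B by fact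
  interpret C: algebra K C by fact
  interpret D: algebra K D by fact
  have "(\<one>\<^bsub>B\<^esub>, \<zero>\<^bsub>C\<^esub>) \<in> (\<lambda>z. (p z, q z)) ` carrier A"
    using pr unfolding is_alg_prod_def bij_betw_def by auto
  then obtain e where e: "e \<in> carrier A" "p e = \<one>\<^bsub>B\<^esub>" "q e = \<zero>\<^bsub>C\<^esub>" by auto
  have "v (p e) = w (q e)" using fun_cong[OF eq, of e] e(1) by (simp add: compose_def)
  then show ?thesis
    using e alg_homD(7)[OF v] ring_hom_zero[OF alg_homD(1)[OF w] C.ring_axioms D.ring_axioms] by simp
qed

text \<open>For an fppf cover it suffices to apply the matching condition to \<open>i1\<close> and
  \<open>i2\<close>, which places the section in the equaliser; for a product every pair of sections
  already glues.\<close>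

lemma faisceau_cov_sheaf:
  assumes F: "faisceau K F"
  shows "cov_sheaf K F"
proof (rule cov_sheafI)
  show fu: "is_functor K F" using F unfolding faisceau_def by blast
  have P: "bij_betw (\<lambda>z. (arr F P A p1 z, arr F P B p2 z)) (obj F P) (obj F A \<times> obj F B)"
    if "is_alg_prod K A B P p1 p2" for A B P p1 p2 using F that unfolding faisceau_def by blast
  have S: "bij_betw (arr F R S \<phi>) (obj F R) {s \<in> obj F S. arr F S T i1 s = arr F S T i2 s}"
    if "fppf_cover K R S \<phi>" "is_self_tensor K R S \<phi> T i1 i2" for R S \<phi> T i1 i2
    using F that unfolding faisceau_def by blast
  {
    fix A I x y assume cov: "covers K A I" and xy: "x \<in> obj F A" "y \<in> obj F A"
      and eq: "\<And>B f. (B, f) \<in> I \<Longrightarrow> arr F A B f x = arr F A B f y"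
    from cov show "x = y" unfolding covers_def
    proof (elim disjE exE conjE)
      fix B C p q assume "is_alg_prod K B C A p q" "I = {(B, p), (C, q)}"
      then show ?thesis using P[of B C A p q] xy eq unfolding bij_betw_def inj_on_def by blast
    next
      fix S \<phi> T i1 i2 assume "fppf_cover K A S \<phi>" "is_self_tensor K A S \<phi> T i1 i2" "I = {(S, \<phi>)}"
      then show ?thesis using S[of A S \<phi> T i1 i2] xy eq unfolding bij_betw_def inj_on_def by blast
    qed
  }
  fix A I s assume cov: "covers K A I" and m: "matching K F A I s"
  from cov show "\<exists>x\<in>obj F A. \<forall>(B, f)\<in>I. arr F A B f x = s B f" unfolding covers_def
  proof (elim disjE exE conjE)
    fix B C p q assume a: "is_alg_prod K B C A p q" "I = {(B, p), (C, q)}"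
    then have "(s B p, s C q) \<in> obj F B \<times> obj F C" using matchingD(1)[OF m] by auto
    then have "(s B p, s C q) \<in> (\<lambda>z. (arr F A B p z, arr F A C q z)) ` obj F A"
      using P[OF a(1)] unfolding bij_betw_def by blast
    then show ?thesis using a(2) by auto
  next
    fix S \<phi> T i1 i2 assume a: "fppf_cover K A S \<phi>" "is_self_tensor K A S \<phi> T i1 i2" "I = {(S, \<phi>)}"
    then have h: "algebra K A" "algebra K S" "\<phi> \<in> alg_hom K A S" "algebra K T" "i1 \<in> alg_hom K S T" "i2 \<in> alg_hom K S T"
      unfolding fppf_cover_def is_self_tensor_def by auto
    have "arr F S T i1 (s S \<phi>) = arr F S T i2 (s S \<phi>)"
      by (rule matchingD(2)[OF m]) (use a h self_tensor_coequal in auto)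
    moreover have "s S \<phi> \<in> obj F S" using matchingD(1)[OF m] a by auto
    ultimately have "s S \<phi> \<in> arr F A S \<phi> ` obj F A" using S[OF a(1,2)] unfolding bij_betw_def by blast
    then show ?thesis using a(3) by auto
  qed
qed

lemma faisceau_zero:
  assumes F: "faisceau K F"
  shows "zero_subsingleton K F"
  unfolding zero_subsingleton_def
proof (intro allI impI ballI, elim conjE)
  fix A x y assume A: "algebra K A" and z: "\<one>\<^bsub>A\<^esub> = \<zero>\<^bsub>A\<^esub>" and xy: "x \<in> obj F A" "y \<in> obj F A"
  interpret algebra K A by fact
  let ?id = "\<lambda>a\<in>carrier A. a"
  have c: "carrier A = {\<zero>\<^bsub>A\<^esub>}" using z by (metis carrier_one_zero)
  have "is_alg_prod K A A A ?id ?id"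
    unfolding is_alg_prod_def
    by (intro conjI A alg_hom_id[OF A]) (simp add: c bij_betw_def)
  then have "bij_betw (\<lambda>z. (arr F A A ?id z, arr F A A ?id z)) (obj F A) (obj F A \<times> obj F A)"
    using F unfolding faisceau_def by blast
  then have "(x, y) \<in> (\<lambda>z. (arr F A A ?id z, arr F A A ?id z)) ` obj F A"
    using xy unfolding bij_betw_def by auto
  then show "x = y" by auto
qed

text \<open>A single compatibility has to imply all others. For an fppf cover, two maps from
  \<open>S\<close> to \<open>D\<close> that agree on \<open>R\<close> factor through the self tensor
  product. For a product, different factors overlap only in the zero ring, where sections agree by
  \<open>Z\<close>, and a factor overlaps harmlessly with itself because the projections are
  surjective, hence epimorphisms.\<close>

lemma faisceau_of_cov_sheaf:
  assumes F: "cov_sheaf K F" and Z: "zero_subsingleton K F"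
  shows "faisceau K F"
proof -
  note fu = cov_sheafD(1)[OF F]
  have prod: "bij_betw (\<lambda>z. (arr F A B p z, arr F A C q z)) (obj F A) (obj F B \<times> obj F C)"
    if pr: "is_alg_prod K B C A p q" for B C A p q
  proof -
    from pr have alg: "algebra K B" "algebra K C" "algebra K A" and pq: "p \<in> alg_hom K A B" "q \<in> alg_hom K A C"
      unfolding is_alg_prod_def by auto
    have cov: "covers K A {(B, p), (C, q)}" using pr unfolding covers_def by blast
    have zero: "x = y" if "x \<in> obj F D" "y \<in> obj F D" "algebra K D" "\<one>\<^bsub>D\<^esub> = \<zero>\<^bsub>D\<^esub>" for x y D
      using Z that unfolding zero_subsingleton_def by blast
    have "\<exists>z\<in>obj F A. arr F A B p z = x \<and> arr F A C q z = y" if xy: "x \<in> obj F B" "y \<in> obj F C" for x y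
    proof -
      define s where "s = (\<lambda>D f. if (D, f) = (B, p) then x else y)"
      have sB: "s B p = x" by (simp add: s_def)
      \<comment> \<open>The family is indexed by the pairs in the cover, so it takes a single value
        when the two factors coincide. In that case \<open>B\<close> is the zero ring, where
        \<open>x\<close> and \<open>y\<close> agree.\<close>
      have sC: "s C q = y"
      proof (cases "(C, q) = (B, p)")
        case True
        then have "\<one>\<^bsub>B\<^esub> = \<zero>\<^bsub>B\<^esub>"
          using prod_disjoint[OF pr alg(1) alg_hom_id[OF alg(1)]] alg_hom_id[OF alg(1)] by simp
        then have "x = y" using zero[of x B y] True xy alg by simp
        then show ?thesis by (simp add: s_def)
      next
        case False
        then show ?thesis unfolding s_def by (rule if_not_P)
      qed
      have hom_eq: "v = w" if "p' ` carrier A = carrier D" "v \<in> alg_hom K D E" "w \<in> alg_hom K D E"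
        "compose (carrier A) v p' = compose (carrier A) w p'" for p' D E v w
      proof (rule alg_hom_ext[OF that(2,3)])
        fix b assume "b \<in> carrier D"
        then have "b \<in> p' ` carrier A" using that(1) by simp
        then obtain a where "a \<in> carrier A" "b = p' a" by blast
        then show "v b = w b" using fun_cong[OF that(4), of a] by (simp add: compose_def)
      qed
      have m: "matching K F A {(B, p), (C, q)} s"
      proof (rule matchingI)
        fix D f assume "(D, f) \<in> {(B, p), (C, q)}"
        then show "s D f \<in> obj F D" using sB sC xy by auto
      next
        fix B1 f1 C1 g1 D v w
        assume 1: "(B1, f1) \<in> {(B, p), (C, q)}" "(C1, g1) \<in> {(B, p), (C, q)}" "algebra K D"
          "v \<in> alg_hom K B1 D" "w \<in> alg_hom K C1 D" "compose (carrier A) v f1 = compose (carrier A) w g1"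
        have cl: "arr F B1 D v (s B1 f1) \<in> obj F D" "arr F C1 D w (s C1 g1) \<in> obj F D"
          using functorD(1)[OF fu _ 1(3) 1(4)] functorD(1)[OF fu _ 1(3) 1(5)] 1(1,2) sB sC alg xy by auto
        show "arr F B1 D v (s B1 f1) = arr F C1 D w (s C1 g1)"
        proof (cases "(B1, f1) = (C1, g1)")
          case True
          moreover have "f1 ` carrier A = carrier B1" using 1(1) prod_surj[OF pr] by auto
          ultimately have "v = w" using 1(4-6) by (intro hom_eq[of f1 B1 v D w]) auto
          then show ?thesis using True by simp
        next
          case False
          then have "\<one>\<^bsub>D\<^esub> = \<zero>\<^bsub>D\<^esub>" using 1(1,2,4-6) prod_disjoint[OF pr 1(3)] sym[OF 1(6)] by auto
          then show ?thesis using zero[OF cl 1(3)] by blast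
        qed
      qed
      from cov_sheafD(3)[OF F cov m] show ?thesis using sB sC by auto
    qed
    moreover have "inj_on (\<lambda>z. (arr F A B p z, arr F A C q z)) (obj F A)"
      by (rule inj_onI, rule cov_sheafD(2)[OF F cov]) auto
    moreover have "(\<lambda>z. (arr F A B p z, arr F A C q z)) ` obj F A \<subseteq> obj F B \<times> obj F C"
      using functorD(1)[OF fu alg(3,1) pq(1)] functorD(1)[OF fu alg(3,2) pq(2)] by auto
    ultimately show ?thesis unfolding bij_betw_def by (auto simp: image_iff)
  qed
  have fppf: "bij_betw (arr F R S \<phi>) (obj F R) {s \<in> obj F S. arr F S T i1 s = arr F S T i2 s}"
    if c: "fppf_cover K R S \<phi>" and T: "is_self_tensor K R S \<phi> T i1 i2" for R S \<phi> T i1 i2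
  proof -
  from that have cov: "covers K R {(S, \<phi>)}" unfolding covers_def by blast
  have h: "algebra K R" "algebra K S" "\<phi> \<in> alg_hom K R S" "algebra K T" "i1 \<in> alg_hom K S T" "i2 \<in> alg_hom K S T"
    using c T unfolding fppf_cover_def is_self_tensor_def by auto
  have "inj_on (arr F R S \<phi>) (obj F R)"
    by (rule inj_onI, rule cov_sheafD(2)[OF F cov]) auto
  moreover have "arr F R S \<phi> ` obj F R = {s \<in> obj F S. arr F S T i1 s = arr F S T i2 s}"
  proof (intro equalityI subsetI)
    fix s assume "s \<in> arr F R S \<phi> ` obj F R"
    then show "s \<in> {s \<in> obj F S. arr F S T i1 s = arr F S T i2 s}"
      using functorD(1)[OF fu h(1-3)] functorD(3)[OF fu h(1,2,4,3)] h(5,6) self_tensor_coequal[OF h(1-3) T] by auto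
  next
    fix s assume "s \<in> {s \<in> obj F S. arr F S T i1 s = arr F S T i2 s}"
    then have s: "s \<in> obj F S" "arr F S T i1 s = arr F S T i2 s" by auto
    have "matching K F R {(S, \<phi>)} (\<lambda>_ _. s)"
    proof (rule matchingI)
      fix B1 f1 C1 g1 D v w
      assume 1: "(B1, f1) \<in> {(S, \<phi>)}" "(C1, g1) \<in> {(S, \<phi>)}" "algebra K D"
        "v \<in> alg_hom K B1 D" "w \<in> alg_hom K C1 D" "compose (carrier R) v f1 = compose (carrier R) w g1"
      then have vw: "v \<in> alg_hom K S D" "w \<in> alg_hom K S D" "compose (carrier R) v \<phi> = compose (carrier R) w \<phi>" by auto
      obtain k where k: "k \<in> alg_hom K T D" "compose (carrier S) k i1 = v" "compose (carrier S) k i2 = w"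
        using self_tensor_factor[OF h(1-3) T 1(3) vw] by blast
      have "arr F S D v s = arr F S D w s"
        using functorD(3)[OF fu h(2,4) 1(3) h(5) k(1) s(1)] functorD(3)[OF fu h(2,4) 1(3) h(6) k(1) s(1)] s(2) k by simp
      then show "arr F B1 D v s = arr F C1 D w s" using 1 by auto
    qed (use s in auto)
    from cov_sheafD(3)[OF F cov this] show "s \<in> arr F R S \<phi> ` obj F R" by auto
  qed
  ultimately show ?thesis unfolding bij_betw_def by blast
  qed
  show ?thesis unfolding faisceau_def using fu prod fppf by blast
qed

section \<open>Locally generated subfunctors\<close>

lemma nat_transD:
  assumes "nat_trans K F F' \<eta>"
  shows "\<lbrakk>algebra K A; x \<in> obj F A\<rbrakk> \<Longrightarrow> \<eta> A x \<in> obj F' A"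
    "\<lbrakk>algebra K A; algebra K B; f \<in> alg_hom K A B; x \<in> obj F A\<rbrakk> \<Longrightarrow> \<eta> B (arr F A B f x) = arr F' A B f (\<eta> A x)"
  using assms unfolding nat_trans_def by blast+

lemma nat_transI:
  assumes "\<And>A x. \<lbrakk>algebra K A; x \<in> obj F A\<rbrakk> \<Longrightarrow> \<eta> A x \<in> obj F' A"
    "\<And>A B f x. \<lbrakk>algebra K A; algebra K B; f \<in> alg_hom K A B; x \<in> obj F A\<rbrakk>
      \<Longrightarrow> \<eta> B (arr F A B f x) = arr F' A B f (\<eta> A x)"
  shows "nat_trans K F F' \<eta>"
  using assms unfolding nat_trans_def by blast

lemma nat_trans_comp:
  "\<lbrakk>nat_trans K F F' \<eta>; nat_trans K F' F'' \<theta>\<rbrakk> \<Longrightarrow> nat_trans K F F'' (nat_comp \<theta> \<eta>)"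
  by (rule nat_transI) (simp_all add: nat_comp_def nat_transD)

lemma nat_trans_id: "nat_trans K F F (\<lambda>A x. x)"
  by (rule nat_transI) simp_all

lemma nat_isoD:
  assumes "nat_iso K F F' \<eta>"
  shows "nat_trans K F F' \<eta>" "algebra K A \<Longrightarrow> bij_betw (\<eta> A) (obj F A) (obj F' A)"
proof -
  show n: "nat_trans K F F' \<eta>" using assms unfolding nat_iso_def by blast
  obtain \<theta> where t: "nat_trans K F' F \<theta>" "nat_eq K F (nat_comp \<theta> \<eta>) (\<lambda>A x. x)"
    "nat_eq K F' (nat_comp \<eta> \<theta>) (\<lambda>A y. y)" using assms unfolding nat_iso_def by blast
  assume A: "algebra K A"
  show "bij_betw (\<eta> A) (obj F A) (obj F' A)"
    by (rule bij_betwI[where g = "\<theta> A"])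
      (use A t nat_transD(1)[OF n A] nat_transD(1)[OF t(1) A] in \<open>auto simp: nat_eq_def nat_comp_def\<close>)
qed

lemma nat_isoI:
  assumes F: "is_functor K F" and n: "nat_trans K F F' \<eta>"
    and bij: "\<And>A. algebra K A \<Longrightarrow> bij_betw (\<eta> A) (obj F A) (obj F' A)"
  shows "nat_iso K F F' \<eta>"
proof -
  define \<theta> where "\<theta> = (\<lambda>A. inv_into (obj F A) (\<eta> A))"
  have \<theta>: "\<theta> A y \<in> obj F A" "\<eta> A (\<theta> A y) = y" if "algebra K A" "y \<in> obj F' A" for A y
    using bij[OF that(1)] that(2) unfolding \<theta>_def bij_betw_def by (auto simp: inv_into_into f_inv_into_f)
  have \<theta>\<eta>: "\<theta> A (\<eta> A x) = x" if "algebra K A" "x \<in> obj F A" for A x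
    using bij[OF that(1)] that(2) unfolding \<theta>_def bij_betw_def by simp
  have "nat_trans K F' F \<theta>"
  proof (rule nat_transI)
    fix A B f y assume h: "algebra K A" "algebra K B" "f \<in> alg_hom K A B" "y \<in> obj F' A"
    have "\<theta> B (arr F' A B f (\<eta> A (\<theta> A y))) = \<theta> B (\<eta> B (arr F A B f (\<theta> A y)))"
      using nat_transD(2)[OF n h(1-3) \<theta>(1)[OF h(1,4)]] by simp
    also have "\<dots> = arr F A B f (\<theta> A y)"
      by (rule \<theta>\<eta>[OF h(2) functorD(1)[OF F h(1-3) \<theta>(1)[OF h(1,4)]]])
    finally show "\<theta> B (arr F' A B f y) = arr F A B f (\<theta> A y)" using \<theta>(2)[OF h(1,4)] by simp
  qed (rule \<theta>)
  then show ?thesis unfolding nat_iso_def nat_eq_def nat_comp_def using n \<theta> \<theta>\<eta> by blast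
qed

text \<open>The covers in \<open>covers\<close> need not compose to covers, so local membership in
  the image of \<open>p\<close> is defined by iterating them: a derivation is a finite tree of
  covers with sections of \<open>Y\<close> at its leaves.\<close>

inductive gen :: "'u ring \<Rightarrow> ('u, 'y) kfunctor \<Rightarrow> ('u, 'q) kfunctor \<Rightarrow> ('u, 'y, 'q) nat_map \<Rightarrow> 'u alg \<Rightarrow> 'q \<Rightarrow> bool"
  for K Y Q p where
  image: "\<lbrakk>algebra K A; y \<in> obj Y A\<rbrakk> \<Longrightarrow> gen K Y Q p A (p A y)"
| local: "\<lbrakk>covers K A I; c \<in> obj Q A; \<And>B f. (B, f) \<in> I \<Longrightarrow> gen K Y Q p B (arr Q A B f c)\<rbrakk> \<Longrightarrow> gen K Y Q p A c"

definition gen_fun :: "'u ring \<Rightarrow> ('u, 'y) kfunctor \<Rightarrow> ('u, 'q) kfunctor \<Rightarrow> ('u, 'y, 'q) nat_map \<Rightarrow> ('u, 'q) kfunctor" where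
  "gen_fun K Y Q p = \<lparr>obj = (\<lambda>A. {c. gen K Y Q p A c}), arr = arr Q\<rparr>"

definition locally_surjective :: "'u ring \<Rightarrow> ('u, 'y) kfunctor \<Rightarrow> ('u, 'q) kfunctor \<Rightarrow> ('u, 'y, 'q) nat_map \<Rightarrow> bool" where
  "locally_surjective K Y Q p \<longleftrightarrow> (\<forall>A. algebra K A \<longrightarrow> (\<forall>c\<in>obj Q A. gen K Y Q p A c))"

lemma gen_closed:
  assumes "nat_trans K Y Q p" "gen K Y Q p A c"
  shows "algebra K A" "c \<in> obj Q A"
  using assms(2) by (induction) (auto intro: nat_transD(1)[OF assms(1)] covers_alg(1))

text \<open>Induction over the tree of covers. The top cover is refined by its pullback along
  \<open>u\<close>, and each member of the refinement receives a map from a member of the original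
  cover, to which the induction hypothesis applies.\<close>

lemma gen_restrict:
  fixes K :: "'u ring"
  assumes inf: "infinite (UNIV :: 'u set)" and Y: "is_functor K Y" and Q: "is_functor K Q" and p: "nat_trans K Y Q p"
    and c: "gen K Y Q p A c" and B: "algebra K B" and u: "u \<in> alg_hom K A B"
  shows "gen K Y Q p B (arr Q A B u c)"
  using c B u
proof (induction arbitrary: B u)
  case (image A y)
  then show ?case using gen.image[OF image.prems(1) functorD(1)[OF Y image.hyps(1) image.prems image.hyps(2)]]
    nat_transD(2)[OF p image.hyps(1) image.prems image.hyps(2)] by metis
next
  case (local A I c)
  note A = covers_alg[OF local.hyps(1)]
  obtain I' where I': "covers K B I'"
    "\<And>B' f'. (B', f') \<in> I' \<Longrightarrow> \<exists>(D, f)\<in>I. \<exists>t\<in>alg_hom K D B'. compose (carrier A) t f = compose (carrier A) f' u"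
    using covers_pullback[OF inf local.hyps(1) local.prems] by blast
  show ?case
  proof (rule gen.local[OF I'(1) functorD(1)[OF Q A(1) local.prems local.hyps(2)]])
    fix B' f' assume "(B', f') \<in> I'"
    note B' = covers_alg(2,3)[OF I'(1) this]
    obtain D f t where Df: "(D, f) \<in> I" and t: "t \<in> alg_hom K D B'"
      and eq: "compose (carrier A) t f = compose (carrier A) f' u" using I'(2)[OF \<open>(B', f') \<in> I'\<close>] by auto
    have "arr Q B B' f' (arr Q A B u c) = arr Q D B' t (arr Q A D f c)"
      using functorD(3)[OF Q A(1) local.prems(1) B'(1) local.prems(2) B'(2) local.hyps(2)]
        functorD(3)[OF Q A(1) A(2)[OF Df] B'(1) A(3)[OF Df] t local.hyps(2)] eq by simp
    then show "gen K Y Q p B' (arr Q B B' f' (arr Q A B u c))"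
      using local.IH[OF Df B'(1) t] by simp
  qed
qed

text \<open>Gluing takes place in \<open>Q\<close>; the glued section is generated by the rule
  \<open>local\<close>, since its restrictions are.\<close>

lemma gen_fun_sheaf:
  fixes K :: "'u ring"
  assumes inf: "infinite (UNIV :: 'u set)" and Y: "is_functor K Y" and Q: "cov_sheaf K Q" and p: "nat_trans K Y Q p"
  shows "cov_sheaf K (gen_fun K Y Q p)"
proof (rule cov_sheafI)
  note fQ = cov_sheafD(1)[OF Q]
  note cl = gen_closed[OF p]
  show "is_functor K (gen_fun K Y Q p)"
    unfolding is_functor_def gen_fun_def
    using gen_restrict[OF inf Y fQ p] cl functorD[OF fQ] by simp
  fix A I x y
  assume "covers K A I" "x \<in> obj (gen_fun K Y Q p) A" "y \<in> obj (gen_fun K Y Q p) A"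
    "\<And>B f. (B, f) \<in> I \<Longrightarrow> arr (gen_fun K Y Q p) A B f x = arr (gen_fun K Y Q p) A B f y"
  then show "x = y" using cov_sheafD(2)[OF Q, of A I x y] cl by (simp add: gen_fun_def)
next
  note cl = gen_closed[OF p]
  fix A I s assume cov: "covers K A I" and m: "matching K (gen_fun K Y Q p) A I s"
  have s: "gen K Y Q p B (s B f)" if "(B, f) \<in> I" for B f
    using matchingD(1)[OF m that] by (simp add: gen_fun_def)
  have "matching K Q A I s"
  proof (rule matchingI)
    show "(B, f) \<in> I \<Longrightarrow> s B f \<in> obj Q B" for B f using cl(2)[OF s] by blast
  next
    fix B f C g D v w
    assume "(B, f) \<in> I" "(C, g) \<in> I" "algebra K D" "v \<in> alg_hom K B D" "w \<in> alg_hom K C D"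
      "compose (carrier A) v f = compose (carrier A) w g"
    from matchingD(2)[OF m this] show "arr Q B D v (s B f) = arr Q C D w (s C g)" by (simp add: gen_fun_def)
  qed
  then obtain x where x: "x \<in> obj Q A" "\<And>B f. (B, f) \<in> I \<Longrightarrow> arr Q A B f x = s B f"
    using cov_sheafD(3)[OF Q cov] by blast
  have "gen K Y Q p A x" by (rule gen.local[OF cov x(1)]) (simp add: x(2) s)
  then show "\<exists>x\<in>obj (gen_fun K Y Q p) A. \<forall>(B, f)\<in>I. arr (gen_fun K Y Q p) A B f x = s B f"
    using x(2) by (auto simp: gen_fun_def)
qed

lemma gen_fun_nat: "nat_trans K Y Q p \<Longrightarrow> nat_trans K Y (gen_fun K Y Q p) p"
  by (rule nat_transI) (auto simp: gen_fun_def gen.image nat_transD)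

text \<open>The generated subsheaf \<open>?T\<close> has values in the same type as
  \<open>Q\<close>, so it is a legitimate test object without any coding. The map \<open>h\<close>
  from \<open>Q\<close> to \<open>?T\<close>, followed by the inclusion, and the identity of
  \<open>Q\<close> both extend \<open>\<pi>\<close>; they agree by uniqueness, so every section of
  \<open>Q\<close> lies in \<open>?T\<close>.\<close>

lemma coequaliser_locally_surjective:
  fixes K :: "'u ring"
  assumes inf: "infinite (UNIV :: 'u set)" and X: "is_functor K X" and co: "is_coequaliser K Y X \<alpha> \<beta> Q \<pi>"
  shows "locally_surjective K X Q \<pi>"
proof -
  have Q: "faisceau K Q" and \<pi>: "nat_trans K X Q \<pi>" and eq: "nat_eq K Y (nat_comp \<pi> \<alpha>) (nat_comp \<pi> \<beta>)"
    using co unfolding is_coequaliser_def by blast+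
  note up = co[unfolded is_coequaliser_def, THEN conjunct2, THEN conjunct2, THEN conjunct2, rule_format]
  let ?T = "gen_fun K X Q \<pi>"
  note cl = gen_closed[OF \<pi>]
  have "zero_subsingleton K ?T"
    using faisceau_zero[OF Q] cl unfolding zero_subsingleton_def by (simp add: gen_fun_def)
  then have T: "faisceau K ?T"
    using faisceau_of_cov_sheaf gen_fun_sheaf[OF inf X faisceau_cov_sheaf[OF Q] \<pi>] by blast
  obtain h where h: "nat_trans K Q ?T h" "nat_eq K X (nat_comp h \<pi>) \<pi>"
    using up[of ?T \<pi>] T gen_fun_nat[OF \<pi>] eq by blast
  have hQ: "nat_trans K Q Q h"
    by (rule nat_transI) (use nat_transD[OF h(1)] cl in \<open>auto simp: gen_fun_def\<close>)
  obtain h0 where h0: "\<And>h'. nat_trans K Q Q h' \<and> nat_eq K X (nat_comp h' \<pi>) \<pi> \<Longrightarrow> nat_eq K Q h' h0"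
    using up[of Q \<pi>] Q \<pi> eq by blast
  have "nat_eq K X (nat_comp (\<lambda>A x. x) \<pi>) \<pi>" by (simp add: nat_eq_def nat_comp_def)
  then have "nat_eq K Q h h0" "nat_eq K Q (\<lambda>A x. x) h0" using h0 hQ h(2) nat_trans_id by blast+
  then have "h A c = c" if "algebra K A" "c \<in> obj Q A" for A c using that unfolding nat_eq_def by simp
  then show ?thesis
    unfolding locally_surjective_def using nat_transD(1)[OF h(1)] by (metis CollectD gen_fun_def kfunctor.select_convs(1))
qed

text \<open>Induction over the tree of covers: the maps agree at the leaves by \<open>eq\<close>,
  and agreement passes up because \<open>T\<close> is separated.\<close>

lemma locally_surjective_unique:
  assumes p: "nat_trans K Y Z p" and ls: "locally_surjective K Y Z p" and T: "cov_sheaf K T"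
    and h: "nat_trans K Z T h" and h': "nat_trans K Z T h'"
    and eq: "\<And>A y. \<lbrakk>algebra K A; y \<in> obj Y A\<rbrakk> \<Longrightarrow> h A (p A y) = h' A (p A y)"
  shows "nat_eq K Z h h'"
proof -
  have "h A c = h' A c" if "gen K Y Z p A c" for A c
    using that
  proof induction
    case (local A I c)
    note A = covers_alg[OF local(1)]
    show ?case
      by (rule cov_sheafD(2)[OF T local(1)])
        (use local A nat_transD(1)[OF h A(1)] nat_transD(1)[OF h' A(1)]
          nat_transD(2)[OF h A(1), symmetric] nat_transD(2)[OF h' A(1), symmetric] in auto)
  qed (rule eq)
  then show ?thesis using ls unfolding nat_eq_def locally_surjective_def by blast
qed

text \<open>The value at \<open>z\<close> is characterised before it is found:
  \<open>val A z t\<close> says that \<open>t\<close> is compatible with \<open>f\<close> at every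
  section of \<open>Y\<close> lying over a restriction of \<open>z\<close>. Induction over the tree
  of covers of \<open>z\<close> shows that such a \<open>t\<close> is unique and that it exists;
  uniqueness then also gives naturality.\<close>

lemma locally_surjective_extend:
  fixes K :: "'u ring"
  assumes inf: "infinite (UNIV :: 'u set)" and Y: "is_functor K Y" and Z: "is_functor K Z"
    and p: "nat_trans K Y Z p" and ls: "locally_surjective K Y Z p"
    and T: "cov_sheaf K T" and f: "nat_trans K Y T f"
    and fp: "\<And>A y y'. \<lbrakk>algebra K A; y \<in> obj Y A; y' \<in> obj Y A; p A y = p A y'\<rbrakk> \<Longrightarrow> f A y = f A y'"
  shows "\<exists>h. nat_trans K Z T h \<and> nat_eq K Y (nat_comp h p) f"
proof -
  note fT = cov_sheafD(1)[OF T]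
  define val where "val A z t \<longleftrightarrow> t \<in> obj T A \<and> (\<forall>B u y. algebra K B \<and> u \<in> alg_hom K A B \<and> y \<in> obj Y B \<and>
      p B y = arr Z A B u z \<longrightarrow> f B y = arr T A B u t)" for A z t
  have valD: "t \<in> obj T A" "\<And>B u y. \<lbrakk>algebra K B; u \<in> alg_hom K A B; y \<in> obj Y B; p B y = arr Z A B u z\<rbrakk>
      \<Longrightarrow> f B y = arr T A B u t" if "val A z t" for A z t
    using that unfolding val_def by blast+
  have valI: "val A z t" if "t \<in> obj T A" "\<And>B u y. \<lbrakk>algebra K B; u \<in> alg_hom K A B; y \<in> obj Y B; p B y = arr Z A B u z\<rbrakk>
      \<Longrightarrow> f B y = arr T A B u t" for A z t
    using that unfolding val_def by blast
  have val_restrict: "val B (arr Z A B u z) (arr T A B u t)"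
    if A: "algebra K A" "algebra K B" "u \<in> alg_hom K A B" "z \<in> obj Z A" and v: "val A z t" for A B u z t
  proof (rule valI)
    show "arr T A B u t \<in> obj T B" by (rule functorD(1)[OF fT A(1-3) valD(1)[OF v]])
    fix C w y assume C: "algebra K C" "w \<in> alg_hom K B C" "y \<in> obj Y C" "p C y = arr Z B C w (arr Z A B u z)"
    have "f C y = arr T A C (compose (carrier A) w u) t"
      by (rule valD(2)[OF v C(1) alg_hom_compose[OF A(1,3) C(2)] C(3)])
        (use C(4) functorD(3)[OF Z A(1,2) C(1) A(3) C(2) A(4)] in simp)
    then show "f C y = arr T B C w (arr T A B u t)"
      using functorD(3)[OF fT A(1,2) C(1) A(3) C(2) valD(1)[OF v]] by simp
  qed
  have uniq: "t = t'" if "gen K Y Z p A z" "val A z t" "val A z t'" for A z t t'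
    using that
  proof (induction arbitrary: t t')
    case (image A y)
    note A = image(1)
    have "arr Z A A (\<lambda>a\<in>carrier A. a) (p A y) = p A y" by (rule functorD(2)[OF Z A nat_transD(1)[OF p image(1,2)]])
    then have "f A y = arr T A A (\<lambda>a\<in>carrier A. a) t" "f A y = arr T A A (\<lambda>a\<in>carrier A. a) t'"
      using valD(2)[OF image(3) A alg_hom_id[OF A] image(2)] valD(2)[OF image(4) A alg_hom_id[OF A] image(2)] by auto
    then show ?case using functorD(2)[OF fT A] valD(1)[OF image(3)] valD(1)[OF image(4)] by simp
  next
    case (local A I c)
    note A = covers_alg[OF local(1)]
    show ?case
      by (rule cov_sheafD(2)[OF T local(1) valD(1)[OF local(5)] valD(1)[OF local(6)]])
        (rule local(4), assumption, (rule val_restrict; use A local in blast)+)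
  qed
  have val_p: "val A (p A y) (f A y)" if A: "algebra K A" "y \<in> obj Y A" for A y
  proof (rule valI)
    show "f A y \<in> obj T A" by (rule nat_transD(1)[OF f A])
    fix B u y' assume B: "algebra K B" "u \<in> alg_hom K A B" "y' \<in> obj Y B" "p B y' = arr Z A B u (p A y)"
    have "p B y' = p B (arr Y A B u y)" using B(4) nat_transD(2)[OF p A(1) B(1,2) A(2)] by simp
    then have "f B y' = f B (arr Y A B u y)"
      by (rule fp[OF B(1,3) functorD(1)[OF Y A(1) B(1,2) A(2)]])
    then show "f B y' = arr T A B u (f A y)" using nat_transD(2)[OF f A(1) B(1,2) A(2)] by simp
  qed
  have ex: "\<exists>t. val A z t" if "gen K Y Z p A z" for A z
    using that
  proof induction
    case (image A y) then show ?case using val_p by blast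
  next
    case (local A I c)
    note A = covers_alg[OF local(1)]
    obtain s where s: "\<And>B f. (B, f) \<in> I \<Longrightarrow> val B (arr Z A B f c) (s B f)" using local(4) by metis
    \<comment> \<open>On an overlap both restrictions satisfy \<open>val\<close> for the same
      section of \<open>Z\<close>. They agree by \<open>uniq\<close>, which applies because that
      section is again generated.\<close>
    have "matching K T A I s"
    proof (rule matchingI)
      fix B g C h D v w assume B: "(B, g) \<in> I" and C: "(C, h) \<in> I" and D: "algebra K D"
        and v: "v \<in> alg_hom K B D" and w: "w \<in> alg_hom K C D"
        and eq: "compose (carrier A) v g = compose (carrier A) w h"
      have Bz: "arr Z A B g c \<in> obj Z B" and Cz: "arr Z A C h c \<in> obj Z C"
        using functorD(1)[OF Z A(1) A(2) A(3) local(2)] B C by blast+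
      have e: "arr Z B D v (arr Z A B g c) = arr Z C D w (arr Z A C h c)"
        using functorD(3)[OF Z A(1) A(2)[OF B] D A(3)[OF B] v local(2)]
          functorD(3)[OF Z A(1) A(2)[OF C] D A(3)[OF C] w local(2)] eq by simp
      show "arr T B D v (s B g) = arr T C D w (s C h)"
      proof (rule uniq)
        show "gen K Y Z p D (arr Z B D v (arr Z A B g c))"
          by (rule gen_restrict[OF inf Y Z p local(3)[OF B] D v])
        show "val D (arr Z B D v (arr Z A B g c)) (arr T B D v (s B g))"
          by (rule val_restrict[OF A(2)[OF B] D v Bz s[OF B]])
        show "val D (arr Z B D v (arr Z A B g c)) (arr T C D w (s C h))"
          unfolding e by (rule val_restrict[OF A(2)[OF C] D w Cz s[OF C]])
      qed
    qed (use s valD(1) in blast)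
    then obtain t where t: "t \<in> obj T A" "\<And>B f. (B, f) \<in> I \<Longrightarrow> arr T A B f t = s B f"
      using cov_sheafD(3)[OF T local(1)] by blast
    have "val A c t"
    proof (rule valI[OF t(1)])
      fix B u y assume B: "algebra K B" and u: "u \<in> alg_hom K A B" and y: "y \<in> obj Y B" and py: "p B y = arr Z A B u c"
      \<comment> \<open>The homomorphism \<open>u\<close> need not factor through the cover of
        \<open>A\<close>; it does so after passing to a cover of \<open>B\<close>.\<close>
      obtain I' where I': "covers K B I'"
        "\<And>B' f'. (B', f') \<in> I' \<Longrightarrow> \<exists>(D, f)\<in>I. \<exists>t\<in>alg_hom K D B'. compose (carrier A) t f = compose (carrier A) f' u"
        using covers_pullback[OF inf local(1) B u] by blast
      show "f B y = arr T A B u t"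
      proof (rule cov_sheafD(2)[OF T I'(1) nat_transD(1)[OF f B y] functorD(1)[OF fT A(1) B u t(1)]])
        fix B' f' assume in': "(B', f') \<in> I'"
        note B' = covers_alg(2,3)[OF I'(1) in']
        obtain D d r where Dd: "(D, d) \<in> I" and r: "r \<in> alg_hom K D B'"
          and eq: "compose (carrier A) r d = compose (carrier A) f' u" using I'(2)[OF in'] by auto
        have "p B' (arr Y B B' f' y) = arr Z B B' f' (arr Z A B u c)"
          using nat_transD(2)[OF p B B' y] py by simp
        also have "\<dots> = arr Z D B' r (arr Z A D d c)"
          using functorD(3)[OF Z A(1) A(2)[OF Dd] B'(1) A(3)[OF Dd] r local(2)]
            functorD(3)[OF Z A(1) B B'(1) u B'(2) local(2)] eq by simp
        finally have "f B' (arr Y B B' f' y) = arr T D B' r (s D d)"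
          by (rule valD(2)[OF s[OF Dd] B'(1) r functorD(1)[OF Y B B' y]])
        also have "\<dots> = arr T D B' r (arr T A D d t)" using t(2)[OF Dd] by simp
        also have "\<dots> = arr T B B' f' (arr T A B u t)"
          using functorD(3)[OF fT A(1) A(2)[OF Dd] B'(1) A(3)[OF Dd] r t(1)]
            functorD(3)[OF fT A(1) B B'(1) u B'(2) t(1)] eq by simp
        finally show "arr T B B' f' (f B y) = arr T B B' f' (arr T A B u t)"
          using nat_transD(2)[OF f B B' y] by simp
      qed
    qed
    then show ?case by blast
  qed
  define h where "h = (\<lambda>A z. SOME t. val A z t)"
  have g: "gen K Y Z p A z" if "algebra K A" "z \<in> obj Z A" for A z
    using ls that unfolding locally_surjective_def by blast
  have h: "val A z (h A z)" if "algebra K A" "z \<in> obj Z A" for A z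
    using ex[OF g[OF that]] unfolding h_def by (rule someI_ex)
  have "nat_trans K Z T h"
  proof (rule nat_transI)
    fix A z assume "algebra K A" "z \<in> obj Z A"
    then show "h A z \<in> obj T A" using valD(1) h by blast
  next
    fix A B u z assume A: "algebra K A" "algebra K B" "u \<in> alg_hom K A B" "z \<in> obj Z A"
    note z' = functorD(1)[OF Z A]
    show "h B (arr Z A B u z) = arr T A B u (h A z)"
      by (rule uniq[OF g[OF A(2) z'] h[OF A(2) z'] val_restrict[OF A h[OF A(1,4)]]])
  qed
  moreover have "nat_eq K Y (nat_comp h p) f"
    unfolding nat_eq_def nat_comp_def
  proof (intro allI impI ballI)
    fix A y assume A: "algebra K A" "y \<in> obj Y A"
    note z = nat_transD(1)[OF p A]
    show "h A (p A y) = f A y" by (rule uniq[OF g[OF A(1) z] h[OF A(1) z] val_p[OF A]])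
  qed
  ultimately show ?thesis by blast
qed

section \<open>Transport of small sheaves\<close>

text \<open>Used to bring a test sheaf into the type \<open>'v\<close>. The codings for different
  algebras are unrelated, so a restriction map has to decode, restrict in \<open>F\<close> and code
  again.\<close>

definition transport_fun :: "('u alg \<Rightarrow> 'w \<Rightarrow> 'v) \<Rightarrow> ('u, 'w) kfunctor \<Rightarrow> ('u, 'v) kfunctor" where
  "transport_fun enc F = \<lparr>obj = (\<lambda>A. enc A ` obj F A),
     arr = (\<lambda>A B f v. enc B (arr F A B f (inv_into (obj F A) (enc A) v)))\<rparr>"

lemma transport_faisceau:
  assumes F: "cov_sheaf K F" and Z: "zero_subsingleton K F" and inj: "\<And>A. algebra K A \<Longrightarrow> inj_on (enc A) (obj F A)"
  shows "faisceau K (transport_fun enc F)" "nat_trans K F (transport_fun enc F) enc"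
proof -
  let ?T = "transport_fun enc F"
  note fF = cov_sheafD(1)[OF F]
  have objT: "obj ?T A = enc A ` obj F A" for A by (simp add: transport_fun_def)
  have arrT: "arr ?T A B f (enc A x) = enc B (arr F A B f x)" if "algebra K A" "x \<in> obj F A" for A B f x
    using inv_into_f_f[OF inj[OF that(1)] that(2)] by (simp add: transport_fun_def)
  show "nat_trans K F ?T enc" by (rule nat_transI) (auto simp: objT arrT)
  have "cov_sheaf K ?T"
  proof (rule cov_sheafI)
    show "is_functor K ?T" unfolding is_functor_def
    proof (intro conjI allI impI ballI, elim conjE)
      fix A B f assume "algebra K A" "algebra K B" "f \<in> alg_hom K A B"
      then show "arr ?T A B f \<in> obj ?T A \<rightarrow> obj ?T B" using functorD(1)[OF fF] by (auto simp: objT arrT)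
    next
      fix A x assume "algebra K A" "x \<in> obj ?T A"
      then show "arr ?T A A (\<lambda>a\<in>carrier A. a) x = x" using functorD(2)[OF fF] by (auto simp: objT arrT)
    next
      fix A B C f g x assume "algebra K A \<and> algebra K B \<and> algebra K C \<and> f \<in> alg_hom K A B \<and> g \<in> alg_hom K B C"
        "x \<in> obj ?T A"
      then show "arr ?T A C (compose (carrier A) g f) x = arr ?T B C g (arr ?T A B f x)"
        using functorD(1,3)[OF fF] by (auto simp: objT arrT)
    qed
    fix A I x y assume cov: "covers K A I" and xy: "x \<in> obj ?T A" "y \<in> obj ?T A"
      and eq: "\<And>B f. (B, f) \<in> I \<Longrightarrow> arr ?T A B f x = arr ?T A B f y"
    note A = covers_alg[OF cov]
    obtain x' y' where x': "x' \<in> obj F A" "x = enc A x'" and y': "y' \<in> obj F A" "y = enc A y'" using xy objT by auto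
    have "x' = y'"
    proof (rule cov_sheafD(2)[OF F cov x'(1) y'(1)])
      fix B f assume B: "(B, f) \<in> I"
      have "enc B (arr F A B f x') = enc B (arr F A B f y')" using eq[OF B] x' y' arrT A(1) by simp
      then show "arr F A B f x' = arr F A B f y'"
        using inj_onD[OF inj[OF A(2)[OF B]]] functorD(1)[OF fF A(1) A(2)[OF B] A(3)[OF B]] x' y' by blast
    qed
    then show "x = y" using x' y' by simp
  next
    fix A I s assume cov: "covers K A I" and m: "matching K ?T A I s"
    note A = covers_alg[OF cov]
    define s' where "s' = (\<lambda>B f. inv_into (obj F B) (enc B) (s B f))"
    have s': "s' B f \<in> obj F B" "enc B (s' B f) = s B f" if "(B, f) \<in> I" for B f
      using matchingD(1)[OF m that] unfolding s'_def objT by (auto simp: inv_into_into f_inv_into_f)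
    have "matching K F A I s'"
    proof (rule matchingI)
      fix B f C g D v w assume B: "(B, f) \<in> I" and C: "(C, g) \<in> I" and D: "algebra K D"
        and v: "v \<in> alg_hom K B D" and w: "w \<in> alg_hom K C D"
        and eq: "compose (carrier A) v f = compose (carrier A) w g"
      have "enc D (arr F B D v (s' B f)) = enc D (arr F C D w (s' C g))"
        using matchingD(2)[OF m B C D v w eq] arrT[OF A(2)[OF B] s'(1)[OF B]] arrT[OF A(2)[OF C] s'(1)[OF C]]
          s'(2)[OF B] s'(2)[OF C] by simp
      then show "arr F B D v (s' B f) = arr F C D w (s' C g)"
        using inj_onD[OF inj[OF D]] functorD(1)[OF fF A(2)[OF B] D v s'(1)[OF B]]
          functorD(1)[OF fF A(2)[OF C] D w s'(1)[OF C]] by blast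
    qed (rule s')
    then obtain x where x: "x \<in> obj F A" "\<And>B f. (B, f) \<in> I \<Longrightarrow> arr F A B f x = s' B f"
      using cov_sheafD(3)[OF F cov] by blast
    then show "\<exists>x\<in>obj ?T A. \<forall>(B, f)\<in>I. arr ?T A B f x = s B f"
      using s'(2) arrT[OF A(1) x(1)] by (intro bexI[of _ "enc A x"]) (auto simp: objT)
  qed
  moreover have "zero_subsingleton K ?T"
    unfolding zero_subsingleton_def objT
  proof (intro allI impI ballI)
    fix A x y assume A: "algebra K A \<and> \<one>\<^bsub>A\<^esub> = \<zero>\<^bsub>A\<^esub>" and "x \<in> enc A ` obj F A" "y \<in> enc A ` obj F A"
    then obtain x' y' where xy: "x' \<in> obj F A" "y' \<in> obj F A" "x = enc A x'" "y = enc A y'" by blast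
    have "x' = y'" using Z A xy(1,2) unfolding zero_subsingleton_def by simp
    then show "x = y" using xy by simp
  qed
  ultimately show "faisceau K ?T" by (rule faisceau_of_cov_sheaf)
qed

text \<open>By separatedness, a locally generated section is determined by a finite binary tree of covers
  whose leaves are sections of \<open>Y\<close>; the injection \<open>j\<close> codes these trees.\<close>

lemma gen_fun_embeds:
  fixes K :: "'u ring" and Y :: "('u, 'y) kfunctor" and Q :: "('u, 'q) kfunctor"
    and j :: "('u alg \<times> 'y) + ('u alg \<times> ('u alg \<times> ('u \<Rightarrow> 'u)) \<times> ('u alg \<times> ('u \<Rightarrow> 'u)) \<times> 'v \<times> 'v) \<Rightarrow> 'v"
  assumes j: "inj j" and Q: "cov_sheaf K Q"
  shows "\<exists>enc :: 'u alg \<Rightarrow> 'q \<Rightarrow> 'v. \<forall>A. inj_on (enc A) (obj (gen_fun K Y Q p) A)"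
proof -
  \<comment> \<open>The codes are given by the least fixed point of this operator. A leaf records
    its algebra and its section of \<open>Y\<close>; a node records its algebra, the two members of
    its cover and the codes over them.\<close>
  define step where "step code A c v \<longleftrightarrow>
      (\<exists>y. algebra K A \<and> y \<in> obj Y A \<and> c = p A y \<and> v = j (Inl (A, y))) \<or>
      (\<exists>B f C g v1 v2. covers K A {(B, f), (C, g)} \<and> c \<in> obj Q A \<and> code B (arr Q A B f c) v1 \<and>
         code C (arr Q A C g c) v2 \<and> v = j (Inr (A, (B, f), (C, g), v1, v2)))" for code A c v
  have "mono step"
    unfolding mono_def le_fun_def le_bool_def step_def by blast
  define code where "code = lfp step"
  have unf: "code A c v \<longleftrightarrow> step code A c v" for A c v
    using lfp_unfold[OF \<open>mono step\<close>] unfolding code_def by metis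
  have inj_code: "code A c v \<Longrightarrow> code A' c' v \<Longrightarrow> A = A' \<and> c = c'" for A c A' c' v
  proof -
    \<comment> \<open>\<open>good\<close> expresses that a code determines both algebra and section.
      At a node this holds because sections of \<open>Q\<close> over \<open>A\<close> are determined
      by their restrictions to a cover.\<close>
    define good where "good A c v \<longleftrightarrow> (\<forall>A' c'. code A' c' v \<longrightarrow> A = A' \<and> c = c')" for A c v
    have "step good \<le> good"
    proof (intro le_funI le_boolI)
      fix A c v assume "step good A c v"
      then consider (im) y where "y \<in> obj Y A" "c = p A y" "v = j (Inl (A, y))"
        | (lo) B f C g v1 v2 where "covers K A {(B, f), (C, g)}" "c \<in> obj Q A" "good B (arr Q A B f c) v1"
         "good C (arr Q A C g c) v2" "v = j (Inr (A, (B, f), (C, g), v1, v2))"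
        unfolding step_def by blast
      then show "good A c v"
      proof cases
        case im
        then show ?thesis unfolding good_def by (subst unf) (auto simp: step_def inj_eq[OF j])
      next
        case lo
        show ?thesis unfolding good_def
        proof (intro allI impI)
          fix A' c' assume "code A' c' v"
          then have "A' = A" and c': "c' \<in> obj Q A" "code B (arr Q A B f c') v1" "code C (arr Q A C g c') v2"
            unfolding unf[of A' c'] step_def lo(5) by (auto simp: inj_eq[OF j])
          then have "arr Q A B f c = arr Q A B f c'" "arr Q A C g c = arr Q A C g c'"
            using lo(3,4) unfolding good_def by blast+
          then have "c = c'" by (intro cov_sheafD(2)[OF Q lo(1,2) c'(1)]) auto
          then show "A = A' \<and> c = c'" using \<open>A' = A\<close> by simp
        qed
      qed
    qed
    then have "code \<le> good" unfolding code_def by (rule lfp_lowerbound)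
    then show "code A c v \<Longrightarrow> code A' c' v \<Longrightarrow> A = A' \<and> c = c'"
      unfolding good_def le_fun_def le_bool_def by blast
  qed
  have ex_code: "\<exists>v. code A c v" if "gen K Y Q p A c" for A c
    using that
  proof induction
    case (image A y)
    then have "code A (p A y) (j (Inl (A, y)))" by (subst unf) (auto simp: step_def)
    then show ?case by blast
  next
    case (local A I c)
    \<comment> \<open>A cover with one member is read as a pair of equal members, so every node is
      binary.\<close>
    obtain B f C g where I: "I = {(B, f), (C, g)}" using local(1) unfolding covers_def by blast
    obtain v1 v2 where v: "code B (arr Q A B f c) v1" "code C (arr Q A C g c) v2" 
      using local(4)[of B f] local(4)[of C g] I by auto
    have "code A c (j (Inr (A, (B, f), (C, g), v1, v2)))"
      unfolding unf[of A c] step_def using local(1,2) v I by blast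
    then show ?case by blast
  qed
  have "inj_on (\<lambda>c. SOME v. code A c v) (obj (gen_fun K Y Q p) A)" for A
  proof (rule inj_onI)
    fix c d assume "c \<in> obj (gen_fun K Y Q p) A" "d \<in> obj (gen_fun K Y Q p) A"
      and eq: "(SOME v. code A c v) = (SOME v. code A d v)"
    then have "gen K Y Q p A c" "gen K Y Q p A d" by (simp_all add: gen_fun_def)
    then have "code A c (SOME v. code A c v)" "code A d (SOME v. code A d v)"
      using someI_ex[OF ex_code] by blast+
    then show "c = d" using inj_code eq by metis
  qed
  then show ?thesis by (intro exI[of _ "\<lambda>A c. SOME v. code A c v"]) blast
qed

text \<open>Functions on \<open>'u\<close> are coded by their graphs, which become subsets of
  \<open>'u\<close> through a pairing, and an algebra by its six fields. The constants
  \<open>c0\<close> and \<open>c1\<close> separate leaves from nodes.\<close>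

lemma code_injection:
  fixes \<iota> :: "'u set \<Rightarrow> 'v" and k :: "'y \<Rightarrow> 'v"
  assumes inf: "infinite (UNIV :: 'u set)" and \<iota>: "inj \<iota>" and k: "inj k"
  shows "\<exists>j :: ('u alg \<times> 'y) + ('u alg \<times> ('u alg \<times> ('u \<Rightarrow> 'u)) \<times> ('u alg \<times> ('u \<Rightarrow> 'u)) \<times> 'v \<times> 'v) \<Rightarrow> 'v. inj j"
proof -
  obtain pu :: "'u \<times> 'u \<Rightarrow> 'u" where pu: "inj pu" using infinite_inj_pair[OF inf] by blast
  have "inj (\<lambda>x :: 'u. \<iota> {x})" using \<iota> by (auto simp: inj_def)
  then have infv: "infinite (UNIV :: 'v set)" using inf by (metis finite_imageD finite_subset subset_UNIV)
  obtain pr :: "'v \<times> 'v \<Rightarrow> 'v" where pr: "inj pr" using infinite_inj_pair[OF infv] by blast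
  obtain c0 c1 :: 'v where c: "c0 \<noteq> c1" using infv by (metis (full_types) finite.emptyI finite_insert infinite_super insertI1 subsetI)
  define fn where "fn = (\<lambda>f :: 'u \<Rightarrow> 'u. \<iota> (range (\<lambda>x. pu (x, f x))))"
  have fn: "fn f = fn g \<longleftrightarrow> f = g" for f g
  proof
    assume "fn f = fn g"
    then have r: "range (\<lambda>x. pu (x, f x)) = range (\<lambda>x. pu (x, g x))" using \<iota> by (simp add: fn_def inj_eq)
    show "f = g"
    proof
      fix x
      have "pu (x, f x) \<in> range (\<lambda>x. pu (x, g x))" unfolding r[symmetric] by blast
      then show "f x = g x" by (auto simp: inj_eq[OF pu])
    qed
  qed simp
  define fn2 where "fn2 = (\<lambda>f :: 'u \<Rightarrow> 'u \<Rightarrow> 'u. \<iota> (range (\<lambda>(x, y). pu (x, pu (y, f x y)))))"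
  have fn2: "fn2 f = fn2 g \<longleftrightarrow> f = g" for f g
  proof
    assume "fn2 f = fn2 g"
    then have r: "range (\<lambda>(x, y). pu (x, pu (y, f x y))) = range (\<lambda>(x, y). pu (x, pu (y, g x y)))"
      using \<iota> by (simp add: fn2_def inj_eq)
    show "f = g"
    proof (intro ext)
      fix x y
      have "(\<lambda>(x, y). pu (x, pu (y, f x y))) (x, y) \<in> range (\<lambda>(x, y). pu (x, pu (y, g x y)))"
        unfolding r[symmetric] by (rule rangeI)
      then show "f x y = g x y" by (auto simp: inj_eq[OF pu])
    qed
  qed simp
  define al where "al = (\<lambda>A :: 'u alg. pr (\<iota> (carrier A), pr (fn2 (monoid.mult A), pr (\<iota> {one A},
      pr (\<iota> {ring.zero A}, pr (fn2 (ring.add A), fn2 (smult A)))))))"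
  have al: "al A = al B \<longleftrightarrow> A = B" for A B
    by (auto simp: al_def inj_eq[OF pr] inj_eq[OF \<iota>] fn2 intro: module.equality)
  define j where "j = (\<lambda>z :: ('u alg \<times> 'y) + ('u alg \<times> ('u alg \<times> ('u \<Rightarrow> 'u)) \<times> ('u alg \<times> ('u \<Rightarrow> 'u)) \<times> 'v \<times> 'v).
      case z of Inl (A, y) \<Rightarrow> pr (c0, pr (al A, k y))
      | Inr (A, (B, f), (C, g), v, w) \<Rightarrow> pr (c1, pr (al A, pr (al B, pr (fn f, pr (al C, pr (fn g, pr (v, w))))))))"
  have "inj j"
    by (rule injI) (use c in \<open>auto simp: j_def inj_eq[OF pr] inj_eq[OF k] al fn split: sum.splits\<close>)
  then show ?thesis by blast
qed

section \<open>Effectivity of the quotient by a free action\<close>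

text \<open>The power object of \<open>X\<close>: a section over \<open>A\<close> is a subsheaf of
  the restriction of \<open>X\<close> to \<open>A\<close>-algebras. In a triple, \<open>B\<close> is
  an \<open>A\<close>-algebra with structure map \<open>u\<close> and \<open>y\<close> is a section
  over it; the two closure conditions are stability under restriction and locality.\<close>

definition power_fun :: "'u ring \<Rightarrow> ('u, 'x) kfunctor \<Rightarrow> ('u, ('u alg \<times> ('u \<Rightarrow> 'u) \<times> 'x) set) kfunctor" where
  "power_fun K X =
     \<lparr>obj = (\<lambda>A. {O'. O' \<subseteq> {(B, u, y). algebra K B \<and> u \<in> alg_hom K A B \<and> y \<in> obj X B} \<and>
        (\<forall>B u y C w. (B, u, y) \<in> O' \<and> algebra K C \<and> w \<in> alg_hom K B C \<longrightarrow>
           (C, compose (carrier A) w u, arr X B C w y) \<in> O') \<and>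
        (\<forall>B u y I. covers K B I \<and> u \<in> alg_hom K A B \<and> y \<in> obj X B \<and>
           (\<forall>(C, f)\<in>I. (C, compose (carrier A) f u, arr X B C f y) \<in> O') \<longrightarrow> (B, u, y) \<in> O')}),
      arr = (\<lambda>A A' w O'. {(B, u, y). u \<in> alg_hom K A' B \<and> (B, compose (carrier A) u w, y) \<in> O'})\<rparr>"

lemma power_objD:
  assumes "O' \<in> obj (power_fun K X) A"
  shows "(B, u, y) \<in> O' \<Longrightarrow> algebra K B" "(B, u, y) \<in> O' \<Longrightarrow> u \<in> alg_hom K A B" "(B, u, y) \<in> O' \<Longrightarrow> y \<in> obj X B"
    "\<lbrakk>(B, u, y) \<in> O'; algebra K C; w \<in> alg_hom K B C\<rbrakk> \<Longrightarrow> (C, compose (carrier A) w u, arr X B C w y) \<in> O'"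
    "\<lbrakk>covers K B I; u \<in> alg_hom K A B; y \<in> obj X B;
      \<And>C f. (C, f) \<in> I \<Longrightarrow> (C, compose (carrier A) f u, arr X B C f y) \<in> O'\<rbrakk> \<Longrightarrow> (B, u, y) \<in> O'"
proof -
  note O' = assms[unfolded power_fun_def kfunctor.select_convs mem_Collect_eq]
  note sub = conjunct1[OF O'] and cl = conjunct1[OF conjunct2[OF O']] and loc = conjunct2[OF conjunct2[OF O']]
  show "(B, u, y) \<in> O' \<Longrightarrow> algebra K B" "(B, u, y) \<in> O' \<Longrightarrow> u \<in> alg_hom K A B" "(B, u, y) \<in> O' \<Longrightarrow> y \<in> obj X B"
    using sub by auto
  show "\<lbrakk>(B, u, y) \<in> O'; algebra K C; w \<in> alg_hom K B C\<rbrakk> \<Longrightarrow> (C, compose (carrier A) w u, arr X B C w y) \<in> O'"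
    using cl by simp
  assume "covers K B I" "u \<in> alg_hom K A B" "y \<in> obj X B"
      "\<And>C f. (C, f) \<in> I \<Longrightarrow> (C, compose (carrier A) f u, arr X B C f y) \<in> O'"
  then show "(B, u, y) \<in> O'" by (intro loc[rule_format, of B I u y]) auto
qed

lemma power_objI:
  assumes "\<And>B u y. (B, u, y) \<in> O' \<Longrightarrow> algebra K B \<and> u \<in> alg_hom K A B \<and> y \<in> obj X B"
    "\<And>B u y C w. \<lbrakk>(B, u, y) \<in> O'; algebra K C; w \<in> alg_hom K B C\<rbrakk> \<Longrightarrow> (C, compose (carrier A) w u, arr X B C w y) \<in> O'"
    "\<And>B u y I. \<lbrakk>covers K B I; u \<in> alg_hom K A B; y \<in> obj X B;
      \<And>C f. (C, f) \<in> I \<Longrightarrow> (C, compose (carrier A) f u, arr X B C f y) \<in> O'\<rbrakk> \<Longrightarrow> (B, u, y) \<in> O'"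
  shows "O' \<in> obj (power_fun K X) A"
  unfolding power_fun_def kfunctor.select_convs mem_Collect_eq
proof (intro conjI allI impI)
  show "O' \<subseteq> {(B, u, y). algebra K B \<and> u \<in> alg_hom K A B \<and> y \<in> obj X B}" using assms(1) by auto
  show "(C, compose (carrier A) w u, arr X B C w y) \<in> O'" if "(B, u, y) \<in> O' \<and> algebra K C \<and> w \<in> alg_hom K B C" for B u y C w
    using that assms(2) by blast
  show "(B, u, y) \<in> O'" if "covers K B I \<and> u \<in> alg_hom K A B \<and> y \<in> obj X B \<and>
           (\<forall>(C, f)\<in>I. (C, compose (carrier A) f u, arr X B C f y) \<in> O')" for B u y I
    by (rule assms(3)[of B I]) (use that in auto)
qed

lemma power_arr:
  "(B, u, y) \<in> arr (power_fun K X) A A' w O' \<longleftrightarrow> u \<in> alg_hom K A' B \<and> (B, compose (carrier A) u w, y) \<in> O'"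
  by (simp add: power_fun_def)

lemma power_arr_closed:
  assumes O': "O' \<in> obj (power_fun K X) A" and A: "algebra K A" "algebra K A'" and w: "w \<in> alg_hom K A A'"
  shows "arr (power_fun K X) A A' w O' \<in> obj (power_fun K X) A'"
proof (rule power_objI)
  fix B u y assume "(B, u, y) \<in> arr (power_fun K X) A A' w O'"
  then show "algebra K B \<and> u \<in> alg_hom K A' B \<and> y \<in> obj X B"
    using power_objD(1,3)[OF O'] by (auto simp: power_arr)
next
  fix B u y C v assume h: "(B, u, y) \<in> arr (power_fun K X) A A' w O'" "algebra K C" "v \<in> alg_hom K B C"
  then have u: "u \<in> alg_hom K A' B" "(B, compose (carrier A) u w, y) \<in> O'" by (auto simp: power_arr)
  show "(C, compose (carrier A') v u, arr X B C v y) \<in> arr (power_fun K X) A A' w O'"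
    using power_objD(4)[OF O' u(2) h(2,3)] alg_hom_compose[OF A(2) u(1) h(3)] compose_alg_assoc[OF w, of v u]
    by (simp add: power_arr)
next
  fix B u y I assume cov: "covers K B I" and u: "u \<in> alg_hom K A' B" and y: "y \<in> obj X B"
    and loc: "\<And>C f. (C, f) \<in> I \<Longrightarrow> (C, compose (carrier A') f u, arr X B C f y) \<in> arr (power_fun K X) A A' w O'"
  have "(B, compose (carrier A) u w, y) \<in> O'"
  proof (rule power_objD(5)[OF O' cov alg_hom_compose[OF A(1) w u] y])
    fix C f assume "(C, f) \<in> I"
    from loc[OF this] show "(C, compose (carrier A) f (compose (carrier A) u w), arr X B C f y) \<in> O'"
      using compose_alg_assoc[OF w, of f u] by (simp add: power_arr)
  qed
  then show "(B, u, y) \<in> arr (power_fun K X) A A' w O'" using u by (simp add: power_arr)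
qed

lemma power_arr_id:
  assumes "O' \<in> obj (power_fun K X) A"
  shows "arr (power_fun K X) A A (\<lambda>a\<in>carrier A. a) O' = O'"
proof (rule Set.set_eqI)
  fix z :: "'a alg \<times> ('a \<Rightarrow> 'a) \<times> 'b"
  obtain B u y where z: "z = (B, u, y)" by (cases z) auto
  show "z \<in> arr (power_fun K X) A A (\<lambda>a\<in>carrier A. a) O' \<longleftrightarrow> z \<in> O'"
    unfolding z power_arr using power_objD(2)[OF assms] compose_alg_id(1) by metis
qed

lemma power_arr_comp:
  assumes A: "algebra K A" "algebra K B" and f: "f \<in> alg_hom K A B" and g: "g \<in> alg_hom K B C"
  shows "arr (power_fun K X) A C (compose (carrier A) g f) O' = arr (power_fun K X) B C g (arr (power_fun K X) A B f O')"
proof (rule Set.set_eqI)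
  fix z :: "'a alg \<times> ('a \<Rightarrow> 'a) \<times> 'b"
  obtain D u y where z: "z = (D, u, y)" by (cases z) auto
  show "z \<in> arr (power_fun K X) A C (compose (carrier A) g f) O' \<longleftrightarrow>
      z \<in> arr (power_fun K X) B C g (arr (power_fun K X) A B f O')"
    unfolding z power_arr using alg_hom_compose[OF A(2) g] compose_alg_assoc[OF f, of u g] by metis
qed

lemma power_functor: "is_functor K (power_fun K X)"
  unfolding is_functor_def
  by (intro conjI allI impI ballI funcsetI; (elim conjE)?)
    (rule power_arr_closed power_arr_id power_arr_comp, assumption+)+

text \<open>Membership of a triple is local. Hence subsheaves that agree on the members of a cover
  agree, and compatible subsheaves on the members are glued by testing a triple wherever a member of
  the cover is available; locality of the result uses the pullback of covers.\<close>

lemma power_sheaf: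
  fixes K :: "'u ring" and X :: "('u, 'x) kfunctor"
  assumes inf: "infinite (UNIV :: 'u set)" and X: "is_functor K X"
  shows "cov_sheaf K (power_fun K X)"
proof (rule cov_sheafI[OF power_functor])
  let ?W = "power_fun K X"
  have half: "x \<subseteq> y" if cov: "covers K A I" and x: "x \<in> obj ?W A" and y: "y \<in> obj ?W A"
    and eq: "\<And>B f. (B, f) \<in> I \<Longrightarrow> arr ?W A B f x = arr ?W A B f y" for A I x y
  proof
    fix z assume "z \<in> x"
    then obtain B u t where z: "z = (B, u, t)" "(B, u, t) \<in> x" by (cases z) auto
    note B = power_objD(1-3)[OF x z(2)] and A = covers_alg[OF cov]
    obtain I' where I': "covers K B I'"
      "\<And>B' f'. (B', f') \<in> I' \<Longrightarrow> \<exists>(D, f)\<in>I. \<exists>r\<in>alg_hom K D B'. compose (carrier A) r f = compose (carrier A) f' u"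
      using covers_pullback[OF inf cov B(1,2)] by blast
    have "(B, u, t) \<in> y"
    proof (rule power_objD(5)[OF y I'(1) B(2,3)])
      fix C f' assume in': "(C, f') \<in> I'"
      note C = covers_alg(2,3)[OF I'(1) in']
      obtain D f r where Df: "(D, f) \<in> I" and r: "r \<in> alg_hom K D C"
        and e: "compose (carrier A) r f = compose (carrier A) f' u" using I'(2)[OF in'] by auto
      have "(C, compose (carrier A) f' u, arr X B C f' t) \<in> x" by (rule power_objD(4)[OF x z(2) C])
      then have "(C, r, arr X B C f' t) \<in> arr ?W A D f x" using r e by (simp add: power_arr)
      then have "(C, r, arr X B C f' t) \<in> arr ?W A D f y" using eq[OF Df] by simp
      then show "(C, compose (carrier A) f' u, arr X B C f' t) \<in> y" using e by (simp add: power_arr)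
    qed
    then show "z \<in> y" using z by simp
  qed
  fix A I x y assume h: "covers K A I" "x \<in> obj ?W A" "y \<in> obj ?W A"
    "\<And>B f. (B, f) \<in> I \<Longrightarrow> arr ?W A B f x = arr ?W A B f y"
  show "x = y" using half[OF h] half[OF h(1,3,2)] h(4) by (metis subset_antisym)
next
  let ?W = "power_fun K X"
  fix A I s assume cov: "covers K A I" and m: "matching K ?W A I s"
  note A = covers_alg[OF cov] and s = matchingD(1)[OF m]
  define O' where "O' = {(B, u, y). algebra K B \<and> u \<in> alg_hom K A B \<and> y \<in> obj X B \<and>
     (\<forall>D f C v w. (D, f) \<in> I \<and> algebra K C \<and> v \<in> alg_hom K D C \<and> w \<in> alg_hom K B C \<and>
        compose (carrier A) w u = compose (carrier A) v f \<longrightarrow> (C, v, arr X B C w y) \<in> s D f)}"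
  have OD: "algebra K B" "u \<in> alg_hom K A B" "y \<in> obj X B"
    "\<And>D f C v w. \<lbrakk>(D, f) \<in> I; algebra K C; v \<in> alg_hom K D C; w \<in> alg_hom K B C;
      compose (carrier A) w u = compose (carrier A) v f\<rbrakk> \<Longrightarrow> (C, v, arr X B C w y) \<in> s D f"
    if "(B, u, y) \<in> O'" for B u y using that unfolding O'_def by blast+
  have OI: "(B, u, y) \<in> O'" if "algebra K B" "u \<in> alg_hom K A B" "y \<in> obj X B"
    "\<And>D f C v w. \<lbrakk>(D, f) \<in> I; algebra K C; v \<in> alg_hom K D C; w \<in> alg_hom K B C;
      compose (carrier A) w u = compose (carrier A) v f\<rbrakk> \<Longrightarrow> (C, v, arr X B C w y) \<in> s D f" for B u y
    using that unfolding O'_def by blast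
  have "O' \<in> obj ?W A"
  proof (rule power_objI)
    fix B u y C w assume h: "(B, u, y) \<in> O'" and C: "algebra K C" and w: "w \<in> alg_hom K B C"
    note B = OD[OF h]
    show "(C, compose (carrier A) w u, arr X B C w y) \<in> O'"
    proof (rule OI[OF C alg_hom_compose[OF A(1) B(2) w] functorD(1)[OF X B(1) C w B(3)]])
      fix D f E v r assume Df: "(D, f) \<in> I" and E: "algebra K E" and v: "v \<in> alg_hom K D E" and r: "r \<in> alg_hom K C E"
        and e: "compose (carrier A) r (compose (carrier A) w u) = compose (carrier A) v f"
      have "(E, v, arr X B E (compose (carrier B) r w) y) \<in> s D f"
        by (rule B(4)[OF Df E v alg_hom_compose[OF B(1) w r]]) (use e compose_alg_assoc[OF B(2), of r w] in simp)
      then show "(E, v, arr X C E r (arr X B C w y)) \<in> s D f"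
        using functorD(3)[OF X B(1) C E w r B(3)] by simp
    qed
  next
    fix B u y J assume J: "covers K B J" and u: "u \<in> alg_hom K A B" and y: "y \<in> obj X B"
      and loc: "\<And>C f. (C, f) \<in> J \<Longrightarrow> (C, compose (carrier A) f u, arr X B C f y) \<in> O'"
    note B = covers_alg[OF J]
    show "(B, u, y) \<in> O'"
    proof (rule OI[OF B(1) u y])
      fix D f C v w assume Df: "(D, f) \<in> I" and C: "algebra K C" and v: "v \<in> alg_hom K D C" and w: "w \<in> alg_hom K B C"
        and e: "compose (carrier A) w u = compose (carrier A) v f"
      obtain J' where J': "covers K C J'"
        "\<And>B' f'. (B', f') \<in> J' \<Longrightarrow> \<exists>(E, k)\<in>J. \<exists>r\<in>alg_hom K E B'. compose (carrier B) r k = compose (carrier B) f' w"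
        using covers_pullback[OF inf J C w] by blast
      show "(C, v, arr X B C w y) \<in> s D f"
      proof (rule power_objD(5)[OF s[OF Df] J'(1) v functorD(1)[OF X B(1) C w y]])
        fix C' f' assume in': "(C', f') \<in> J'"
        note C' = covers_alg(2,3)[OF J'(1) in']
        obtain E k r where Ek: "(E, k) \<in> J" and r: "r \<in> alg_hom K E C'"
          and e2: "compose (carrier B) r k = compose (carrier B) f' w" using J'(2)[OF in'] by auto
        have "compose (carrier A) r (compose (carrier A) k u) = compose (carrier A) (compose (carrier B) f' w) u"
          using compose_alg_assoc[OF u, of r k] e2 by simp
        also have "\<dots> = compose (carrier A) f' (compose (carrier A) v f)"
          using compose_alg_assoc[OF u, of f' w] e by simp
        also have "\<dots> = compose (carrier A) (compose (carrier D) f' v) f"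
          by (rule compose_alg_assoc[OF A(3)[OF Df]])
        finally have "(C', compose (carrier D) f' v, arr X E C' r (arr X B E k y)) \<in> s D f"
          by (rule OD(4)[OF loc[OF Ek] Df C'(1) alg_hom_compose[OF A(2)[OF Df] v C'(2)] r])
        moreover have "arr X E C' r (arr X B E k y) = arr X C C' f' (arr X B C w y)"
          using functorD(3)[OF X B(1) B(2)[OF Ek] C'(1) B(3)[OF Ek] r y]
            functorD(3)[OF X B(1) C C'(1) w C'(2) y] e2 by simp
        ultimately show "(C', compose (carrier D) f' v, arr X C C' f' (arr X B C w y)) \<in> s D f" by simp
      qed
    qed
  qed (use OD in blast)
  moreover have "arr ?W A D f O' = s D f" if Df: "(D, f) \<in> I" for D f
  proof (rule Set.set_eqI)
    fix z :: "'u alg \<times> ('u \<Rightarrow> 'u) \<times> 'x"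
    obtain B u y where z: "z = (B, u, y)" by (cases z) auto
    show "z \<in> arr ?W A D f O' \<longleftrightarrow> z \<in> s D f"
    proof
      assume "z \<in> arr ?W A D f O'"
      then have u: "u \<in> alg_hom K D B" and h: "(B, compose (carrier A) u f, y) \<in> O'" by (auto simp: z power_arr)
      note B = OD[OF h]
      have "(B, u, arr X B B (\<lambda>b\<in>carrier B. b) y) \<in> s D f"
        by (rule B(4)[OF Df B(1) u alg_hom_id[OF B(1)]]) (rule compose_alg_id(2)[OF B(2)])
      then show "z \<in> s D f" using functorD(2)[OF X B(1,3)] z by simp
    next
      assume zs: "z \<in> s D f"
      note B = power_objD(1-3)[OF s[OF Df] zs[unfolded z]]
      have "(B, compose (carrier A) u f, y) \<in> O'"
      proof (rule OI[OF B(1) alg_hom_compose[OF A(1) A(3)[OF Df] B(2)] B(3)])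
        fix E k C v w assume Ek: "(E, k) \<in> I" and C: "algebra K C" and v: "v \<in> alg_hom K E C" and w: "w \<in> alg_hom K B C"
          and e: "compose (carrier A) w (compose (carrier A) u f) = compose (carrier A) v k"
        have wu: "compose (carrier D) w u \<in> alg_hom K D C" by (rule alg_hom_compose[OF A(2)[OF Df] B(2) w])
        have e': "compose (carrier A) (compose (carrier D) w u) f = compose (carrier A) v k"
          using e compose_alg_assoc[OF A(3)[OF Df], of w u] by simp
        have "(C, compose (carrier D) w u, arr X B C w y) \<in> s D f"
          using zs z power_objD(4)[OF s[OF Df] _ C w] by blast
        \<comment> \<open>Matching compares the restrictions of the two subsheaves to
          \<open>C\<close>, so membership is rewritten at the identity of \<open>C\<close> before it
          is carried from \<open>s D f\<close> to \<open>s E k\<close>.\<close>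
        then have "(C, (\<lambda>c\<in>carrier C. c), arr X B C w y) \<in> arr ?W D C (compose (carrier D) w u) (s D f)"
          using alg_hom_id[OF C] compose_alg_id(2)[OF wu] by (simp add: power_arr)
        then have "(C, (\<lambda>c\<in>carrier C. c), arr X B C w y) \<in> arr ?W E C v (s E k)"
          using matchingD(2)[OF m Df Ek C wu v e'] by simp
        then show "(C, v, arr X B C w y) \<in> s E k" using compose_alg_id(2)[OF v] by (simp add: power_arr)
      qed
      then show "z \<in> arr ?W A D f O'" using z B(2) by (simp add: power_arr)
    qed
  qed
  ultimately show "\<exists>x\<in>obj ?W A. \<forall>(B, f)\<in>I. arr ?W A B f x = s B f" by blast
qed

text \<open>\<open>X\<close> is a sheaf for \<open>covers\<close> with at most one section over the
  zero ring, and its values have a type of their own. In this form the results apply both to the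
  given \<open>X\<close> and to the product of \<open>X\<close> and \<open>X'\<close>, whose
  sections are pairs.\<close>

locale free_group_action =
  fixes K :: "'u ring" and G :: "('u, 'g) kfunctor" and m :: "'u alg \<Rightarrow> 'g \<Rightarrow> 'g \<Rightarrow> 'g" and e :: "'u alg \<Rightarrow> 'g"
    and X :: "('u, 'x) kfunctor" and a :: "'u alg \<Rightarrow> 'g \<Rightarrow> 'x \<Rightarrow> 'x"
  assumes inf: "infinite (UNIV :: 'u set)" and G: "group_faisceau K G m e"
    and X: "cov_sheaf K X" and Xz: "zero_subsingleton K X"
    and act: "group_faisceau_action K G m e X a" and free: "free_action K G e X a"
begin

lemma fX: "is_functor K X"
  by (rule cov_sheafD(1)[OF X])

lemma G_sheaf: "cov_sheaf K G"
  using G faisceau_cov_sheaf unfolding group_faisceau_def by blast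

lemma e_closed: "algebra K A \<Longrightarrow> e A \<in> obj G A"
  using G group.is_monoid monoid.one_closed unfolding group_faisceau_def by fastforce

lemma m_closed: "\<lbrakk>algebra K A; g \<in> obj G A; h \<in> obj G A\<rbrakk> \<Longrightarrow> m A g h \<in> obj G A"
  using G group.is_monoid monoid.m_closed unfolding group_faisceau_def by fastforce

lemma inverse_ex: "\<lbrakk>algebra K A; g \<in> obj G A\<rbrakk> \<Longrightarrow> \<exists>h\<in>obj G A. m A h g = e A \<and> m A g h = e A"
proof -
  assume A: "algebra K A" "g \<in> obj G A"
  interpret group "\<lparr>carrier = obj G A, monoid.mult = m A, one = e A\<rparr>"
    using G A(1) unfolding group_faisceau_def by blast
  show ?thesis using A(2) inv_closed[of g] l_inv[of g] r_inv[of g] by auto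
qed

lemma act_closed: "\<lbrakk>algebra K A; g \<in> obj G A; x \<in> obj X A\<rbrakk> \<Longrightarrow> a A g x \<in> obj X A"
  and act_nat: "\<lbrakk>algebra K A; algebra K B; f \<in> alg_hom K A B; g \<in> obj G A; x \<in> obj X A\<rbrakk>
      \<Longrightarrow> arr X A B f (a A g x) = a B (arr G A B f g) (arr X A B f x)"
proof -
  have n: "nat_trans K (prod_fun G X) X (\<lambda>A (g, x). a A g x)"
    using act unfolding group_faisceau_action_def by blast
  show "\<lbrakk>algebra K A; g \<in> obj G A; x \<in> obj X A\<rbrakk> \<Longrightarrow> a A g x \<in> obj X A"
    using nat_transD(1)[OF n, of A "(g, x)"] by (simp add: prod_fun_def)
  show "\<lbrakk>algebra K A; algebra K B; f \<in> alg_hom K A B; g \<in> obj G A; x \<in> obj X A\<rbrakk>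
      \<Longrightarrow> arr X A B f (a A g x) = a B (arr G A B f g) (arr X A B f x)"
    using nat_transD(2)[OF n, of A B f "(g, x)"] by (simp add: prod_fun_def)
qed

lemma act_e: "\<lbrakk>algebra K A; x \<in> obj X A\<rbrakk> \<Longrightarrow> a A (e A) x = x"
  and act_m: "\<lbrakk>algebra K A; g \<in> obj G A; h \<in> obj G A; x \<in> obj X A\<rbrakk> \<Longrightarrow> a A (m A g h) x = a A g (a A h x)"
  using act unfolding group_faisceau_action_def by blast+

lemma act_inj:
  assumes "algebra K A" "g \<in> obj G A" "h \<in> obj G A" "x \<in> obj X A" "a A g x = a A h x"
  shows "g = h"
proof -
  obtain k where k: "k \<in> obj G A" "m A k h = e A" "m A h k = e A" using inverse_ex assms(1,3) by blast
  have "a A (m A k g) x = x"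
    using assms k act_m[of A k g x] act_m[of A k h x] act_e by simp
  then have kg: "m A k g = e A"
    using free assms k m_closed unfolding free_action_def by blast
  interpret group "\<lparr>carrier = obj G A, monoid.mult = m A, one = e A\<rparr>"
    using G assms(1) unfolding group_faisceau_def by blast
  show ?thesis using inv_unique[of h k g] kg k assms(2,3) by simp
qed

section \<open>Orbits of sections as subsheaves\<close>

definition orb :: "'u alg \<Rightarrow> 'x \<Rightarrow> ('u alg \<times> ('u \<Rightarrow> 'u) \<times> 'x) set" where
  "orb A x = {(B, u, y). algebra K B \<and> u \<in> alg_hom K A B \<and> (\<exists>g\<in>obj G B. y = a B g (arr X A B u x))}"

text \<open>Stability under restriction is naturality of the action. For locality, a section that is
  locally in the orbit of \<open>x\<close> is locally a translate of \<open>x\<close> by group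
  elements that are unique by freeness; they therefore match, and glue because \<open>G\<close> is a
  sheaf.\<close>

lemma orb_obj:
  assumes A: "algebra K A" "x \<in> obj X A"
  shows "orb A x \<in> obj (power_fun K X) A"
proof (rule power_objI)
  fix B u y assume "(B, u, y) \<in> orb A x"
  then show "algebra K B \<and> u \<in> alg_hom K A B \<and> y \<in> obj X B"
    using act_closed functorD(1)[OF fX] A by (auto simp: orb_def)
next
  fix B u y C w assume "(B, u, y) \<in> orb A x" and C: "algebra K C" and w: "w \<in> alg_hom K B C"
  then obtain g where B: "algebra K B" "u \<in> alg_hom K A B" and g: "g \<in> obj G B" "y = a B g (arr X A B u x)"
    by (auto simp: orb_def)
  have "arr X B C w y = a C (arr G B C w g) (arr X A C (compose (carrier A) w u) x)"
    using act_nat[OF B(1) C w g(1) functorD(1)[OF fX A(1) B A(2)]] functorD(3)[OF fX A(1) B(1) C B(2) w A(2)] g by simp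
  then show "(C, compose (carrier A) w u, arr X B C w y) \<in> orb A x"
    using C alg_hom_compose[OF A(1) B(2) w] functorD(1)[OF cov_sheafD(1)[OF G_sheaf] B(1) C w g(1)]
    by (auto simp: orb_def)
next
  fix B u y I assume cov: "covers K B I" and u: "u \<in> alg_hom K A B" and y: "y \<in> obj X B"
    and loc: "\<And>C f. (C, f) \<in> I \<Longrightarrow> (C, compose (carrier A) f u, arr X B C f y) \<in> orb A x"
  note B = covers_alg[OF cov] and fG = cov_sheafD(1)[OF G_sheaf]
  let ?x = "arr X A B u x"
  have x': "?x \<in> obj X B" by (rule functorD(1)[OF fX A(1) B(1) u A(2)])
  have "\<exists>g\<in>obj G C. arr X B C f y = a C g (arr X B C f ?x)" if "(C, f) \<in> I" for C f
    using loc[OF that] functorD(3)[OF fX A(1) B(1) B(2)[OF that] u B(3)[OF that] A(2)] by (auto simp: orb_def)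
  then obtain s where s: "\<And>C f. (C, f) \<in> I \<Longrightarrow> s C f \<in> obj G C"
    "\<And>C f. (C, f) \<in> I \<Longrightarrow> arr X B C f y = a C (s C f) (arr X B C f ?x)" by metis
  have sD: "arr X B D (compose (carrier B) v f) y = a D (arr G C D v (s C f)) (arr X B D (compose (carrier B) v f) ?x)"
    if C: "(C, f) \<in> I" and D: "algebra K D" "v \<in> alg_hom K C D" for C f D v
  proof -
    note f = B(2,3)[OF C]
    have "arr X C D v (arr X B C f y) = a D (arr G C D v (s C f)) (arr X C D v (arr X B C f ?x))"
      unfolding s(2)[OF C] by (rule act_nat[OF f(1) D s(1)[OF C] functorD(1)[OF fX B(1) f x']])
    then show ?thesis
      using functorD(3)[OF fX B(1) f(1) D(1) f(2) D(2) y] functorD(3)[OF fX B(1) f(1) D(1) f(2) D(2) x'] by simp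
  qed
  have "matching K G B I s"
  proof (rule matchingI[OF s(1)], assumption)
    fix C f C' f' D v w assume C: "(C, f) \<in> I" and C': "(C', f') \<in> I" and D: "algebra K D"
      and v: "v \<in> alg_hom K C D" and w: "w \<in> alg_hom K C' D" and eq: "compose (carrier B) v f = compose (carrier B) w f'"
    show "arr G C D v (s C f) = arr G C' D w (s C' f')"
    proof (rule act_inj[OF D])
      show "arr G C D v (s C f) \<in> obj G D" by (rule functorD(1)[OF fG B(2)[OF C] D v s(1)[OF C]])
      show "arr G C' D w (s C' f') \<in> obj G D" by (rule functorD(1)[OF fG B(2)[OF C'] D w s(1)[OF C']])
      show "arr X B D (compose (carrier B) v f) ?x \<in> obj X D"
        by (rule functorD(1)[OF fX B(1) D alg_hom_compose[OF B(1) B(3)[OF C] v] x'])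
      show "a D (arr G C D v (s C f)) (arr X B D (compose (carrier B) v f) ?x) =
          a D (arr G C' D w (s C' f')) (arr X B D (compose (carrier B) v f) ?x)"
        using sD[OF C D v] sD[OF C' D w] eq by simp
    qed
  qed
  then obtain g where g: "g \<in> obj G B" "\<And>C f. (C, f) \<in> I \<Longrightarrow> arr G B C f g = s C f"
    using cov_sheafD(3)[OF G_sheaf cov] by blast
  have "y = a B g ?x"
  proof (rule cov_sheafD(2)[OF X cov y act_closed[OF B(1) g(1) x']])
    fix C f assume C: "(C, f) \<in> I"
    show "arr X B C f y = arr X B C f (a B g ?x)"
      using act_nat[OF B(1) B(2)[OF C] B(3)[OF C] g(1) x'] s(2)[OF C] g(2)[OF C] by simp
  qed
  then show "(B, u, y) \<in> orb A x" using B(1) u g(1) by (auto simp: orb_def)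
qed

lemma orb_act_subset:
  assumes A: "algebra K A" "g \<in> obj G A" "x \<in> obj X A"
  shows "orb A (a A g x) \<subseteq> orb A x"
proof
  fix z assume "z \<in> orb A (a A g x)"
  then obtain B u y h where z: "z = (B, u, y)" and B: "algebra K B" "u \<in> alg_hom K A B"
    and h: "h \<in> obj G B" "y = a B h (arr X A B u (a A g x))" by (auto simp: orb_def)
  have g': "arr G A B u g \<in> obj G B" by (rule functorD(1)[OF cov_sheafD(1)[OF G_sheaf] A(1) B A(2)])
  have "y = a B (m B h (arr G A B u g)) (arr X A B u x)"
    using h act_nat[OF A(1) B A(2,3)] act_m[OF B(1) h(1) g' functorD(1)[OF fX A(1) B A(3)]] by simp
  then show "z \<in> orb A x" using z B m_closed[OF B(1) h(1) g'] by (auto simp: orb_def)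
qed

lemma orb_act:
  assumes A: "algebra K A" "g \<in> obj G A" "x \<in> obj X A"
  shows "orb A (a A g x) = orb A x"
proof
  show "orb A (a A g x) \<subseteq> orb A x" by (rule orb_act_subset[OF A])
  obtain h where h: "h \<in> obj G A" "m A h g = e A" using inverse_ex A by blast
  have "a A h (a A g x) = x" using act_m[OF A(1) h(1) A(2,3)] h(2) act_e A by simp
  then show "orb A x \<subseteq> orb A (a A g x)" using orb_act_subset[OF A(1) h(1) act_closed[OF A]] by simp
qed

lemma orb_nat: "nat_trans K X (power_fun K X) orb"
proof (rule nat_transI[OF orb_obj], assumption, assumption)
  fix A B f x assume A: "algebra K A" "algebra K B" "f \<in> alg_hom K A B" "x \<in> obj X A"
  show "orb B (arr X A B f x) = arr (power_fun K X) A B f (orb A x)"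
  proof (rule Set.set_eqI)
    fix z :: "'u alg \<times> ('u \<Rightarrow> 'u) \<times> 'x"
    obtain C u y where z: "z = (C, u, y)" by (cases z) auto
    show "z \<in> orb B (arr X A B f x) \<longleftrightarrow> z \<in> arr (power_fun K X) A B f (orb A x)"
      using functorD(3)[OF fX A(1,2) _ A(3) _ A(4), of C u] alg_hom_compose[OF A(1,3), of u C]
      by (auto simp: z power_arr orb_def)
  qed
qed

text \<open>The power object may have several sections over the zero ring, such as the empty and the
  full subsheaf. A generated one is full there, because all algebras over the zero ring are zero and
  \<open>X\<close> has at most one section over each. This is what makes the generated subsheaf,
  once coded, a faisceau.\<close>

lemma gen_orb_zero:
  assumes "gen K X (power_fun K X) orb A O'" "\<one>\<^bsub>A\<^esub> = \<zero>\<^bsub>A\<^esub>"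
  shows "O' = {(B, u, y). algebra K B \<and> u \<in> alg_hom K A B \<and> y \<in> obj X B}"
  using assms
proof induction
  case (image A x)
  have "\<exists>g\<in>obj G B. y = a B g (arr X A B u x)" if B: "algebra K B" "u \<in> alg_hom K A B" "y \<in> obj X B" for B u y
  proof -
    have x': "arr X A B u x \<in> obj X B" by (rule functorD(1)[OF fX image(1) B(1,2) image(2)])
    have "\<one>\<^bsub>B\<^esub> = \<zero>\<^bsub>B\<^esub>" by (rule zero_algebra_hom[OF image(1) B(1,2) image(3)])
    then have "y = arr X A B u x" using Xz B x' unfolding zero_subsingleton_def by blast
    then show ?thesis using e_closed[OF B(1)] act_e[OF B(1) x'] by force
  qed
  then have "(B, u, y) \<in> orb A x" if "algebra K B" "u \<in> alg_hom K A B" "y \<in> obj X B" for B u y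
    using that unfolding orb_def by blast
  moreover have "algebra K B \<and> u \<in> alg_hom K A B \<and> y \<in> obj X B" if "(B, u, y) \<in> orb A x" for B u y
    using power_objD(1-3)[OF orb_obj[OF image(1,2)] that] by blast
  ultimately show ?case by fast
next
  case (local A I O')
  note A = covers_alg[OF local(1)]
  have "(B, u, y) \<in> O'" if B: "algebra K B" "u \<in> alg_hom K A B" "y \<in> obj X B" for B u y
  proof -
    obtain I' where I': "covers K B I'"
      "\<And>B' f'. (B', f') \<in> I' \<Longrightarrow> \<exists>(D, f)\<in>I. \<exists>t\<in>alg_hom K D B'. compose (carrier A) t f = compose (carrier A) f' u"
      using covers_pullback[OF inf local(1) B(1,2)] by blast
    show ?thesis
    proof (rule power_objD(5)[OF local(2) I'(1) B(2,3)])
      fix C f' assume in': "(C, f') \<in> I'"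
      note C = covers_alg(2,3)[OF I'(1) in']
      obtain D f t where Df: "(D, f) \<in> I" and t: "t \<in> alg_hom K D C"
        and eq: "compose (carrier A) t f = compose (carrier A) f' u" using I'(2)[OF in'] by auto
      have "\<one>\<^bsub>D\<^esub> = \<zero>\<^bsub>D\<^esub>" by (rule zero_algebra_hom[OF A(1) A(2)[OF Df] A(3)[OF Df] local(5)])
      then have "(C, t, arr X B C f' y) \<in> arr (power_fun K X) A D f O'"
        using local(4)[OF Df] C(1) t functorD(1)[OF fX B(1) C B(3)] by auto
      then show "(C, compose (carrier A) f' u, arr X B C f' y) \<in> O'" using eq by (simp add: power_arr)
    qed
  qed
  moreover have "algebra K B \<and> u \<in> alg_hom K A B \<and> y \<in> obj X B" if "(B, u, y) \<in> O'" for B u y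
    using power_objD(1-3)[OF local(2) that] by blast
  ultimately show ?case by fast
qed

text \<open>The orbit map separates orbits. Its target is too large to take part in the universal property
  of the quotient, but the subsheaf that it generates is not.\<close>

lemma quotient_effective:
  fixes Q :: "('u, 'v) kfunctor" and \<iota> :: "'u set \<Rightarrow> 'v" and k :: "'x \<Rightarrow> 'v"
  assumes \<iota>: "inj \<iota>" and k: "inj k" and quo: "quotient_faisceau K G X a Q \<pi>"
    and A: "algebra K A" and x: "x \<in> obj X A" and y: "y \<in> obj X A" and eq: "\<pi> A x = \<pi> A y"
  shows "\<exists>g\<in>obj G A. y = a A g x"
proof -
  let ?W = "power_fun K X"
  let ?V = "gen_fun K X ?W orb"
  note W = power_sheaf[OF inf fX]
  have V: "cov_sheaf K ?V" by (rule gen_fun_sheaf[OF inf fX W orb_nat])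
  have Vz: "zero_subsingleton K ?V"
    unfolding zero_subsingleton_def
  proof (intro allI impI ballI)
    fix A O1 O2 assume "algebra K A \<and> \<one>\<^bsub>A\<^esub> = \<zero>\<^bsub>A\<^esub>" "O1 \<in> obj ?V A" "O2 \<in> obj ?V A"
    then show "O1 = O2" using gen_orb_zero[of A O1] gen_orb_zero[of A O2] by (simp add: gen_fun_def)
  qed
  obtain j :: "('u alg \<times> 'x) + ('u alg \<times> ('u alg \<times> ('u \<Rightarrow> 'u)) \<times> ('u alg \<times> ('u \<Rightarrow> 'u)) \<times> 'v \<times> 'v) \<Rightarrow> 'v"
    where "inj j" using code_injection[OF inf \<iota> k] by blast
  then obtain enc :: "'u alg \<Rightarrow> ('u alg \<times> ('u \<Rightarrow> 'u) \<times> 'x) set \<Rightarrow> 'v" where enc: "\<And>A. inj_on (enc A) (obj ?V A)"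
    using gen_fun_embeds[OF _ W] by blast
  let ?T = "transport_fun enc ?V"
  note T = transport_faisceau[OF V Vz enc]
  have n: "nat_trans K X ?T (nat_comp enc orb)"
    by (rule nat_trans_comp[OF gen_fun_nat[OF orb_nat] T(2)])
  have const: "nat_eq K (prod_fun G X) (nat_comp (nat_comp enc orb) (\<lambda>A (g, x). a A g x))
      (nat_comp (nat_comp enc orb) (\<lambda>A (g, x). x))"
    by (auto simp: nat_eq_def nat_comp_def prod_fun_def orb_act)
  obtain h where h: "nat_eq K X (nat_comp h \<pi>) (nat_comp enc orb)"
    using quo T(1) n const unfolding quotient_faisceau_def is_coequaliser_def by blast
  have "enc A (orb A x) = enc A (orb A y)"
    using h A x y eq unfolding nat_eq_def nat_comp_def by metis
  moreover have "orb A x \<in> obj ?V A" "orb A y \<in> obj ?V A"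
    using gen.image[OF A] x y by (auto simp: gen_fun_def)
  ultimately have "orb A x = orb A y" using inj_onD[OF enc] by blast
  \<comment> \<open>\<open>y\<close> lies in its own orbit through the unit of \<open>G\<close> and
    the identity of \<open>A\<close>. As the orbits coincide it also lies in the orbit of
    \<open>x\<close>, which provides the group element.\<close>
  moreover have "(A, (\<lambda>b\<in>carrier A. b), y) \<in> orb A y"
    using A alg_hom_id[OF A] e_closed[OF A] act_e[OF A y] functorD(2)[OF fX A y] by (force simp: orb_def)
  ultimately have "(A, (\<lambda>b\<in>carrier A. b), y) \<in> orb A x" by simp
  then show ?thesis using functorD(2)[OF fX A x] by (auto simp: orb_def)
qed

end

section \<open>Associated fibrations\<close>

lemma prod_functor: "\<lbrakk>is_functor K F; is_functor K F'\<rbrakk> \<Longrightarrow> is_functor K (prod_fun F F')"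
  unfolding is_functor_def prod_fun_def by (auto simp: Pi_def)

lemma prod_sheaf:
  assumes F: "cov_sheaf K F" and F': "cov_sheaf K F'"
  shows "cov_sheaf K (prod_fun F F')"
proof (rule cov_sheafI[OF prod_functor[OF cov_sheafD(1)[OF F] cov_sheafD(1)[OF F']]])
  fix A I x y
  assume h: "covers K A I" "x \<in> obj (prod_fun F F') A" "y \<in> obj (prod_fun F F') A"
    "\<And>B f. (B, f) \<in> I \<Longrightarrow> arr (prod_fun F F') A B f x = arr (prod_fun F F') A B f y"
  have "arr F A B f (fst x) = arr F A B f (fst y)" "arr F' A B f (snd x) = arr F' A B f (snd y)" if "(B, f) \<in> I" for B f
    using h(4)[OF that] by (cases x; cases y; simp add: prod_fun_def)+
  then have "fst x = fst y" "snd x = snd y"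
    using cov_sheafD(2)[OF F h(1)] cov_sheafD(2)[OF F' h(1)] h(2,3) by (auto simp: prod_fun_def)
  then show "x = y" by (simp add: prod_eq_iff)
next
  fix A I s assume cov: "covers K A I" and m: "matching K (prod_fun F F') A I s"
  have s: "s B f \<in> obj F B \<times> obj F' B" if "(B, f) \<in> I" for B f
    using matchingD(1)[OF m that] by (simp add: prod_fun_def)
  have ms: "arr F B D v (fst (s B f)) = arr F C D w (fst (s C g)) \<and> arr F' B D v (snd (s B f)) = arr F' C D w (snd (s C g))"
    if "(B, f) \<in> I" "(C, g) \<in> I" "algebra K D" "v \<in> alg_hom K B D" "w \<in> alg_hom K C D"
      "compose (carrier A) v f = compose (carrier A) w g" for B f C g D v w
    using matchingD(2)[OF m that] by (cases "s B f"; cases "s C g"; simp add: prod_fun_def)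
  have "matching K F A I (\<lambda>B f. fst (s B f))" "matching K F' A I (\<lambda>B f. snd (s B f))"
    by (rule matchingI; use s ms in \<open>blast | fastforce simp: mem_Times_iff\<close>)+
  then obtain x y where "x \<in> obj F A" "y \<in> obj F' A" "\<forall>(B, f)\<in>I. arr F A B f x = fst (s B f)"
    "\<forall>(B, f)\<in>I. arr F' A B f y = snd (s B f)"
    using cov_sheafD(3)[OF F cov] cov_sheafD(3)[OF F' cov] by blast
  then show "\<exists>x\<in>obj (prod_fun F F') A. \<forall>(B, f)\<in>I. arr (prod_fun F F') A B f x = s B f"
    by (intro bexI[of _ "(x, y)"]) (fastforce simp: prod_fun_def)+
qed

lemma prod_zero: "\<lbrakk>zero_subsingleton K F; zero_subsingleton K F'\<rbrakk> \<Longrightarrow> zero_subsingleton K (prod_fun F F')"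
  unfolding zero_subsingleton_def prod_fun_def by auto

theorem lemma4p5:
  fixes K :: "'u ring"
    and G X X' Q Z :: "('u, 'v) kfunctor"
    and m :: "'u alg \<Rightarrow> 'v \<Rightarrow> 'v \<Rightarrow> 'v"
    and e :: "'u alg \<Rightarrow> 'v"
    and a a' :: "'u alg \<Rightarrow> 'v \<Rightarrow> 'v \<Rightarrow> 'v"
    and \<pi> :: "('u, 'v, 'v) nat_map"
  assumes "infinite (UNIV :: 'u set)"
    and "\<exists>\<iota> :: 'u set \<Rightarrow> 'v. inj \<iota>"
    and "field K"
    and "group_faisceau K G m e"
    and "faisceau K X" and "faisceau K X'"
    and "group_faisceau_action K G m e X a"
    and "group_faisceau_action K G m e X' a'"
    and "free_action K G e X a"
    and "quotient_faisceau K G X a Q \<pi>"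
    and "faisceau K Z"
  shows "(\<exists>(E :: ('u, 'v) kfunctor) \<rho>.
            associated_fibration K G X a X' a' E \<rho> \<and> isomorphic K Z E)
         \<longleftrightarrow>
         (\<exists>\<phi> q. nat_trans K (prod_fun X X') Z \<phi> \<and> nat_trans K Z Q q \<and>
            nat_eq K (prod_fun X X') (nat_comp q \<phi>) (nat_comp \<pi> (\<lambda>A (x, x'). x)) \<and>
            constant_on_orbits K G X a X' a' \<phi> \<and>
            nat_iso K (prod_fun X X') (fibre_prod X \<pi> Z q) (\<lambda>A (x, x'). (x, \<phi> A (x, x'))))"
proof -
  note inf = assms(1)
  obtain \<iota> :: "'u set \<Rightarrow> 'v" where \<iota>: "inj \<iota>" using assms(2) by blast
  note X = faisceau_cov_sheaf[OF assms(5)] and X' = faisceau_cov_sheaf[OF assms(6)]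
  note fX = cov_sheafD(1)[OF X] and fX' = cov_sheafD(1)[OF X']
  note Z = faisceau_cov_sheaf[OF assms(11)]
  note fZ = cov_sheafD(1)[OF Z]
  have Q: "faisceau K Q" and \<pi>: "nat_trans K X Q \<pi>"
    and \<pi>_const: "nat_eq K (prod_fun G X) (nat_comp \<pi> (\<lambda>A (g, x). a A g x)) (nat_comp \<pi> (\<lambda>A (g, x). x))"
    using assms(10) unfolding quotient_faisceau_def is_coequaliser_def by blast+
  have \<pi>_act: "\<pi> A (a A g x) = \<pi> A x" if "algebra K A" "g \<in> obj G A" "x \<in> obj X A" for A g x
    using \<pi>_const that unfolding nat_eq_def nat_comp_def prod_fun_def by fastforce
  interpret GX: free_group_action K G m e X a
    using assms X faisceau_zero by (intro free_group_action.intro) auto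
  let ?Y = "prod_fun X X'"
  let ?d = "\<lambda>A g (x, x'). (a A g x, a' A g x')"
  let ?mor = "\<lambda>\<phi> A (x, x'). (x, \<phi> A (x, x'))"
  have objY: "obj ?Y A = obj X A \<times> obj X' A" for A :: "'u alg" by (simp add: prod_fun_def)
  have arrY: "arr ?Y A B f (x, x') = (arr X A B f x, arr X' A B f x')" for A B :: "'u alg" and f x x'
    by (simp add: prod_fun_def)
  note Y = prod_sheaf[OF X X']
  note fY = cov_sheafD(1)[OF Y]
  have act': "group_faisceau_action K G m e ?Y ?d"
    unfolding group_faisceau_action_def
  proof (intro conjI allI impI)
    have n: "nat_trans K (prod_fun G X) X (\<lambda>A (g, x). a A g x)" "nat_trans K (prod_fun G X') X' (\<lambda>A (g, x). a' A g x)"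
      using assms(7,8) unfolding group_faisceau_action_def by blast+
    show "nat_trans K (prod_fun G ?Y) ?Y (\<lambda>A (g, x). ?d A g x)"
    proof (rule nat_transI)
      fix A :: "'u alg" and z assume A: "algebra K A" and "z \<in> obj (prod_fun G ?Y) A"
      then obtain g x x' where z: "z = (g, x, x')" "g \<in> obj G A" "x \<in> obj X A" "x' \<in> obj X' A"
        by (auto simp: prod_fun_def)
      then show "(case z of (g, x) \<Rightarrow> ?d A g x) \<in> obj ?Y A"
        using nat_transD(1)[OF n(1) A, of "(g, x)"] nat_transD(1)[OF n(2) A, of "(g, x')"] by (simp add: prod_fun_def)
      fix B f assume B: "algebra K B" "f \<in> alg_hom K A B"
      show "(case arr (prod_fun G ?Y) A B f z of (g, x) \<Rightarrow> ?d B g x) = arr ?Y A B f (case z of (g, x) \<Rightarrow> ?d A g x)"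
        using z nat_transD(2)[OF n(1) A B, of "(g, x)"] nat_transD(2)[OF n(2) A B, of "(g, x')"] by (simp add: prod_fun_def)
    qed
    fix A :: "'u alg" assume A: "algebra K A"
    show "\<forall>x\<in>obj ?Y A. ?d A (e A) x = x \<and> (\<forall>g\<in>obj G A. \<forall>h\<in>obj G A. ?d A (m A g h) x = ?d A g (?d A h x))"
      using assms(7,8) A unfolding group_faisceau_action_def objY by auto
  qed
  \<comment> \<open>The diagonal action is free because the action on the first factor is.\<close>
  interpret GY: free_group_action K G m e ?Y ?d
  proof (rule free_group_action.intro[OF inf assms(4) Y _ act'])
    show "zero_subsingleton K ?Y" using assms(5,6) by (intro prod_zero faisceau_zero)
    show "free_action K G e ?Y ?d" using assms(9) unfolding free_action_def objY by auto
  qed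
  have "inj (\<lambda>x :: 'u. \<iota> {x})" using \<iota> by (auto simp: inj_def)
  then have "infinite (UNIV :: 'v set)" using inf by (metis finite_imageD finite_subset subset_UNIV)
  \<comment> \<open>Sections of the product are pairs; coding pairs in \<open>'v\<close> makes
    \<open>quotient_effective\<close> applicable to them.\<close>
  then obtain pr :: "'v \<times> 'v \<Rightarrow> 'v" where pr: "inj pr" using infinite_inj_pair by blast
  show ?thesis
  proof
    assume "\<exists>(E :: ('u, 'v) kfunctor) \<rho>. associated_fibration K G X a X' a' E \<rho> \<and> isomorphic K Z E"
    then obtain E :: "('u, 'v) kfunctor" and \<rho> \<eta> where quo: "quotient_faisceau K G ?Y ?d E \<rho>"
      and \<eta>: "nat_iso K Z E \<eta>" unfolding associated_fibration_def isomorphic_def by blast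
    note co = quo[unfolded quotient_faisceau_def]
    have E: "faisceau K E" and \<rho>: "nat_trans K ?Y E \<rho>"
      and \<rho>_const: "nat_eq K (prod_fun G ?Y) (nat_comp \<rho> (\<lambda>A (g, x). ?d A g x)) (nat_comp \<rho> (\<lambda>A (g, x). x))"
      using co unfolding is_coequaliser_def by blast+
    note Es = faisceau_cov_sheaf[OF E]
    note fE = cov_sheafD(1)[OF Es]
    have ls: "locally_surjective K ?Y E \<rho>" by (rule coequaliser_locally_surjective[OF inf fY co])
    obtain \<theta> where \<theta>: "nat_trans K E Z \<theta>" and \<theta>\<eta>: "nat_eq K Z (nat_comp \<theta> \<eta>) (\<lambda>A x. x)"
      and \<eta>\<theta>: "nat_eq K E (nat_comp \<eta> \<theta>) (\<lambda>A y. y)" and \<eta>n: "nat_trans K Z E \<eta>"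
      using \<eta> unfolding nat_iso_def by blast
    have \<rho>_act: "\<rho> A (a A g x, a' A g x') = \<rho> A (x, x')"
      if "algebra K A" "g \<in> obj G A" "x \<in> obj X A" "x' \<in> obj X' A" for A g x x'
      using \<rho>_const that unfolding nat_eq_def nat_comp_def prod_fun_def by fastforce
    have pfst: "nat_trans K ?Y Q (nat_comp \<pi> (\<lambda>A (x, x'). x))"
      by (rule nat_transI) (use nat_transD[OF \<pi>] in \<open>auto simp: objY arrY nat_comp_def\<close>)
    have pconst: "nat_eq K (prod_fun G ?Y) (nat_comp (nat_comp \<pi> (\<lambda>A (x, x'). x)) (\<lambda>A (g, x). ?d A g x))
        (nat_comp (nat_comp \<pi> (\<lambda>A (x, x'). x)) (\<lambda>A (g, x). x))"
      by (auto simp: nat_eq_def nat_comp_def prod_fun_def \<pi>_act)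
    \<comment> \<open>The structure map of the associated fibration over \<open>Q\<close>, induced
      by the first projection.\<close>
    obtain q0 where q0: "nat_trans K E Q q0" and q0\<rho>: "nat_eq K ?Y (nat_comp q0 \<rho>) (nat_comp \<pi> (\<lambda>A (x, x'). x))"
      using co Q pfst pconst unfolding is_coequaliser_def by blast
    have q0D: "q0 A (\<rho> A (x, x')) = \<pi> A x" if "algebra K A" "x \<in> obj X A" "x' \<in> obj X' A" for A x x'
      using q0\<rho> that unfolding nat_eq_def nat_comp_def objY by fastforce
    \<comment> \<open>By effectivity of the quotient of the product, the two points differ by some
      \<open>g\<close>. It fixes \<open>x\<close>, so it is the unit by freeness.\<close>
    have \<rho>_inj: "x' = y'" if A: "algebra K A" "x \<in> obj X A" "x' \<in> obj X' A" "y' \<in> obj X' A"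
      and eq: "\<rho> A (x, x') = \<rho> A (x, y')" for A x x' y'
    proof -
      obtain g where g: "g \<in> obj G A" "(x, y') = ?d A g (x, x')"
        using GY.quotient_effective[OF \<iota> pr quo A(1) _ _ eq] A by (auto simp: objY)
      then have "a A g x = x" by simp
      then have "g = e A" using assms(9) A(1,2) g(1) unfolding free_action_def by blast
      then show ?thesis using g(2) assms(8) A unfolding group_faisceau_action_def by auto
    qed
    \<comment> \<open>Surjectivity onto the part of \<open>E\<close> over \<open>\<pi> A x\<close>,
      by induction over the tree of covers. Local solutions are unique by \<open>\<rho>_inj\<close>,
      so they match and glue in \<open>X'\<close>.\<close>
    have sur: "\<forall>x\<in>obj X A. \<pi> A x = q0 A c \<longrightarrow> (\<exists>x'\<in>obj X' A. \<rho> A (x, x') = c)" if "gen K ?Y E \<rho> A c" for A c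
      using that
    proof induction
      case (image A z)
      obtain y y' where z: "z = (y, y')" "y \<in> obj X A" "y' \<in> obj X' A" using image(2) by (auto simp: objY)
      show ?case
      proof (intro ballI impI)
        fix x assume x: "x \<in> obj X A" "\<pi> A x = q0 A (\<rho> A z)"
        then have "\<pi> A y = \<pi> A x" using q0D image(1) z by simp
        \<comment> \<open>Points of \<open>X\<close> with the same image in \<open>Q\<close> are
          translates of each other. Sections of \<open>X\<close> already lie in \<open>'v\<close>,
          so the identity serves as their coding.\<close>
        then obtain g where g: "g \<in> obj G A" "x = a A g y"
          using GX.quotient_effective[OF \<iota> inj_on_id2 assms(10) image(1) z(2) x(1)] by blast
        have "a' A g y' \<in> obj X' A"
          using GY.act_closed[OF image(1) g(1), of "(y, y')"] z by (simp add: objY)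
        then show "\<exists>x'\<in>obj X' A. \<rho> A (x, x') = \<rho> A z"
          using \<rho>_act[OF image(1) g(1) z(2,3)] g z by auto
      qed
    next
      case (local A I c)
      note A = covers_alg[OF local(1)]
      show ?case
      proof (intro ballI impI)
        fix x assume x: "x \<in> obj X A" "\<pi> A x = q0 A c"
        have xr: "arr X A B f x \<in> obj X B" if "(B, f) \<in> I" for B f
          by (rule functorD(1)[OF fX A(1) A(2)[OF that] A(3)[OF that] x(1)])
        have "\<exists>x'\<in>obj X' B. \<rho> B (arr X A B f x, x') = arr E A B f c" if B: "(B, f) \<in> I" for B f
          using local(4)[OF B] xr[OF B] x nat_transD(2)[OF \<pi> A(1) A(2)[OF B] A(3)[OF B] x(1)]
            nat_transD(2)[OF q0 A(1) A(2)[OF B] A(3)[OF B] local(2)] by simp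
        then obtain s where s: "\<And>B f. (B, f) \<in> I \<Longrightarrow> s B f \<in> obj X' B"
          "\<And>B f. (B, f) \<in> I \<Longrightarrow> \<rho> B (arr X A B f x, s B f) = arr E A B f c" by metis
        have sD: "\<rho> D (arr X A D (compose (carrier A) v f) x, arr X' B D v (s B f)) = arr E A D (compose (carrier A) v f) c"
          if B: "(B, f) \<in> I" and D: "algebra K D" "v \<in> alg_hom K B D" for B f D v
          using nat_transD(2)[OF \<rho> A(2)[OF B] D, of "(arr X A B f x, s B f)"] s[OF B] xr[OF B]
            functorD(3)[OF fX A(1) A(2)[OF B] D(1) A(3)[OF B] D(2) x(1)]
            functorD(3)[OF fE A(1) A(2)[OF B] D(1) A(3)[OF B] D(2) local(2)] by (simp add: objY arrY)
        have "matching K X' A I s"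
        proof (rule matchingI[OF s(1)], assumption)
          fix B f C g D v w assume B: "(B, f) \<in> I" and C: "(C, g) \<in> I" and D: "algebra K D"
            and v: "v \<in> alg_hom K B D" and w: "w \<in> alg_hom K C D"
            and eq: "compose (carrier A) v f = compose (carrier A) w g"
          show "arr X' B D v (s B f) = arr X' C D w (s C g)"
          proof (rule \<rho>_inj[OF D])
            show "arr X A D (compose (carrier A) v f) x \<in> obj X D"
              by (rule functorD(1)[OF fX A(1) D alg_hom_compose[OF A(1) A(3)[OF B] v] x(1)])
            show "arr X' B D v (s B f) \<in> obj X' D" by (rule functorD(1)[OF fX' A(2)[OF B] D v s(1)[OF B]])
            show "arr X' C D w (s C g) \<in> obj X' D" by (rule functorD(1)[OF fX' A(2)[OF C] D w s(1)[OF C]])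
            show "\<rho> D (arr X A D (compose (carrier A) v f) x, arr X' B D v (s B f)) =
                \<rho> D (arr X A D (compose (carrier A) v f) x, arr X' C D w (s C g))"
              using sD[OF B D v] sD[OF C D w] eq by simp
          qed
        qed
        then obtain x' where x': "x' \<in> obj X' A" "\<And>B f. (B, f) \<in> I \<Longrightarrow> arr X' A B f x' = s B f"
          using cov_sheafD(3)[OF X' local(1)] by blast
        have xx: "(x, x') \<in> obj ?Y A" using x x' by (simp add: objY)
        have "\<rho> A (x, x') = c"
        proof (rule cov_sheafD(2)[OF Es local(1) nat_transD(1)[OF \<rho> A(1) xx] local(2)])
          fix B f assume B: "(B, f) \<in> I"
          show "arr E A B f (\<rho> A (x, x')) = arr E A B f c"
            using nat_transD(2)[OF \<rho> A(1) A(2)[OF B] A(3)[OF B] xx] s(2)[OF B] x'(2)[OF B] by (simp add: arrY)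
        qed
        then show "\<exists>x'\<in>obj X' A. \<rho> A (x, x') = c" using x'(1) by blast
      qed
    qed
    \<comment> \<open>The isomorphism between \<open>Z\<close> and \<open>E\<close> carries
      \<open>\<rho>\<close> and \<open>q0\<close> over to \<open>Z\<close>.\<close>
    define \<phi> where "\<phi> = nat_comp \<theta> \<rho>"
    define q where "q = nat_comp q0 \<eta>"
    have \<phi>n: "nat_trans K ?Y Z \<phi>" unfolding \<phi>_def by (rule nat_trans_comp[OF \<rho> \<theta>])
    have qn: "nat_trans K Z Q q" unfolding q_def by (rule nat_trans_comp[OF \<eta>n q0])
    have \<eta>\<phi>: "\<eta> A (\<phi> A z) = \<rho> A z" if "algebra K A" "z \<in> obj ?Y A" for A z
      using \<eta>\<theta> that nat_transD(1)[OF \<rho> that] unfolding \<phi>_def nat_eq_def nat_comp_def by blast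
    have q\<phi>: "q A (\<phi> A (x, x')) = \<pi> A x" if "algebra K A" "x \<in> obj X A" "x' \<in> obj X' A" for A x x'
      using \<eta>\<phi>[OF that(1), of "(x, x')"] q0D[OF that] that by (simp add: q_def nat_comp_def objY)
    have "nat_iso K ?Y (fibre_prod X \<pi> Z q) (?mor \<phi>)"
    proof (rule nat_isoI[OF fY])
      show "nat_trans K ?Y (fibre_prod X \<pi> Z q) (?mor \<phi>)"
      proof (rule nat_transI)
        fix A :: "'u alg" and z assume "algebra K A" "z \<in> obj ?Y A"
        then show "?mor \<phi> A z \<in> obj (fibre_prod X \<pi> Z q) A"
          using nat_transD(1)[OF \<phi>n] q\<phi> by (auto simp: objY fibre_prod_def)
      next
        fix A B :: "'u alg" and f z assume "algebra K A" "algebra K B" "f \<in> alg_hom K A B" "z \<in> obj ?Y A"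
        then show "?mor \<phi> B (arr ?Y A B f z) = arr (fibre_prod X \<pi> Z q) A B f (?mor \<phi> A z)"
          using nat_transD(2)[OF \<phi>n, of A B f z] by (auto simp: objY arrY fibre_prod_def)
      qed
      fix A :: "'u alg" assume A: "algebra K A"
      show "bij_betw (?mor \<phi> A) (obj ?Y A) (obj (fibre_prod X \<pi> Z q) A)"
        unfolding bij_betw_def
      proof (intro conjI equalityI subsetI)
        show "inj_on (?mor \<phi> A) (obj ?Y A)"
        proof (rule inj_onI)
          fix y z assume yz: "y \<in> obj ?Y A" "z \<in> obj ?Y A" "?mor \<phi> A y = ?mor \<phi> A z"
          obtain x x' w w' where yz': "y = (x, x')" "z = (w, w')" by (cases y, cases z) auto
          have "\<phi> A y = \<phi> A z" "x = w" using yz(3) yz' by auto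
          then have "\<rho> A (x, x') = \<rho> A (x, w')" using \<eta>\<phi>[OF A yz(1)] \<eta>\<phi>[OF A yz(2)] yz' by simp
          then have "x' = w'" using \<rho>_inj[OF A, of x x' w'] yz yz' by (auto simp: objY)
          then show "y = z" using yz' \<open>x = w\<close> by simp
        qed
      next
        fix z assume "z \<in> ?mor \<phi> A ` obj ?Y A"
        then show "z \<in> obj (fibre_prod X \<pi> Z q) A"
          using nat_transD(1)[OF \<phi>n A] q\<phi>[OF A] by (auto simp: objY fibre_prod_def)
      next
        fix y assume "y \<in> obj (fibre_prod X \<pi> Z q) A"
        then obtain x z where y: "y = (x, z)" "x \<in> obj X A" "z \<in> obj Z A" "\<pi> A x = q A z"
          by (auto simp: fibre_prod_def)
        have c: "\<eta> A z \<in> obj E A" by (rule nat_transD(1)[OF \<eta>n A y(3)])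
        then have "gen K ?Y E \<rho> A (\<eta> A z)" using ls A unfolding locally_surjective_def by blast
        then obtain x' where x': "x' \<in> obj X' A" "\<rho> A (x, x') = \<eta> A z"
          using sur[of A "\<eta> A z"] y by (auto simp: q_def nat_comp_def)
        have "\<phi> A (x, x') = z" using x'(2) \<theta>\<eta> A y(3) by (simp add: \<phi>_def nat_comp_def nat_eq_def)
        then show "y \<in> ?mor \<phi> A ` obj ?Y A" using y x' by (intro image_eqI[of _ _ "(x, x')"]) (auto simp: objY)
      qed
    qed
    moreover have "nat_eq K ?Y (nat_comp q \<phi>) (nat_comp \<pi> (\<lambda>A (x, x'). x))"
      by (auto simp: nat_eq_def nat_comp_def objY q\<phi>)
    moreover have "constant_on_orbits K G X a X' a' \<phi>"
      by (auto simp: constant_on_orbits_def \<phi>_def nat_comp_def \<rho>_act)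
    ultimately show "\<exists>\<phi> q. nat_trans K ?Y Z \<phi> \<and> nat_trans K Z Q q \<and>
        nat_eq K ?Y (nat_comp q \<phi>) (nat_comp \<pi> (\<lambda>A (x, x'). x)) \<and>
        constant_on_orbits K G X a X' a' \<phi> \<and> nat_iso K ?Y (fibre_prod X \<pi> Z q) (?mor \<phi>)"
      using \<phi>n qn by blast
  next
    assume "\<exists>\<phi> q. nat_trans K ?Y Z \<phi> \<and> nat_trans K Z Q q \<and>
        nat_eq K ?Y (nat_comp q \<phi>) (nat_comp \<pi> (\<lambda>A (x, x'). x)) \<and>
        constant_on_orbits K G X a X' a' \<phi> \<and> nat_iso K ?Y (fibre_prod X \<pi> Z q) (?mor \<phi>)"
    then obtain \<phi> q where \<phi>: "nat_trans K ?Y Z \<phi>" and q: "nat_trans K Z Q q"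
      and q\<phi>0: "nat_eq K ?Y (nat_comp q \<phi>) (nat_comp \<pi> (\<lambda>A (x, x'). x))"
      and const: "constant_on_orbits K G X a X' a' \<phi>" and iso: "nat_iso K ?Y (fibre_prod X \<pi> Z q) (?mor \<phi>)"
      by blast
    have q\<phi>: "q A (\<phi> A (x, x')) = \<pi> A x" if "algebra K A" "x \<in> obj X A" "x' \<in> obj X' A" for A x x'
      using q\<phi>0 that unfolding nat_eq_def nat_comp_def objY by fastforce
    have bij: "bij_betw (?mor \<phi> A) (obj ?Y A) (obj (fibre_prod X \<pi> Z q) A)" if "algebra K A" for A
      by (rule nat_isoD(2)[OF iso that])
    have \<phi>_act: "\<phi> A (a A g x, a' A g x') = \<phi> A (x, x')"
      if "algebra K A" "g \<in> obj G A" "x \<in> obj X A" "x' \<in> obj X' A" for A g x x'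
      using const that unfolding constant_on_orbits_def by blast
    \<comment> \<open>\<open>\<phi>\<close> inherits local surjectivity from \<open>\<pi>\<close>:
      wherever the image of \<open>z\<close> in \<open>Q\<close> lifts to some \<open>x\<close>, the
      pair of \<open>x\<close> and \<open>z\<close> is a point of the fibre product, hence comes
      from the product, and \<open>z\<close> is a value of \<open>\<phi>\<close>.\<close>
    have "gen K ?Y Z \<phi> A z" if "gen K X Q \<pi> A c" "z \<in> obj Z A" "q A z = c" for A c z
      using that
    proof (induction arbitrary: z)
      case (image A x)
      then have "(x, z) \<in> obj (fibre_prod X \<pi> Z q) A" by (simp add: fibre_prod_def)
      then have "(x, z) \<in> ?mor \<phi> A ` obj ?Y A" using bij[OF image(1)] unfolding bij_betw_def by simp
      then obtain x' where x': "(x, x') \<in> obj ?Y A" "z = \<phi> A (x, x')" by auto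
      show ?case unfolding x'(2) by (rule gen.image[OF image(1) x'(1)])
    next
      case (local A I c)
      note A = covers_alg[OF local(1)]
      show ?case
      proof (rule gen.local[OF local(1) local(5)])
        fix B f assume B: "(B, f) \<in> I"
        show "gen K ?Y Z \<phi> B (arr Z A B f z)"
          by (rule local(4)[OF B functorD(1)[OF fZ A(1) A(2)[OF B] A(3)[OF B] local(5)]])
            (use nat_transD(2)[OF q A(1) A(2)[OF B] A(3)[OF B] local(5)] local(6) in simp)
      qed
    qed
    moreover have "locally_surjective K X Q \<pi>"
      by (rule coequaliser_locally_surjective[OF inf fX assms(10)[unfolded quotient_faisceau_def]])
    ultimately have ls: "locally_surjective K ?Y Z \<phi>"
      using nat_transD(1)[OF q] unfolding locally_surjective_def by blast
    \<comment> \<open>The fibres of \<open>\<phi>\<close> are orbits: effectivity for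
      \<open>X\<close> moves \<open>x\<close> to \<open>y\<close>, and injectivity of the given
      isomorphism then forces the second components to agree.\<close>
    have fib: "\<exists>g\<in>obj G A. (y, y') = (a A g x, a' A g x')"
      if A: "algebra K A" and x: "x \<in> obj X A" "x' \<in> obj X' A" and y: "y \<in> obj X A" "y' \<in> obj X' A"
        and eq: "\<phi> A (x, x') = \<phi> A (y, y')" for A x x' y y'
    proof -
      have "\<pi> A x = \<pi> A y" using q\<phi>[OF A x] q\<phi>[OF A y] eq by simp
      then obtain g where g: "g \<in> obj G A" "y = a A g x"
        using GX.quotient_effective[OF \<iota> inj_on_id2 assms(10) A x(1) y(1)] by blast
      have gx: "a' A g x' \<in> obj X' A" using GY.act_closed[OF A g(1), of "(x, x')"] x by (simp add: objY)
      have "?mor \<phi> A (y, y') = ?mor \<phi> A (y, a' A g x')"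
        using \<phi>_act[OF A g(1) x] eq g(2) by simp
      then have "(y, y') = (y, a' A g x')"
        using bij[OF A] y gx unfolding bij_betw_def inj_on_def objY by blast
      then show ?thesis using g by auto
    qed
    have "is_coequaliser K (prod_fun G ?Y) ?Y (\<lambda>A (g, x). ?d A g x) (\<lambda>A (g, x). x) Z \<phi>"
      unfolding is_coequaliser_def
    proof (intro conjI allI impI assms(11) \<phi>)
      show "nat_eq K (prod_fun G ?Y) (nat_comp \<phi> (\<lambda>A (g, x). ?d A g x)) (nat_comp \<phi> (\<lambda>A (g, x). x))"
        by (auto simp: nat_eq_def nat_comp_def prod_fun_def \<phi>_act)
    next
      fix T :: "('u, 'v) kfunctor" and f
      assume "faisceau K T \<and> nat_trans K ?Y T f \<and>
        nat_eq K (prod_fun G ?Y) (nat_comp f (\<lambda>A (g, x). ?d A g x)) (nat_comp f (\<lambda>A (g, x). x))"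
      then have T: "faisceau K T" and f: "nat_trans K ?Y T f"
        and fc: "nat_eq K (prod_fun G ?Y) (nat_comp f (\<lambda>A (g, x). ?d A g x)) (nat_comp f (\<lambda>A (g, x). x))"
        by blast+
      note Ts = faisceau_cov_sheaf[OF T]
      have f_act: "f A (a A g x, a' A g x') = f A (x, x')"
        if "algebra K A" "g \<in> obj G A" "x \<in> obj X A" "x' \<in> obj X' A" for A g x x'
        using fc that unfolding nat_eq_def nat_comp_def prod_fun_def by fastforce
      have "f A y = f A y'" if A: "algebra K A" "y \<in> obj ?Y A" "y' \<in> obj ?Y A" "\<phi> A y = \<phi> A y'" for A y y'
      proof -
        obtain x x' w w' where yy: "y = (x, x')" "y' = (w, w')" by (cases y, cases y') auto
        then obtain g where "g \<in> obj G A" "(w, w') = (a A g x, a' A g x')"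
          using fib[OF A(1), of x x' w w'] A by (auto simp: objY)
        then show ?thesis using f_act[OF A(1), of g x x'] A yy by (auto simp: objY)
      qed
      from locally_surjective_extend[OF inf fY fZ \<phi> ls Ts f this]
      obtain h where h: "nat_trans K Z T h" "nat_eq K ?Y (nat_comp h \<phi>) f" by blast
      have "nat_eq K Z h' h" if h': "nat_trans K Z T h'" "nat_eq K ?Y (nat_comp h' \<phi>) f" for h'
        by (rule locally_surjective_unique[OF \<phi> ls Ts h'(1) h(1)])
          (use h(2) h'(2) in \<open>simp add: nat_eq_def nat_comp_def\<close>)
      then show "\<exists>h. nat_trans K Z T h \<and> nat_eq K ?Y (nat_comp h \<phi>) f \<and>
          (\<forall>h'. nat_trans K Z T h' \<and> nat_eq K ?Y (nat_comp h' \<phi>) f \<longrightarrow> nat_eq K Z h' h)"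
        using h by blast
    qed
    \<comment> \<open>\<open>Z\<close> with \<open>\<phi>\<close> is itself a quotient of the
      product, so it can be taken as \<open>E\<close>.\<close>
    then have "associated_fibration K G X a X' a' Z \<phi>"
      unfolding associated_fibration_def quotient_faisceau_def .
    moreover have "isomorphic K Z Z"
      unfolding isomorphic_def nat_iso_def
      by (intro exI[of _ "\<lambda>A x. x"] conjI nat_trans_id) (simp_all add: nat_eq_def nat_comp_def)
    ultimately show "\<exists>(E :: ('u, 'v) kfunctor) \<rho>. associated_fibration K G X a X' a' E \<rho> \<and> isomorphic K Z E"
      by blast
  qed
qed

end
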